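(* Let $n\in\{1,2,3\}$. The map $\pi_n:P_n\to\mathcal P_{n-1}$ has image $\Sigma_{n-1}$, and its restriction $P_n\setminus P_{n-1}\to\Sigma_{n-1}\setminus P_{n-1}$ is a homogeneous fibration for the group $\mathcal G_{n-1}$ (i.e. $\mathcal G_{n-1}$ acts transitively on both $P_n\setminus P_{n-1}$ and $\Sigma_{n-1}\setminus P_{n-1}$ and the map is a $\mathcal G_{n-1}$-equivariant fibration of homogeneous spaces).
   Context: Let $A_0=\mathbb R\subset A_1=\mathbb C\subset A_2=\mathbb H\subset A_3=\mathbb O$ be the normed real division algebras. $H_m$ is the real vector space of $3\times3$ Hermitian matrices over $A_m$ ($\bar x_{ij}=x_{ji}$), with trace $\mathrm{tr}$ and Jordan product $X\circ Y=\frac12(XY+YX)$; the resulting Jordan algebra is $J_m$. Every $X\in H_m$ can be brought by $\mathrm{Aut}(J_m)$ to real diagonal form $\mathrm{Diag}(\lambda_1,\lambda_2,\lambda_3)$; $\lambda_1\le\lambda_2\le\lambda_3$ are the eigenvalues of $X$, and $\det X=\lambda_1\lambda_2\lambda_3$ is a cubic polynomial on $H_m$. The projective plane $P_m\subset H_m$ is the $\mathrm{Aut}(J_m)$-orbit of $\mathrm{Diag}(1,0,0)$ ($\mathbb RP^2,\mathbb CP^2,\mathbb HP^2,\mathbb OP^2$ for $m=0,1,2,3$). Put $H_m(1)=\{X\in H_m:\mathrm{tr}\,X=1\}$, let $\mathcal P_m$ be the real projective space of $H_m$, and regard $P_m\subset H_m(1)\subset\mathcal P_m$ (so $\mathcal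 P_m$ is the projective completion of the affine space $H_m(1)$). $\Lambda_m^+\subset H_m(1)$ is the set of matrices with $\lambda_1>0$ (positive definite), and $\Sigma_m$ is its boundary; so $\Sigma_m=\{X\in H_m(1):0=\lambda_1\le\lambda_2\le\lambda_3\}\supset P_m$. $\mathcal G_m=SL(3,A_m)$ for $m=0,1,2$, acting on $H_m$ by $X\mapsto AXA^*$ (for $m=2$, $SL(3,\mathbb H)$ is the group of $A\in GL(3,\mathbb H)$ whose action preserves $\det$), and $\mathcal G_3=E_6^{-26}$ is the group of real linear transformations of $H_3$ preserving $\det$. $\mathcal G_m$ acts on $\mathcal P_m$ preserving $P_m$. The inclusions $\mathcal G_0\subset\mathcal G_1\subset\mathcal G_2$ are those of matrix groups, and $\mathcal G_2\subset\mathcal G_3$ is the subgroup $SL(3,\mathbb H)$ given as the identity component of the centralizer in $E_6^{-26}$ of the group $Sp(1)$ of automorphisms of $J_3$ fixing $J_2$ pointwise; it acts on $H_2\subset H_3$ by $X\mapsto AXA^*$ ($A\in SL(3,\mathbb H)$, $X\in H_2$). Thus $\mathcal G_{n-1}$ acts on $P_n$. $\pi_n:H_n\to H_{n-1}$ applies the orthogonal projection $A_n\to A_{n-1}$ to each matrix entry; since it preserves the trace it induces a map $\pi_n:P_n\to H_{n-1}(1)\subset\mathcal P_{n-1}$, which is $\mathcal G_{n-1}$-equivariant and is the identity on $P_{n-1}\subset P_n$. *)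

theory Defs
  imports "HOL-Analysis.Analysis" "HOL-Algebra.Group_Action"
begin

section \<open>Quaternions and octonions by Cayley--Dickson doubling\<close>

text \<open>Being built from pairs, the types inherit the Euclidean structure of \<open>\<real>\<^sup>4\<close> and \<open>\<real>\<^sup>8\<close>
  from the library; the inner product is the real part of \<open>x \<cdot> cnj y\<close>.\<close>

type_synonym quaternion = "complex \<times> complex"
type_synonym octonion = "quaternion \<times> quaternion"

definition qcnj :: "quaternion \<Rightarrow> quaternion" where
  "qcnj x = (cnj (fst x), - snd x)"

definition qmult :: "quaternion \<Rightarrow> quaternion \<Rightarrow> quaternion" where
  "qmult x y = (fst x * fst y - cnj (snd y) * snd x, snd y * fst x + snd x * cnj (fst y))"

definition ocnj :: "octonion \<Rightarrow> octonion" where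
  "ocnj x = (qcnj (fst x), - snd x)"

definition omult :: "octonion \<Rightarrow> octonion \<Rightarrow> octonion"  (infixl "\<odot>" 70) where
  "x \<odot> y = (qmult (fst x) (fst y) - qmult (qcnj (snd y)) (snd x),
            qmult (snd y) (fst x) + qmult (snd x) (qcnj (fst y)))"

definition oct_of_quat :: "quaternion \<Rightarrow> octonion" where
  "oct_of_quat q = (q, 0)"

definition oct_of_complex :: "complex \<Rightarrow> octonion" where
  "oct_of_complex z = oct_of_quat (z, 0)"

definition oct_of_real :: "real \<Rightarrow> octonion" where
  "oct_of_real t = oct_of_complex (complex_of_real t)"

definition oct_Re :: "octonion \<Rightarrow> real" where
  "oct_Re x = Re (fst (fst x))"

text \<open>The chain \<open>\<real> \<subset> \<complex> \<subset> \<H> \<subset> \<O>\<close>, all realised inside the octonions.\<close>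

definition div_alg :: "nat \<Rightarrow> octonion set" where
  "div_alg m = (if m = 0 then range oct_of_real
                else if m = 1 then range oct_of_complex
                else if m = 2 then range oct_of_quat
                else UNIV)"

section \<open>Hermitian matrices and the Jordan algebras\<close>

type_synonym omat = "octonion^3^3"

definition mmult :: "omat \<Rightarrow> omat \<Rightarrow> omat"  (infixl "\<odot>\<odot>" 70) where
  "X \<odot>\<odot> Y = (\<chi> i j. \<Sum>k\<in>UNIV. X $ i $ k \<odot> Y $ k $ j)"

definition adjoint_mat :: "omat \<Rightarrow> omat" where
  "adjoint_mat X = (\<chi> i j. ocnj (X $ j $ i))"

definition Diag :: "real \<Rightarrow> real \<Rightarrow> real \<Rightarrow> omat" where
  "Diag a b c = (\<chi> i j. if i = j then oct_of_real ((vector [a, b, c] :: real^3) $ i) else 0)"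

definition mat_over :: "nat \<Rightarrow> omat set" where
  "mat_over m = {X. \<forall>i j. X $ i $ j \<in> div_alg m}"

definition Herm :: "nat \<Rightarrow> omat set" where
  "Herm m = {X \<in> mat_over m. \<forall>i j. ocnj (X $ i $ j) = X $ j $ i}"

definition herm_trace :: "omat \<Rightarrow> real" where
  "herm_trace X = (\<Sum>i\<in>UNIV. oct_Re (X $ i $ i))"

definition jordan_prod :: "omat \<Rightarrow> omat \<Rightarrow> omat" where
  "jordan_prod X Y = (1/2) *\<^sub>R (X \<odot>\<odot> Y + Y \<odot>\<odot> X)"

text \<open>The general linear group of a real subspace \<open>V\<close>. Transformations of \<open>V\<close> are represented by
  functions that take the value \<^const>\<open>undefined\<close> outside \<open>V\<close>.\<close>

definition GL_on :: "'v::real_vector set \<Rightarrow> ('v \<Rightarrow> 'v) set" where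
  "GL_on V = {g \<in> Bij V. (\<forall>x\<in>V. \<forall>y\<in>V. g (x + y) = g x + g y) \<and>
                         (\<forall>c. \<forall>x\<in>V. g (c *\<^sub>R x) = c *\<^sub>R g x)}"

definition jordan_aut :: "nat \<Rightarrow> (omat \<Rightarrow> omat) set" where
  "jordan_aut m = {g \<in> GL_on (Herm m).
     \<forall>X\<in>Herm m. \<forall>Y\<in>Herm m. g (jordan_prod X Y) = jordan_prod (g X) (g Y)}"

definition has_eigenvalues :: "nat \<Rightarrow> omat \<Rightarrow> real \<Rightarrow> real \<Rightarrow> real \<Rightarrow> bool" where
  "has_eigenvalues m X l1 l2 l3 \<longleftrightarrow>
     l1 \<le> l2 \<and> l2 \<le> l3 \<and> (\<exists>g\<in>jordan_aut m. g X = Diag l1 l2 l3)"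

definition herm_det :: "nat \<Rightarrow> omat \<Rightarrow> real" where
  "herm_det m X = (THE d. \<exists>l1 l2 l3. has_eigenvalues m X l1 l2 l3 \<and> d = l1 * l2 * l3)"

definition Herm1 :: "nat \<Rightarrow> omat set" where
  "Herm1 m = {X \<in> Herm m. herm_trace X = 1}"

text \<open>The three sets \<open>P\<^sub>m\<close>, \<open>\<Lambda>\<^sub>m\<^sup>+\<close> and \<open>\<Sigma>\<^sub>m\<close> in the affine space \<open>H\<^sub>m(1)\<close>.\<close>

definition Plane :: "nat \<Rightarrow> omat set" where
  "Plane m = {g (Diag 1 0 0) | g. g \<in> jordan_aut m}"

definition Lambda_pos :: "nat \<Rightarrow> omat set" where
  "Lambda_pos m = {X \<in> Herm1 m. \<exists>l1 l2 l3. has_eigenvalues m X l1 l2 l3 \<and> 0 < l1}"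

definition Sigma_bd :: "nat \<Rightarrow> omat set" where
  "Sigma_bd m = (top_of_set (Herm1 m)) frontier_of (Lambda_pos m)"

text \<open>Entrywise orthogonal projection onto matrices over the \<open>m\<close>-th algebra; \<open>\<pi>\<^sub>n\<close> is
  \<open>proj_mat (n - 1)\<close>.\<close>

definition orth_proj :: "'v::real_inner set \<Rightarrow> 'v \<Rightarrow> 'v" where
  "orth_proj V x = (THE y. y \<in> V \<and> (\<forall>z\<in>V. orthogonal (x - y) z))"

definition proj_mat :: "nat \<Rightarrow> omat \<Rightarrow> omat" where
  "proj_mat m X = (\<chi> i j. orth_proj (div_alg m) (X $ i $ j))"

section \<open>The groups\<close>

text \<open>\<open>SL(3, \<real>)\<close>, \<open>SL(3, \<complex>)\<close> and \<open>SL(3, \<H>)\<close> as groups of matrices (used for \<open>m \<le> 2\<close> only).\<close>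

definition congruence :: "omat \<Rightarrow> omat \<Rightarrow> omat" where
  "congruence A X = A \<odot>\<odot> X \<odot>\<odot> adjoint_mat A"

definition GL3H :: "omat set" where
  "GL3H = {A \<in> mat_over 2. \<exists>B\<in>mat_over 2. A \<odot>\<odot> B = Diag 1 1 1 \<and> B \<odot>\<odot> A = Diag 1 1 1}"

definition SL3 :: "nat \<Rightarrow> omat set" where
  "SL3 m = (if m = 0 then {(\<chi> i j. oct_of_real (A $ i $ j)) | A :: real^3^3. det A = 1}
            else if m = 1 then {(\<chi> i j. oct_of_complex (A $ i $ j)) | A :: complex^3^3. det A = 1}
            else {A \<in> GL3H. \<forall>X\<in>Herm 2. herm_det 2 (congruence A X) = herm_det 2 X})"

definition E6 :: "(omat \<Rightarrow> omat) set" where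
  "E6 = {g \<in> GL_on (Herm 3). \<forall>X\<in>Herm 3. herm_det 3 (g X) = herm_det 3 X}"

definition G_lin :: "nat \<Rightarrow> (omat \<Rightarrow> omat) set" where
  "G_lin m = (if m \<le> 2 then {restrict (congruence A) (Herm m) | A. A \<in> SL3 m} else E6)"

definition Sp1 :: "(omat \<Rightarrow> omat) set" where
  "Sp1 = {h \<in> jordan_aut 3. \<forall>X\<in>Herm 2. h X = X}"

definition Sp1_centralizer :: "(omat \<Rightarrow> omat) set" where
  "Sp1_centralizer = {g \<in> E6. \<forall>h\<in>Sp1. compose (Herm 3) g h = compose (Herm 3) h g}"

text \<open>The image of \<open>\<G>\<^sub>n\<^sub>-\<^sub>1 \<subset> \<G>\<^sub>n\<close> in the general linear group of \<open>H\<^sub>n\<close>;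
  its elements preserve \<open>H\<^sub>n\<^sub>-\<^sub>1\<close> and act on it by restriction. Sets of transformations carry
  the library's topology of pointwise convergence on the function type, which on linear
  transformations of a finite-dimensional space is the usual topology.\<close>

definition G_sub :: "nat \<Rightarrow> (omat \<Rightarrow> omat) set" where
  "G_sub n = (if n \<le> 2 then {restrict (congruence A) (Herm n) | A. A \<in> SL3 (n - 1)}
              else connected_component_set Sp1_centralizer (\<lambda>X\<in>Herm 3. X))"

section \<open>Projective spaces\<close>

definition proj_space :: "'v::real_normed_vector set \<Rightarrow> 'v set set" where
  "proj_space V = {span {x} | x. x \<in> V \<and> x \<noteq> 0}"

definition proj_topology :: "'v::real_normed_vector set \<Rightarrow> 'v set topology" where
  "proj_topology V = topology (\<lambda>U. U \<subseteq> proj_space V \<and>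
     openin (top_of_set (V - {0})) {x \<in> V - {0}. span {x} \<in> U})"

lemma openin_proj_topology:
  "openin (proj_topology V) U \<longleftrightarrow>
     U \<subseteq> proj_space V \<and> openin (top_of_set (V - {0})) {x \<in> V - {0}. span {x} \<in> U}"
proof -
  let ?P = "\<lambda>U. {x \<in> V - {0}. span {x} \<in> U}"
  let ?T = "\<lambda>U. U \<subseteq> proj_space V \<and> openin (top_of_set (V - {0})) (?P U)"
  have "istopology ?T"
    unfolding istopology_def
  proof (intro conjI allI impI)
    fix S T assume "?T S" "?T T"
    moreover have "?P (S \<inter> T) = ?P S \<inter> ?P T" by auto
    ultimately show "S \<inter> T \<subseteq> proj_space V" "openin (top_of_set (V - {0})) (?P (S \<inter> T))"
      by auto
  next
    fix K assume K: "\<forall>S\<in>K. ?T S"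
    have "?P (\<Union>K) = (\<Union>S\<in>K. ?P S)" by auto
    with K show "\<Union>K \<subseteq> proj_space V" "openin (top_of_set (V - {0})) (?P (\<Union>K))"
      by (auto intro!: openin_Union)
  qed
  then show ?thesis
    unfolding proj_topology_def by (simp add: topology_inverse')
qed

text \<open>The embedding of the affine space \<open>H\<^sub>m(1)\<close> into its projective completion.\<close>

definition to_proj :: "omat set \<Rightarrow> omat set set" where
  "to_proj S = (\<lambda>X. span {X}) ` S"

section \<open>Homogeneous fibrations\<close>

definition locally_trivial_fibration :: "'a topology \<Rightarrow> 'b topology \<Rightarrow> ('a \<Rightarrow> 'b) \<Rightarrow> bool" where
  "locally_trivial_fibration E B p \<longleftrightarrow>
     continuous_map E B p \<and> p ` topspace E = topspace B \<and>
     (\<forall>b\<in>topspace B. \<exists>U h. openin B U \<and> b \<in> U \<and>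
        homeomorphic_map (subtopology E {x \<in> topspace E. p x \<in> U})
          (prod_topology (subtopology B U) (subtopology E {x \<in> topspace E. p x = b})) h \<and>
        (\<forall>x\<in>topspace E. p x \<in> U \<longrightarrow> fst (h x) = p x))"

definition continuous_transitive_action ::
  "('g::topological_space, 'r) monoid_scheme \<Rightarrow> 'a topology \<Rightarrow> ('g \<Rightarrow> 'a \<Rightarrow> 'a) \<Rightarrow> bool" where
  "continuous_transitive_action G E \<phi> \<longleftrightarrow>
     transitive_action G (topspace E) \<phi> \<and>
     continuous_map (prod_topology (top_of_set (carrier G)) E) E (\<lambda>(g, x). \<phi> g x)"

definition homogeneous_fibration ::
  "('g::topological_space, 'r) monoid_scheme \<Rightarrow> 'a topology \<Rightarrow> ('g \<Rightarrow> 'a \<Rightarrow> 'a) \<Rightarrow>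
   'b topology \<Rightarrow> ('g \<Rightarrow> 'b \<Rightarrow> 'b) \<Rightarrow> ('a \<Rightarrow> 'b) \<Rightarrow> bool" where
  "homogeneous_fibration G E \<phi> B \<psi> p \<longleftrightarrow>
     continuous_transitive_action G E \<phi> \<and>
     continuous_transitive_action G B \<psi> \<and>
     (\<forall>g\<in>carrier G. \<forall>x\<in>topspace E. p (\<phi> g x) = \<psi> g (p x)) \<and>
     locally_trivial_fibration E B p"

text \<open>The total space \<open>P\<^sub>n - P\<^sub>n\<^sub>-\<^sub>1\<close> and the base \<open>\<Sigma>\<^sub>m - P\<^sub>m\<close>, as subspaces of the projective spaces;
  linear maps act on lines by taking images.\<close>

definition total_space :: "nat \<Rightarrow> omat set topology" where
  "total_space n = subtopology (proj_topology (Herm n)) (to_proj (Plane n) - to_proj (Plane (n - 1)))"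

definition base_space :: "nat \<Rightarrow> omat set topology" where
  "base_space m = subtopology (proj_topology (Herm m)) (to_proj (Sigma_bd m) - to_proj (Plane m))"

definition line_action :: "'v set set \<Rightarrow> ('v \<Rightarrow> 'v) \<Rightarrow> 'v set \<Rightarrow> 'v set" where
  "line_action S g = (\<lambda>L\<in>S. g ` L)"

end

theory Submission
  imports Defs
begin

text \<open>
  A matrix of \<open>H\<^sub>m\<^sub>+\<^sub>1\<close> splits as \<open>(S, v)\<close> with \<open>S \<in> H\<^sub>m\<close> and a row \<open>v\<close> of three elements of
  \<open>A\<^sub>m\<close>. In these coordinates \<open>det (S, v) = det S - v S v\<^sup>*\<close>, the adjoint is \<open>(S\<^sup>\<sharp> - v\<^sup>* v, - v S)\<close>,
  and \<open>A \<in> SL(3, A\<^sub>m)\<close> acts by \<open>(A S A\<^sup>*, v A\<^sup>-\<^sup>1)\<close>. So the projective plane is given by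
  \<open>S\<^sup>\<sharp> = v\<^sup>* v\<close>, \<open>v S = 0\<close>, \<open>tr S = 1\<close>; its projection consists of the singular positive semidefinite
  \<open>S\<close>, and over such an \<open>S\<close> of rank two the vector \<open>v\<close> is determined up to a unit of \<open>A\<^sub>m\<close> on the
  left. For the octonionic plane, the centralizer of \<open>Sp(1)\<close> consists of exactly the maps above, and
  \<open>SL(3, \<H>)\<close> is connected by Gaussian elimination.
\<close>

section \<open>Octonion arithmetic\<close>

text \<open>Determinant, eigenvalues and the plane are defined through abstract Jordan
  automorphisms, so nothing can be computed before they are tied to polynomials. The link is that
  every automorphism preserves the trace; traces of powers then control det and the adjoint
  \<open>X\<^sup>#\<close>. Two obstacles shape the rest. Octonionic matrices do not associate, so
  \<open>congruence\<close> cannot be composed freely on H_3; the splitting replaces it by a map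
  built from quaternion products only, and since the vanishing of \<open>X\<^sup>#\<close> can be
  read off from det alone, any map preserving det respects the plane up to scalars. Further, the
  groups preserve det but not the trace, so they act on lines and not on the slice of trace 1:
  orbits are computed up to a nonzero scalar, the fibration is built on the slice, and both pass to
  lines through the chart that sends a point to its span. Transitivity on the base is inherited from
  the total space. The third group is given as an identity component, hence the need for
  connectedness.\<close>

lemmas oct_unfold = omult_def ocnj_def qmult_def qcnj_def oct_of_real_def oct_of_complex_def
  oct_of_quat_def oct_Re_def

abbreviation oct_one :: octonion where "oct_one \<equiv> oct_of_real 1"

lemma omult_add_left: "(x + y) \<odot> z = x \<odot> z + y \<odot> z"
  and omult_add_right: "x \<odot> (y + z) = x \<odot> y + x \<odot> z"
  and omult_diff_left: "(x - y) \<odot> z = x \<odot> z - y \<odot> z"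
  and omult_diff_right: "x \<odot> (y - z) = x \<odot> y - x \<odot> z"
  and omult_minus_left: "(- x) \<odot> y = - (x \<odot> y)"
  and omult_minus_right: "x \<odot> (- y) = - (x \<odot> y)"
  and omult_zero_left [simp]: "0 \<odot> y = 0"
  and omult_zero_right [simp]: "x \<odot> 0 = 0"
  by (simp_all add: oct_unfold prod_eq_iff algebra_simps)

lemma omult_scaleR_left [simp]: "(c *\<^sub>R x) \<odot> y = c *\<^sub>R (x \<odot> y)"
  and omult_scaleR_right [simp]: "x \<odot> (c *\<^sub>R y) = c *\<^sub>R (x \<odot> y)"
  by (simp_all add: oct_unfold prod_eq_iff scaleR_conv_of_real algebra_simps)

lemma omult_sum_left: "(\<Sum>i\<in>A. f i) \<odot> y = (\<Sum>i\<in>A. f i \<odot> y)"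
  and omult_sum_right: "y \<odot> (\<Sum>i\<in>A. f i) = (\<Sum>i\<in>A. y \<odot> f i)"
  by (induction A rule: infinite_finite_induct) (simp_all add: omult_add_left omult_add_right)

lemma oct_of_real_mult_left [simp]: "oct_of_real c \<odot> x = c *\<^sub>R x"
  and oct_of_real_mult_right [simp]: "x \<odot> oct_of_real c = c *\<^sub>R x"
  by (simp_all add: oct_unfold prod_eq_iff scaleR_conv_of_real algebra_simps)

lemma oct_of_real_0 [simp]: "oct_of_real 0 = 0"
  and oct_of_real_add: "oct_of_real (a + b) = oct_of_real a + oct_of_real b"
  and oct_of_real_diff: "oct_of_real (a - b) = oct_of_real a - oct_of_real b"
  and oct_of_real_minus: "oct_of_real (- a) = - oct_of_real a"
  and oct_of_real_scaleR: "c *\<^sub>R oct_of_real a = oct_of_real (c * a)"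
  by (simp_all add: oct_unfold prod_eq_iff scaleR_conv_of_real)

lemma oct_of_real_eq_iff [simp]: "oct_of_real a = oct_of_real b \<longleftrightarrow> a = b"
  by (simp add: oct_unfold)

lemma oct_Re_of_real [simp]: "oct_Re (oct_of_real a) = a"
  by (simp add: oct_unfold)

lemma oct_Re_add [simp]: "oct_Re (x + y) = oct_Re x + oct_Re y"
  and oct_Re_diff [simp]: "oct_Re (x - y) = oct_Re x - oct_Re y"
  and oct_Re_minus [simp]: "oct_Re (- x) = - oct_Re x"
  and oct_Re_scaleR [simp]: "oct_Re (c *\<^sub>R x) = c * oct_Re x"
  and oct_Re_zero [simp]: "oct_Re 0 = 0"
  and oct_Re_cnj [simp]: "oct_Re (ocnj x) = oct_Re x"
  by (simp_all add: oct_unfold)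

lemma ocnj_add: "ocnj (x + y) = ocnj x + ocnj y"
  and ocnj_diff: "ocnj (x - y) = ocnj x - ocnj y"
  and ocnj_minus: "ocnj (- x) = - ocnj x"
  and ocnj_scaleR [simp]: "ocnj (c *\<^sub>R x) = c *\<^sub>R ocnj x"
  and ocnj_zero [simp]: "ocnj 0 = 0"
  and ocnj_of_real [simp]: "ocnj (oct_of_real a) = oct_of_real a"
  and ocnj_ocnj [simp]: "ocnj (ocnj x) = x"
  and ocnj_omult: "ocnj (x \<odot> y) = ocnj y \<odot> ocnj x"
  by (simp_all add: oct_unfold prod_eq_iff algebra_simps)

lemma ocnj_eq_iff [simp]: "ocnj x = ocnj y \<longleftrightarrow> x = y"
  by (metis ocnj_ocnj)

lemma ocnj_eq_self_iff: "ocnj x = x \<longleftrightarrow> x = oct_of_real (oct_Re x)"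
  by (auto simp: oct_unfold prod_eq_iff complex_eq_iff)

lemma inner_oct: "inner x y = oct_Re (x \<odot> ocnj y)"
  by (simp add: oct_unfold inner_prod_def inner_complex_def algebra_simps)

lemma ocnj_add_self: "x + ocnj x = oct_of_real (2 * oct_Re x)"
  by (simp add: oct_unfold prod_eq_iff complex_eq_iff)

lemma oct_Re_commute: "oct_Re (x \<odot> y) = oct_Re (y \<odot> x)"
  by (simp add: oct_unfold algebra_simps)

lemma oct_Re_assoc: "oct_Re (x \<odot> (y \<odot> z)) = oct_Re ((x \<odot> y) \<odot> z)"
  by (simp add: oct_unfold algebra_simps)

lemma inner_ocnj [simp]: "inner (ocnj x) (ocnj y) = inner x y"
  by (simp add: oct_unfold inner_prod_def inner_complex_def)

lemma norm_ocnj [simp]: "norm (ocnj x) = norm x"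
  by (simp add: norm_eq_sqrt_inner)

lemma omult_ocnj_self: "x \<odot> ocnj x = oct_of_real (inner x x)"
  and ocnj_omult_self: "ocnj x \<odot> x = oct_of_real (inner x x)"
  by (auto simp add: oct_unfold inner_prod_def inner_complex_def prod_eq_iff complex_eq_iff algebra_simps)

lemma ocnj_cancel_left: "ocnj x \<odot> (x \<odot> y) = inner x x *\<^sub>R y"
  and ocnj_cancel_left': "x \<odot> (ocnj x \<odot> y) = inner x x *\<^sub>R y"
  and ocnj_cancel_right: "(y \<odot> x) \<odot> ocnj x = inner x x *\<^sub>R y"
  and ocnj_cancel_right': "(y \<odot> ocnj x) \<odot> x = inner x x *\<^sub>R y"
  by (auto simp add: oct_unfold inner_prod_def inner_complex_def prod_eq_iff complex_eq_iff algebra_simps)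

lemma inner_omult_left: "inner (x \<odot> y) z = inner y (ocnj x \<odot> z)"
  and inner_omult_right: "inner (y \<odot> x) z = inner y (z \<odot> ocnj x)"
  by (simp_all add: oct_unfold inner_prod_def inner_complex_def algebra_simps)

lemma inner_omult_omult_left: "inner (a \<odot> x) (a \<odot> y) = inner a a * inner x y"
  and inner_omult_omult_right: "inner (x \<odot> a) (y \<odot> a) = inner a a * inner x y"
  by (simp_all only: inner_omult_left[of a] inner_omult_right[of _ a] ocnj_cancel_left
      ocnj_cancel_right inner_scaleR_right)

lemma norm_omult: "norm (x \<odot> y) = norm x * norm y"
  by (simp add: norm_eq_sqrt_inner inner_omult_omult_left real_sqrt_mult)

lemma omult_eq_0_iff [simp]: "x \<odot> y = 0 \<longleftrightarrow> x = 0 \<or> y = 0"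
  by (metis norm_omult mult_eq_0_iff norm_eq_zero)

lemma moufang_middle: "(a \<odot> x) \<odot> (y \<odot> a) = (a \<odot> (x \<odot> y)) \<odot> a"
  by (simp add: oct_unfold prod_eq_iff algebra_simps)

lemma norm_oct_of_real [simp]: "norm (oct_of_real t) = \<bar>t\<bar>"
  by (simp add: oct_unfold norm_prod_def)

lemma moufang_left: "((a \<odot> x) \<odot> a) \<odot> z = a \<odot> (x \<odot> (a \<odot> z))"
  by (simp add: oct_unfold prod_eq_iff algebra_simps)

lemma moufang_right: "((z \<odot> a) \<odot> x) \<odot> a = z \<odot> (a \<odot> (x \<odot> a))"
  \<comment> \<open>Conjugation reverses products and so exchanges the left and right Moufang
    identities.\<close>
  using arg_cong[OF moufang_left[of "ocnj a" "ocnj x" "ocnj z"], of ocnj]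
  by (simp add: ocnj_omult)

lemma omult_flexible: "a \<odot> (x \<odot> a) = (a \<odot> x) \<odot> a"
  by (simp add: oct_unfold prod_eq_iff algebra_simps)

lemma bounded_bilinear_omult: "bounded_bilinear (\<odot>)"
  by (rule bounded_bilinear.intro)
    (auto simp: omult_add_left omult_add_right norm_omult intro: exI[of _ 1])

lemmas continuous_on_omult [continuous_intros] =
  bounded_bilinear.continuous_on[OF bounded_bilinear_omult]

lemma bounded_linear_oct_Re: "bounded_linear oct_Re"
  unfolding oct_Re_def
  by (intro bounded_linear_compose[OF bounded_linear_Re] bounded_linear_compose[OF bounded_linear_fst]
      bounded_linear_fst)

lemma bounded_linear_ocnj: "bounded_linear ocnj"
  by (rule bounded_linear_intro[where K = 1]) (simp_all add: ocnj_add)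

lemma bounded_linear_oct_of_real: "bounded_linear oct_of_real"
  by (rule bounded_linear_intro[where K = 1]) (simp_all add: oct_of_real_add oct_of_real_scaleR)

lemmas continuous_on_oct [continuous_intros] =
  bounded_linear.continuous_on[OF bounded_linear_oct_Re]
  bounded_linear.continuous_on[OF bounded_linear_ocnj]
  bounded_linear.continuous_on[OF bounded_linear_oct_of_real]

subsection \<open>The chain of subalgebras\<close>

text \<open>Membership becomes the vanishing of coordinates, so most facts about the chain can be
  proved for all m at once.\<close>

lemma div_alg_iff:
  "x \<in> div_alg m \<longleftrightarrow> (m \<le> 2 \<longrightarrow> snd x = 0) \<and> (m \<le> 1 \<longrightarrow> snd (fst x) = 0)
     \<and> (m = 0 \<longrightarrow> Im (fst (fst x)) = 0)"
proof -
  consider "m = 0" | "m = 1" | "m = 2" | "m \<ge> 3" by linarith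
  then show ?thesis
    by cases (auto simp: div_alg_def oct_of_real_def oct_of_complex_def oct_of_quat_def
        image_iff prod_eq_iff complex_eq_iff intro: exI[of _ "Re (fst (fst x))"])
qed

lemma div_alg_mono: "m \<le> k \<Longrightarrow> x \<in> div_alg m \<Longrightarrow> x \<in> div_alg k"
  by (auto simp: div_alg_iff)

lemma div_alg_top [simp]: "3 \<le> m \<Longrightarrow> x \<in> div_alg m"
  by (auto simp: div_alg_iff)

lemma div_alg_of_real [simp]: "oct_of_real t \<in> div_alg m"
  and div_alg_0 [simp]: "0 \<in> div_alg m"
  by (auto simp: div_alg_iff oct_unfold)

lemma Pair_0_0 [simp]: "(0, 0) = 0"
  by (simp add: zero_prod_def)

lemma div_alg_add: "x \<in> div_alg m \<Longrightarrow> y \<in> div_alg m \<Longrightarrow> x + y \<in> div_alg m"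
  and div_alg_diff: "x \<in> div_alg m \<Longrightarrow> y \<in> div_alg m \<Longrightarrow> x - y \<in> div_alg m"
  and div_alg_minus: "x \<in> div_alg m \<Longrightarrow> - x \<in> div_alg m"
  and div_alg_mult: "x \<in> div_alg m \<Longrightarrow> y \<in> div_alg m \<Longrightarrow> x \<odot> y \<in> div_alg m"
  and div_alg_scaleR: "x \<in> div_alg m \<Longrightarrow> c *\<^sub>R x \<in> div_alg m"
  and div_alg_ocnj: "x \<in> div_alg m \<Longrightarrow> ocnj x \<in> div_alg m"
  by (auto simp: div_alg_iff oct_unfold)

lemma div_alg_ocnj_iff [simp]: "ocnj x \<in> div_alg m \<longleftrightarrow> x \<in> div_alg m"
  by (metis div_alg_ocnj ocnj_ocnj)

lemma div_alg_sum: "(\<And>i. i \<in> A \<Longrightarrow> f i \<in> div_alg m) \<Longrightarrow> (\<Sum>i\<in>A. f i) \<in> div_alg m"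
  by (induction A rule: infinite_finite_induct) (auto intro: div_alg_add)

lemmas div_alg_intros = div_alg_add div_alg_diff div_alg_minus div_alg_mult div_alg_scaleR
  div_alg_ocnj div_alg_sum

lemma omult_assoc:
  "x \<in> div_alg 2 \<Longrightarrow> y \<in> div_alg 2 \<Longrightarrow> z \<in> div_alg 2 \<Longrightarrow> (x \<odot> y) \<odot> z = x \<odot> (y \<odot> z)"
  by (auto simp: div_alg_iff oct_unfold prod_eq_iff algebra_simps)

text \<open>\<open>cd_unit m\<close> is the Cayley--Dickson generator: \<open>A\<^sub>m\<^sub>+\<^sub>1 = A\<^sub>m \<oplus> A\<^sub>m \<cdot> cd_unit m\<close>, with components
  \<open>cd_fst m\<close> and \<open>cd_snd m\<close>.\<close>

definition cd_unit :: "nat \<Rightarrow> octonion" where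
  "cd_unit m = (if m = 0 then ((\<i>, 0), 0) else if m = 1 then ((0, 1), 0) else (0, (1, 0)))"

definition cd_fst :: "nat \<Rightarrow> octonion \<Rightarrow> octonion" where
  "cd_fst m x = (if m = 0 then oct_of_real (oct_Re x)
                 else if m = 1 then oct_of_complex (fst (fst x))
                 else if m = 2 then oct_of_quat (fst x) else x)"

definition cd_snd :: "nat \<Rightarrow> octonion \<Rightarrow> octonion" where
  "cd_snd m x = (if m = 0 then oct_of_real (Im (fst (fst x)))
                 else if m = 1 then oct_of_complex (snd (fst x)) else oct_of_quat (snd x))"

lemma cd_fst_in [simp]: "cd_fst m x \<in> div_alg m"
  by (auto simp: div_alg_iff cd_fst_def oct_unfold)

lemma cd_snd_in [simp]: "m \<le> 2 \<Longrightarrow> cd_snd m x \<in> div_alg m"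
  by (auto simp: div_alg_iff cd_snd_def oct_unfold)

lemma div_alg_le2_cases:
  assumes "m \<le> (2::nat)" obtains "m = 0" | "m = 1" | "m = 2"
  using assms by linarith

lemma cd_unit_in: "m \<le> 2 \<Longrightarrow> cd_unit m \<in> div_alg (Suc m)"
  by (erule div_alg_le2_cases) (auto simp: div_alg_iff cd_unit_def)

lemma cd_decomp:
  assumes "m \<le> 2" "x \<in> div_alg (Suc m)" shows "cd_fst m x + cd_snd m x \<odot> cd_unit m = x"
  using assms by (elim div_alg_le2_cases)
    (auto simp: cd_fst_def cd_snd_def cd_unit_def div_alg_iff oct_unfold prod_eq_iff complex_eq_iff)

lemma cd_components:
  assumes "m \<le> 2" "a \<in> div_alg m" "b \<in> div_alg m"
  shows cd_fst_pair: "cd_fst m (a + b \<odot> cd_unit m) = a"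
    and cd_snd_pair: "cd_snd m (a + b \<odot> cd_unit m) = b"
  using assms by (auto elim!: div_alg_le2_cases
    simp: cd_fst_def cd_snd_def cd_unit_def div_alg_iff oct_unfold prod_eq_iff complex_eq_iff)

text \<open>The doubling formula of \<open>omult\<close> holds at each of the three steps of the
  chain, so the three projective planes can be treated by one argument with parameter
  \<open>m\<close>.\<close>

lemma cd_mult:
  assumes "m \<le> 2" "a \<in> div_alg m" "b \<in> div_alg m" "c \<in> div_alg m" "d \<in> div_alg m"
  shows "(a + b \<odot> cd_unit m) \<odot> (c + d \<odot> cd_unit m) =
    (a \<odot> c - ocnj d \<odot> b) + (d \<odot> a + b \<odot> ocnj c) \<odot> cd_unit m"
  using assms(1)
proof (cases rule: div_alg_le2_cases)
  case 1
  with assms show ?thesis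
    by (auto simp: div_alg_def cd_unit_def oct_unfold prod_eq_iff complex_eq_iff)
next
  case 2
  with assms show ?thesis
    by (auto simp: div_alg_def cd_unit_def oct_unfold prod_eq_iff)
next
  case 3
  with assms show ?thesis
    by (auto simp: div_alg_def cd_unit_def oct_unfold prod_eq_iff algebra_simps)
qed

lemma cd_cnj:
  assumes "m \<le> 2" "a \<in> div_alg m" "b \<in> div_alg m"
  shows "ocnj (a + b \<odot> cd_unit m) = ocnj a + (- b) \<odot> cd_unit m"
  using assms by (auto elim!: div_alg_le2_cases
    simp: cd_unit_def div_alg_iff oct_unfold prod_eq_iff complex_eq_iff algebra_simps)

lemma oct_Re_cd:
  assumes "m \<le> 2" "b \<in> div_alg m" shows "oct_Re (a + b \<odot> cd_unit m) = oct_Re a"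
  using assms by (auto elim!: div_alg_le2_cases simp: cd_unit_def div_alg_iff oct_unfold)

lemma inner_cd:
  assumes "m \<le> 2" "a \<in> div_alg m" "b \<in> div_alg m" "c \<in> div_alg m" "d \<in> div_alg m"
  shows "inner (a + b \<odot> cd_unit m) (c + d \<odot> cd_unit m) = inner a c + inner b d"
  using assms by (auto elim!: div_alg_le2_cases simp: cd_unit_def div_alg_iff oct_unfold
      inner_prod_def inner_complex_def)

lemma linear_cd_fst: "linear (cd_fst m)"
  and linear_cd_snd: "linear (cd_snd m)"
  by (auto intro!: linearI simp: cd_fst_def cd_snd_def oct_unfold prod_eq_iff scaleR_conv_of_real)

lemma cd_fst_orthogonal: "z \<in> div_alg m \<Longrightarrow> orthogonal (x - cd_fst m x) z"
  by (auto simp: orthogonal_def cd_fst_def div_alg_iff oct_unfold inner_prod_def inner_complex_def)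

text \<open>Two candidates differ by an element of the subalgebra that is orthogonal to itself,
  which settles uniqueness for the \<open>THE\<close>.\<close>

lemma orth_proj_div_alg: "orth_proj (div_alg m) x = cd_fst m x"
  unfolding orth_proj_def
proof (rule the_equality)
  fix y assume y: "y \<in> div_alg m \<and> (\<forall>z\<in>div_alg m. orthogonal (x - y) z)"
  then have "y - cd_fst m x \<in> div_alg m" by (auto intro: div_alg_diff)
  then have "inner (y - cd_fst m x) (y - cd_fst m x) = 0"
    using y cd_fst_orthogonal[of "y - cd_fst m x" m x]
    by (auto simp: orthogonal_def inner_diff_left)
  then show "y = cd_fst m x" by simp
qed (simp add: cd_fst_orthogonal)

lemma cd_fst_id [simp]: "x \<in> div_alg m \<Longrightarrow> cd_fst m x = x"
  by (auto simp: div_alg_iff cd_fst_def oct_unfold prod_eq_iff complex_eq_iff)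

lemma cd_fst_ocnj: "cd_fst m (ocnj x) = ocnj (cd_fst m x)"
  by (auto simp: cd_fst_def oct_unfold)

section \<open>Coordinates on Hermitian matrices\<close>

text \<open>The off-diagonal entries are named cyclically, x at (2,3), y at (3,1), z at (1,2), each
  opposite to its diagonal entry. A cyclic permutation of the indices then permutes (a, b, c) and
  (x, y, z) simultaneously.\<close>

definition herm :: "real \<Rightarrow> real \<Rightarrow> real \<Rightarrow> octonion \<Rightarrow> octonion \<Rightarrow> octonion \<Rightarrow> omat" where
  "herm a b c x y z = vector [vector [oct_of_real a, z, ocnj y],
     vector [ocnj z, oct_of_real b, x], vector [y, ocnj x, oct_of_real c]]"

lemma herm_nth [simp]:
  "herm a b c x y z $ 1 $ 1 = oct_of_real a" "herm a b c x y z $ 2 $ 2 = oct_of_real b"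
  "herm a b c x y z $ 3 $ 3 = oct_of_real c"
  "herm a b c x y z $ 2 $ 3 = x" "herm a b c x y z $ 3 $ 1 = y" "herm a b c x y z $ 1 $ 2 = z"
  "herm a b c x y z $ 3 $ 2 = ocnj x" "herm a b c x y z $ 1 $ 3 = ocnj y"
  "herm a b c x y z $ 2 $ 1 = ocnj z"
  by (simp_all add: herm_def)

lemma omat_eq_iff:
  "X = Y \<longleftrightarrow> X$1$1 = Y$1$1 \<and> X$1$2 = Y$1$2 \<and> X$1$3 = Y$1$3 \<and> X$2$1 = Y$2$1 \<and> X$2$2 = Y$2$2
    \<and> X$2$3 = Y$2$3 \<and> X$3$1 = Y$3$1 \<and> X$3$2 = Y$3$2 \<and> X$3$3 = (Y$3$3 :: 'a)" for X Y :: "'a^3^3"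
  by (auto simp: vec_eq_iff forall_3)

lemma herm_eq_iff [simp]:
  "herm a b c x y z = herm a' b' c' x' y' z' \<longleftrightarrow>
     a = a' \<and> b = b' \<and> c = c' \<and> x = x' \<and> y = y' \<and> z = z'"
  by (auto simp: omat_eq_iff)

lemma herm_ops:
  "herm a b c x y z + herm a' b' c' x' y' z' = herm (a + a') (b + b') (c + c') (x + x') (y + y') (z + z')"
  "herm a b c x y z - herm a' b' c' x' y' z' = herm (a - a') (b - b') (c - c') (x - x') (y - y') (z - z')"
  "r *\<^sub>R herm a b c x y z = herm (r * a) (r * b) (r * c) (r *\<^sub>R x) (r *\<^sub>R y) (r *\<^sub>R z)"
  by (simp_all add: omat_eq_iff oct_of_real_add oct_of_real_diff oct_of_real_scaleR ocnj_add ocnj_diff)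

lemma herm_0: "0 = herm 0 0 0 0 0 0"
  by (simp add: omat_eq_iff)

lemma Diag_eq_herm: "Diag a b c = herm a b c 0 0 0"
  by (simp add: omat_eq_iff Diag_def vector_def)

lemma herm_in_Herm [simp]:
  "herm a b c x y z \<in> Herm m \<longleftrightarrow> x \<in> div_alg m \<and> y \<in> div_alg m \<and> z \<in> div_alg m"
  by (auto simp: Herm_def mat_over_def forall_3)

lemma Herm_altdef:
  "X \<in> Herm m \<longleftrightarrow> (\<exists>a b c x y z. x \<in> div_alg m \<and> y \<in> div_alg m \<and> z \<in> div_alg m \<and> X = herm a b c x y z)"
proof
  assume X: "X \<in> Herm m"
  then have c: "ocnj (X$i$j) = X$j$i" for i j by (auto simp: Herm_def)
  have d: "X$i$i = oct_of_real (oct_Re (X$i$i))" for i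
    using c[of i i] ocnj_eq_self_iff by blast
  have "X = herm (oct_Re (X$1$1)) (oct_Re (X$2$2)) (oct_Re (X$3$3)) (X$2$3) (X$3$1) (X$1$2)"
    unfolding omat_eq_iff herm_nth using c d by simp
  moreover have "X$2$3 \<in> div_alg m" "X$3$1 \<in> div_alg m" "X$1$2 \<in> div_alg m"
    using X by (auto simp: Herm_def mat_over_def)
  ultimately show "\<exists>a b c x y z. x \<in> div_alg m \<and> y \<in> div_alg m \<and> z \<in> div_alg m \<and> X = herm a b c x y z"
    by blast
next
  show "\<exists>a b c x y z. x \<in> div_alg m \<and> y \<in> div_alg m \<and> z \<in> div_alg m \<and> X = herm a b c x y z \<Longrightarrow> X \<in> Herm m"
    by (elim exE conjE) simp
qed

lemma HermE:
  assumes "X \<in> Herm m"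
  obtains a b c x y z where "X = herm a b c x y z" "x \<in> div_alg m" "y \<in> div_alg m" "z \<in> div_alg m"
  using assms unfolding Herm_altdef by blast

lemma Herm_mono: "m \<le> k \<Longrightarrow> X \<in> Herm m \<Longrightarrow> X \<in> Herm k"
  by (elim HermE) (simp add: div_alg_mono)

lemma subspace_Herm: "subspace (Herm m)"
  unfolding subspace_def
  by (intro conjI ballI allI; (elim HermE)?) (simp_all add: herm_ops herm_0 div_alg_intros)

lemmas Herm_intros = subspace_add[OF subspace_Herm] subspace_diff[OF subspace_Herm]
  subspace_scale[OF subspace_Herm] subspace_neg[OF subspace_Herm] subspace_0[OF subspace_Herm]

lemma Diag_in_Herm [simp]: "Diag a b c \<in> Herm m"
  by (simp add: Diag_eq_herm)

lemma mmult_nth: "(X \<odot>\<odot> Y) $ i $ j = X$i$1 \<odot> Y$1$j + X$i$2 \<odot> Y$2$j + X$i$3 \<odot> Y$3$j"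
  by (simp add: mmult_def sum_3)

lemma jordan_prod_herm:
  "jordan_prod (herm a b c x y z) (herm a' b' c' x' y' z') =
    herm (a * a' + inner y y' + inner z z') (b * b' + inner z z' + inner x x') (c * c' + inner x x' + inner y y')
      ((1/2) *\<^sub>R ((b + c) *\<^sub>R x' + (b' + c') *\<^sub>R x + ocnj (y \<odot> z' + y' \<odot> z)))
      ((1/2) *\<^sub>R ((c + a) *\<^sub>R y' + (c' + a') *\<^sub>R y + ocnj (z \<odot> x' + z' \<odot> x)))
      ((1/2) *\<^sub>R ((a + b) *\<^sub>R z' + (a' + b') *\<^sub>R z + ocnj (x \<odot> y' + x' \<odot> y)))"
proof -
  \<comment> \<open>The polarised norm identity; it turns the mixed products on the diagonal into
    inner products.\<close>
  have e: "x \<odot> ocnj y = oct_of_real (2 * inner x y) - y \<odot> ocnj x" for x y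
    using ocnj_add_self[of "x \<odot> ocnj y"] by (simp add: ocnj_omult inner_oct algebra_simps)
  have e': "ocnj x \<odot> y = oct_of_real (2 * inner x y) - ocnj y \<odot> x" for x y
    using e[of "ocnj x" "ocnj y"] by simp
  have d: "oct_of_real (p / 2) + (oct_of_real (p / 2) + w) = oct_of_real p + w" for p w
    by (simp add: add.assoc[symmetric] flip: oct_of_real_add)
  note ee = e[of x x'] e[of y y'] e[of z z'] e'[of x x'] e'[of y y'] e'[of z z']
  show ?thesis
    unfolding omat_eq_iff herm_nth jordan_prod_def
    by (simp add: mmult_nth ee ocnj_add ocnj_omult algebra_simps oct_of_real_scaleR oct_of_real_add d)
qed

section \<open>Trace, cubic norm and Freudenthal adjoint\<close>

lemma herm_trace_herm [simp]: "herm_trace (herm a b c x y z) = a + b + c"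
  by (simp add: herm_trace_def sum_3)

lemma herm_trace_add: "herm_trace (X + Y) = herm_trace X + herm_trace Y"
  and herm_trace_scaleR: "herm_trace (r *\<^sub>R X) = r * herm_trace X"
  by (simp_all add: herm_trace_def sum_3 algebra_simps)

lemma jordan_prod_in_Herm: "X \<in> Herm m \<Longrightarrow> Y \<in> Herm m \<Longrightarrow> jordan_prod X Y \<in> Herm m"
  by (elim HermE) (simp add: jordan_prod_herm div_alg_intros)

text \<open>Freudenthal's expression for the determinant. The bracketing of the triple product is
  immaterial by \<open>oct_Re_assoc\<close>. Agreement with the definition by eigenvalues is
  \<open>herm_det_eq_det3\<close>.\<close>

definition det3 :: "omat \<Rightarrow> real" where
  "det3 X = oct_Re (X$1$1) * oct_Re (X$2$2) * oct_Re (X$3$3) - oct_Re (X$1$1) * inner (X$2$3) (X$2$3)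
     - oct_Re (X$2$2) * inner (X$3$1) (X$3$1) - oct_Re (X$3$3) * inner (X$1$2) (X$1$2)
     + 2 * oct_Re ((X$2$3 \<odot> X$3$1) \<odot> X$1$2)"

lemma det3_herm: "det3 (herm a b c x y z) =
    a * b * c - a * inner x x - b * inner y y - c * inner z z + 2 * oct_Re ((x \<odot> y) \<odot> z)"
  by (simp add: det3_def)

text \<open>Freudenthal's adjoint \<open>X\<^sup>#\<close> and the second elementary symmetric function of the eigenvalues.\<close>

definition adj3 :: "omat \<Rightarrow> omat" where
  "adj3 X = herm (oct_Re (X$2$2) * oct_Re (X$3$3) - inner (X$2$3) (X$2$3))
     (oct_Re (X$3$3) * oct_Re (X$1$1) - inner (X$3$1) (X$3$1))
     (oct_Re (X$1$1) * oct_Re (X$2$2) - inner (X$1$2) (X$1$2))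
     (ocnj (X$3$1 \<odot> X$1$2) - oct_Re (X$1$1) *\<^sub>R X$2$3)
     (ocnj (X$1$2 \<odot> X$2$3) - oct_Re (X$2$2) *\<^sub>R X$3$1)
     (ocnj (X$2$3 \<odot> X$3$1) - oct_Re (X$3$3) *\<^sub>R X$1$2)"

lemma adj3_herm: "adj3 (herm a b c x y z) =
    herm (b * c - inner x x) (c * a - inner y y) (a * b - inner z z)
     (ocnj (y \<odot> z) - a *\<^sub>R x) (ocnj (z \<odot> x) - b *\<^sub>R y) (ocnj (x \<odot> y) - c *\<^sub>R z)"
  by (simp add: adj3_def)

definition sec3 :: "omat \<Rightarrow> real" where
  "sec3 X = herm_trace (adj3 X)"

lemma sec3_herm: "sec3 (herm a b c x y z) = a * b + b * c + c * a - inner x x - inner y y - inner z z"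
  by (simp add: sec3_def adj3_herm)

lemma adj3_in_Herm: "X \<in> Herm m \<Longrightarrow> adj3 X \<in> Herm m"
  by (elim HermE) (simp add: adj3_herm div_alg_intros)

lemma oct_Re_triple_cyclic: "oct_Re ((y \<odot> z) \<odot> x) = oct_Re ((x \<odot> y) \<odot> z)"
  by (metis oct_Re_assoc oct_Re_commute)

lemma inner_ocnj_omult:
  "inner x (ocnj (y \<odot> z)) = oct_Re ((x \<odot> y) \<odot> z)" "inner (ocnj (y \<odot> z)) x = oct_Re ((x \<odot> y) \<odot> z)"
  by (simp_all add: inner_commute[of "ocnj (y \<odot> z)" x]) (simp_all add: inner_oct oct_Re_assoc)

text \<open>\<open>adj3 X\<close> is the gradient of the cubic form with respect to the trace form:
  the part of det(X + Y) that is odd in Y consists of the linear term and det Y.\<close>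

lemma trace_adj3:
  assumes "X \<in> Herm 3" "Y \<in> Herm 3"
  shows "2 * herm_trace (jordan_prod (adj3 X) Y) = det3 (X + Y) - det3 (X - Y) - 2 * det3 Y"
  using assms
proof (elim HermE)
  fix a b c x y z a' b' c' x' y' z'
  assume XY: "X = herm a b c x y z" "Y = herm a' b' c' x' y' z'"
  have r: "oct_Re ((y \<odot> z) \<odot> x) = oct_Re ((x \<odot> y) \<odot> z)" "oct_Re ((z \<odot> x) \<odot> y) = oct_Re ((x \<odot> y) \<odot> z)" for x y z
    by (metis oct_Re_triple_cyclic)+
  show ?thesis unfolding XY
    by (simp add: adj3_herm jordan_prod_herm herm_ops det3_herm inner_ocnj_omult inner_diff_left inner_diff_right
        inner_add_left inner_add_right omult_add_left omult_add_right omult_diff_left omult_diff_right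
        r(1)[of y' z x] r(2)[of z' x y] inner_commute[of x x'] inner_commute[of y y'] inner_commute[of z z'] algebra_simps)
qed

text \<open>Newton's identity for the second power sum of the eigenvalues;
  \<open>trace_cube_eq\<close> is the one for the third. Together they recover \<open>sec3\<close>
  and \<open>det3\<close> from traces of Jordan powers.\<close>

lemma trace_square_eq:
  "X \<in> Herm 3 \<Longrightarrow> herm_trace (jordan_prod X X) = (herm_trace X)\<^sup>2 - 2 * sec3 X"
  by (elim HermE) (simp add: jordan_prod_herm sec3_herm power2_eq_square algebra_simps)

lemma trace_cube_eq:
  assumes "X \<in> Herm 3"
  shows "herm_trace (jordan_prod X (jordan_prod X X)) =
    (herm_trace X)^3 - 3 * herm_trace X * sec3 X + 3 * det3 X"
  using assms
proof (elim HermE)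
  fix a b c x y z
  assume X: "X = herm a b c x y z"
  have r: "oct_Re ((y \<odot> z) \<odot> x) = oct_Re ((x \<odot> y) \<odot> z)" "oct_Re ((z \<odot> x) \<odot> y) = oct_Re ((x \<odot> y) \<odot> z)"
    by (metis oct_Re_triple_cyclic)+
  show ?thesis unfolding X
    by (simp add: jordan_prod_herm sec3_herm det3_herm inner_add_right ocnj_add inner_ocnj_omult r
        power3_eq_cube algebra_simps)
qed

text \<open>Expresses the adjoint through the Jordan product, the unit and trace invariants, which
  is how automorphisms will be seen to commute with it.\<close>

lemma square_eq_adj3:
  "X \<in> Herm 3 \<Longrightarrow> jordan_prod X X = adj3 X + herm_trace X *\<^sub>R X - sec3 X *\<^sub>R Diag 1 1 1"
  by (elim HermE)
    (simp add: jordan_prod_herm adj3_herm sec3_herm herm_ops Diag_eq_herm algebra_simps flip: scaleR_2)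

lemma trace_form_pos:
  assumes "X \<in> Herm 3" "herm_trace (jordan_prod X X) = 0" shows "X = 0"
  using assms
proof (elim HermE)
  fix a b c x y z
  assume X: "X = herm a b c x y z"
  with assms have "a\<^sup>2 + b\<^sup>2 + c\<^sup>2 + 2 * inner x x + 2 * inner y y + 2 * inner z z = 0"
    by (simp add: jordan_prod_herm power2_eq_square)
  then have "a\<^sup>2 = 0 \<and> b\<^sup>2 = 0 \<and> c\<^sup>2 = 0 \<and> inner x x = 0 \<and> inner y y = 0 \<and> inner z z = 0"
    using inner_ge_zero[of x] inner_ge_zero[of y] inner_ge_zero[of z]
      zero_le_power2[of a] zero_le_power2[of b] zero_le_power2[of c] by linarith
  then show ?thesis by (simp add: X herm_0)
qed

lemma jordan_prod_bilinear:
  "jordan_prod (X + Y) Z = jordan_prod X Z + jordan_prod Y Z"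
  "jordan_prod Z (X + Y) = jordan_prod Z X + jordan_prod Z Y"
  "jordan_prod (r *\<^sub>R X) Z = r *\<^sub>R jordan_prod X Z"
  "jordan_prod Z (r *\<^sub>R X) = r *\<^sub>R jordan_prod Z X"
  by (simp_all add: jordan_prod_def mmult_nth omat_eq_iff omult_add_left omult_add_right algebra_simps)

lemma jordan_prod_one: "X \<in> Herm 3 \<Longrightarrow> jordan_prod X (Diag 1 1 1) = X"
  and jordan_prod_commute: "jordan_prod X Y = jordan_prod Y X"
  by (elim HermE, simp add: jordan_prod_herm Diag_eq_herm flip: scaleR_2)
    (simp add: jordan_prod_def add.commute)

text \<open>By the gradient formula the vanishing of the adjoint is a statement about det only,
  hence stable under linear bijections that preserve det. In the converse direction Y =
  \<open>adj3 X\<close> is the test matrix and the trace form is definite.\<close>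

lemma adj3_eq_0_iff:
  assumes "n \<le> 3" "X \<in> Herm n"
  shows "adj3 X = 0 \<longleftrightarrow> (\<forall>Y\<in>Herm n. det3 (X + Y) - det3 (X - Y) = 2 * det3 Y)"
proof
  assume "adj3 X = 0"
  then show "\<forall>Y\<in>Herm n. det3 (X + Y) - det3 (X - Y) = 2 * det3 Y"
    using trace_adj3[of X] assms Herm_mono[of n 3] jordan_prod_bilinear(3)[of 0 0] herm_trace_scaleR[of 0 0]
    by auto
next
  assume *: "\<forall>Y\<in>Herm n. det3 (X + Y) - det3 (X - Y) = 2 * det3 Y"
  have "herm_trace (jordan_prod (adj3 X) (adj3 X)) = 0"
    using trace_adj3[of X "adj3 X"] bspec[OF *, of "adj3 X"] assms Herm_mono[of n 3]
    by (auto simp: adj3_in_Herm)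
  then show "adj3 X = 0"
    using trace_form_pos[of "adj3 X"] assms Herm_mono[of n 3] by (auto simp: adj3_in_Herm)
qed

text \<open>The trace of the square is \<open>(tr X)\<^sup>2 - 2 tr X\<^sup>#\<close>, and the trace
  form is definite. This is why the group never moves a point of the plane out of the affine
  chart.\<close>

lemma adj3_eq_0_trace:
  assumes "X \<in> Herm 3" "adj3 X = 0" "herm_trace X = 0" shows "X = 0"
  using assms trace_square_eq[of X] trace_form_pos[of X] by (simp add: sec3_def herm_trace_def)

section \<open>Explicit automorphisms\<close>

text \<open>Congruence \<open>A X A\<^sup>T\<close> with a real matrix, factored into its one-sided parts.\<close>

definition lmul :: "real^3^3 \<Rightarrow> omat \<Rightarrow> omat" where
  "lmul A X = (\<chi> i j. \<Sum>k\<in>UNIV. A$i$k *\<^sub>R X$k$j)"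

definition rmul :: "real^3^3 \<Rightarrow> omat \<Rightarrow> omat" where
  "rmul A X = (\<chi> i j. \<Sum>k\<in>UNIV. A$j$k *\<^sub>R X$i$k)"

definition real_cong :: "real^3^3 \<Rightarrow> omat \<Rightarrow> omat" where
  "real_cong A X = lmul A (rmul A X)"

lemma lmul_nth: "lmul A X $ i $ j = A$i$1 *\<^sub>R X$1$j + A$i$2 *\<^sub>R X$2$j + A$i$3 *\<^sub>R X$3$j"
  and rmul_nth: "rmul A X $ i $ j = A$j$1 *\<^sub>R X$i$1 + A$j$2 *\<^sub>R X$i$2 + A$j$3 *\<^sub>R X$i$3"
  by (simp_all add: lmul_def rmul_def sum_3)

lemma lmul_rmul: "lmul A (rmul B X) = rmul B (lmul A X)"
  by (simp add: vec_eq_iff lmul_nth rmul_nth algebra_simps)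

lemma lmul_lmul: "lmul A (lmul B X) = lmul (A ** B) X"
  and rmul_rmul: "rmul A (rmul B X) = rmul (A ** B) X"
  by (simp_all add: vec_eq_iff lmul_nth rmul_nth matrix_matrix_mult_def sum_3 algebra_simps)

lemma real_cong_real_cong: "real_cong A (real_cong B X) = real_cong (A ** B) X"
  unfolding real_cong_def lmul_rmul[of B] by (simp add: lmul_rmul rmul_rmul) (simp flip: lmul_rmul add: lmul_lmul)

lemma real_cong_mat_1 [simp]: "real_cong (mat 1) X = X"
  by (simp add: real_cong_def omat_eq_iff lmul_nth rmul_nth mat_def)

lemma mmult_lmul: "lmul A X \<odot>\<odot> Y = lmul A (X \<odot>\<odot> Y)"
  and mmult_rmul: "X \<odot>\<odot> rmul A Y = rmul A (X \<odot>\<odot> Y)"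
  by (simp_all add: vec_eq_iff lmul_nth rmul_nth mmult_nth omult_add_left omult_add_right algebra_simps)

lemma orthogonal_columns:
  fixes A :: "real^3^3"
  assumes "orthogonal_matrix A"
  shows "A$1$p * A$1$q + A$2$p * A$2$q + A$3$p * A$3$q = (if p = q then 1 else 0)"
  using arg_cong[OF orthogonal_matrix[THEN iffD1, OF assms], of "\<lambda>M. M$p$q"]
  by (simp add: matrix_matrix_mult_def transpose_def sum_3 mat_def)

text \<open>Real scalars are central, so the inner factors combine to \<open>A\<^sup>T A = 1\<close>
  without any associativity of the entries.\<close>

lemma rmul_lmul_cancel:
  assumes "orthogonal_matrix A"
  shows "rmul A X \<odot>\<odot> lmul A Y = X \<odot>\<odot> Y"
proof -
  have "(rmul A X \<odot>\<odot> lmul A Y) $ i $ j =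
      (\<Sum>p\<in>UNIV. \<Sum>q\<in>UNIV. (A$1$p * A$1$q + A$2$p * A$2$q + A$3$p * A$3$q) *\<^sub>R (X$i$p \<odot> Y$q$j))" for i j
    by (simp add: lmul_nth rmul_nth mmult_nth sum_3 omult_add_left omult_add_right algebra_simps)
  then show ?thesis
    by (simp add: orthogonal_columns[OF assms] vec_eq_iff mmult_nth sum_3)
qed

lemma real_cong_mmult:
  "orthogonal_matrix A \<Longrightarrow> real_cong A X \<odot>\<odot> real_cong A Y = real_cong A (X \<odot>\<odot> Y)"
  unfolding real_cong_def
  by (simp add: mmult_lmul mmult_rmul lmul_rmul[of A A Y] lmul_rmul[of A A "X \<odot>\<odot> Y"] rmul_lmul_cancel)

lemma linear_real_cong: "linear (real_cong A)"
  by (rule linearI) (simp_all add: real_cong_def omat_eq_iff lmul_nth rmul_nth algebra_simps)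

lemma real_cong_jordan:
  assumes "orthogonal_matrix A"
  shows "real_cong A (jordan_prod X Y) = jordan_prod (real_cong A X) (real_cong A Y)"
  by (simp add: jordan_prod_def real_cong_mmult assms linear_cmul[OF linear_real_cong] linear_add[OF linear_real_cong])

lemma real_cong_trace:
  assumes "orthogonal_matrix A" shows "herm_trace (real_cong A X) = herm_trace X"
proof -
  have "herm_trace (real_cong A X) =
     (\<Sum>p\<in>UNIV. \<Sum>q\<in>UNIV. (A$1$p * A$1$q + A$2$p * A$2$q + A$3$p * A$3$q) * oct_Re (X$p$q))"
    by (simp add: herm_trace_def real_cong_def lmul_nth rmul_nth sum_3 algebra_simps)
  then show ?thesis by (simp add: orthogonal_columns[OF assms] herm_trace_def sum_3)
qed

lemma real_cong_Herm: assumes "X \<in> Herm m" shows "real_cong A X \<in> Herm m"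
proof -
  have "real_cong A X $ i $ j \<in> div_alg m" for i j
    using assms by (simp add: real_cong_def lmul_nth rmul_nth Herm_def mat_over_def div_alg_intros)
  moreover have "ocnj (X$i$j) = X$j$i" for i j using assms by (auto simp: Herm_def)
  then have "ocnj (real_cong A X $ i $ j) = real_cong A X $ j $ i" for i j
    by (simp add: real_cong_def lmul_nth rmul_nth ocnj_add algebra_simps)
  ultimately show ?thesis by (simp add: Herm_def mat_over_def)
qed

lemma proj_mat_nth: "proj_mat m X $ i $ j = cd_fst m (X$i$j)"
  by (simp add: proj_mat_def orth_proj_div_alg)

lemma proj_mat_herm:
  "proj_mat m (herm a b c x y z) = herm a b c (cd_fst m x) (cd_fst m y) (cd_fst m z)"
  by (simp add: omat_eq_iff proj_mat_nth cd_fst_ocnj)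

lemma linear_proj_mat: "linear (proj_mat m)"
  by (rule linearI) (simp_all add: vec_eq_iff proj_mat_nth linear_add[OF linear_cd_fst] linear_cmul[OF linear_cd_fst])

text \<open>Congruence with \<open>diag(a, 1, a\<^sup>*)\<close> for a unit \<open>a\<close>, which is unambiguous even for octonions and
  an automorphism by the Moufang identities.\<close>

definition phase :: "octonion \<Rightarrow> omat \<Rightarrow> omat" where
  "phase a X = herm (oct_Re (X$1$1)) (oct_Re (X$2$2)) (oct_Re (X$3$3))
     (X$2$3 \<odot> a) ((ocnj a \<odot> X$3$1) \<odot> ocnj a) (a \<odot> X$1$2)"

lemma phase_herm [simp]:
  "phase u (herm a b c x y z) = herm a b c (x \<odot> u) ((ocnj u \<odot> y) \<odot> ocnj u) (u \<odot> z)"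
  by (simp add: phase_def)

lemma linear_phase: "linear (phase a)"
  by (rule linearI) (simp_all add: phase_def herm_ops omult_add_left omult_add_right)

lemma norm_1_inner: "norm (a::octonion) = 1 \<Longrightarrow> inner a a = 1"
  by (simp add: dot_square_norm)

text \<open>Each off-diagonal entry of the Jordan product needs its own Moufang identity: y z the
  left one, x y the right one, z x the middle one.\<close>

lemma phase_jordan:
  assumes u: "norm u = 1" and X: "X \<in> Herm 3" and Y: "Y \<in> Herm 3"
  shows "phase u (jordan_prod X Y) = jordan_prod (phase u X) (phase u Y)"
proof -
  obtain a b c x y z where X: "X = herm a b c x y z" using X by (rule HermE)
  obtain a' b' c' x' y' z' where Y: "Y = herm a' b' c' x' y' z'" using Y by (rule HermE)
  note u1 = norm_1_inner[OF u]
  have i: "inner (p \<odot> u) (q \<odot> u) = inner p q" "inner (u \<odot> p) (u \<odot> q) = inner p q"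
    "inner ((ocnj u \<odot> p) \<odot> ocnj u) ((ocnj u \<odot> q) \<odot> ocnj u) = inner p q" for p q
    by (simp_all add: inner_omult_omult_left inner_omult_omult_right u1)
  have m1: "((ocnj u \<odot> p) \<odot> ocnj u) \<odot> (u \<odot> q) = ocnj u \<odot> (p \<odot> q)" for p q
    using moufang_left[of "ocnj u" p "u \<odot> q"] by (simp add: ocnj_cancel_left u1)
  have m2: "(p \<odot> u) \<odot> ((ocnj u \<odot> q) \<odot> ocnj u) = (p \<odot> q) \<odot> ocnj u" for p q
    using moufang_right[of "p \<odot> u" "ocnj u" q] by (simp add: ocnj_cancel_right u1 omult_flexible)
  show ?thesis unfolding X Y
    by (simp add: jordan_prod_herm i m1 m2 moufang_middle ocnj_omult ocnj_add omult_add_left omult_add_right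
        omult_flexible)
qed

lemma phase_inverse:
  assumes "norm u = 1" "X \<in> Herm 3" shows "phase (ocnj u) (phase u X) = X"
  using assms(2) norm_1_inner[OF assms(1)]
  by (elim HermE) (simp add: ocnj_cancel_left ocnj_cancel_right omult_flexible[symmetric]
      ocnj_cancel_left' ocnj_cancel_right')

text \<open>These explicit automorphisms are all that diagonalisation uses. They are linear on the
  whole of \<open>omat\<close>, act on every larger Jordan algebra of the chain, and for m \<le> 2
  come from elements of SL(3, A_m).\<close>

inductive_set unitary_moves :: "nat \<Rightarrow> (omat \<Rightarrow> omat) set" for m where
  rot: "orthogonal_matrix A \<Longrightarrow> det A = 1 \<Longrightarrow> real_cong A \<in> unitary_moves m"
| phase: "u \<in> div_alg m \<Longrightarrow> norm u = 1 \<Longrightarrow> phase u \<in> unitary_moves m"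
| comp: "f \<in> unitary_moves m \<Longrightarrow> g \<in> unitary_moves m \<Longrightarrow> f \<circ> g \<in> unitary_moves m"

lemma unitary_moves_Herm: "f \<in> unitary_moves m \<Longrightarrow> m \<le> k \<Longrightarrow> X \<in> Herm k \<Longrightarrow> f X \<in> Herm k"
proof (induction arbitrary: X rule: unitary_moves.induct)
  case (phase u)
  then have "u \<in> div_alg k" by (blast intro: div_alg_mono)
  with phase show ?case by (elim HermE) (simp add: div_alg_intros)
qed (simp_all add: real_cong_Herm)

lemma unitary_moves_linear: "f \<in> unitary_moves m \<Longrightarrow> linear f"
  by (induction rule: unitary_moves.induct) (auto simp: linear_real_cong linear_phase linear_compose o_def intro: linear_compose[unfolded o_def])

lemma unitary_moves_Herm3: "f \<in> unitary_moves m \<Longrightarrow> X \<in> Herm 3 \<Longrightarrow> f X \<in> Herm 3"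
proof (cases "m \<le> 3")
  \<comment> \<open>Beyond m = 3 the algebra no longer grows: \<open>div_alg m\<close> is all of the
    octonions.\<close>
  case False
  assume "f \<in> unitary_moves m" "X \<in> Herm 3"
  with False have "f X \<in> Herm m"
    using unitary_moves_Herm[of f m m X] Herm_mono[of 3 m X] by simp
  then show ?thesis by (elim HermE) simp
qed (rule unitary_moves_Herm)

lemma unitary_moves_jordan: "f \<in> unitary_moves m \<Longrightarrow> X \<in> Herm 3 \<Longrightarrow> Y \<in> Herm 3 \<Longrightarrow>
    f (jordan_prod X Y) = jordan_prod (f X) (f Y)"
  by (induction arbitrary: X Y rule: unitary_moves.induct)
    (simp_all add: real_cong_jordan phase_jordan unitary_moves_Herm3)

lemma unitary_moves_trace: "f \<in> unitary_moves m \<Longrightarrow> X \<in> Herm 3 \<Longrightarrow> herm_trace (f X) = herm_trace X"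
proof (induction arbitrary: X rule: unitary_moves.induct)
  case (phase u)
  then show ?case by (elim HermE) simp
qed (simp_all add: real_cong_trace unitary_moves_Herm3)

lemma unitary_moves_inverse:
  assumes "f \<in> unitary_moves m"
  shows "\<exists>g\<in>unitary_moves m. \<forall>X\<in>Herm 3. g (f X) = X \<and> f (g X) = X"
  using assms
proof (induction rule: unitary_moves.induct)
  case (rot A)
  then have "transpose A ** A = mat 1" "A ** transpose A = mat 1"
    by (simp_all add: orthogonal_matrix_def)
  with rot show ?case
    by (intro bexI[of _ "real_cong (transpose A)"])
      (auto simp: real_cong_real_cong intro!: unitary_moves.rot simp: orthogonal_matrix_def)
next
  case (phase u)
  then show ?case
    using phase_inverse[of u] phase_inverse[of "ocnj u"]
    by (intro bexI[of _ "phase (ocnj u)"]) (simp_all add: unitary_moves.phase)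
next
  case (comp f g)
  then obtain f' g' where f': "f' \<in> unitary_moves m" "\<forall>X\<in>Herm 3. f' (f X) = X \<and> f (f' X) = X"
    and g': "g' \<in> unitary_moves m" "\<forall>X\<in>Herm 3. g' (g X) = X \<and> g (g' X) = X" by blast
  then show ?case
    using comp.hyps by (intro bexI[of _ "g' \<circ> f'"]) (simp_all add: unitary_moves_Herm3 unitary_moves.comp)
qed

lemma id_unitary_moves: "(\<lambda>X. X) \<in> unitary_moves m"
proof -
  have "real_cong (mat 1) = (\<lambda>X. X)" by (rule ext) simp
  then show ?thesis
    using unitary_moves.rot[of "mat 1" m] by (simp add: orthogonal_matrix_def)
qed

section \<open>Diagonalisation\<close>

lemma ocnj_eq_0_iff [simp]: "ocnj x = 0 \<longleftrightarrow> x = 0"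
  using ocnj_eq_iff[of x 0] by simp

definition reachable :: "nat \<Rightarrow> omat \<Rightarrow> omat \<Rightarrow> bool" where
  "reachable m X Y \<longleftrightarrow> (\<exists>f\<in>unitary_moves m. f X = Y)"

lemma reachable_refl: "reachable m X X"
  unfolding reachable_def by (rule bexI[OF _ id_unitary_moves]) simp

lemma reachable_trans [trans]: "reachable m X Y \<Longrightarrow> reachable m Y Z \<Longrightarrow> reachable m X Z"
  unfolding reachable_def by (metis comp_apply unitary_moves.comp)

lemma reachable_sym: "reachable m X Y \<Longrightarrow> X \<in> Herm 3 \<Longrightarrow> reachable m Y X"
  unfolding reachable_def using unitary_moves_inverse by metis

lemma reachable_Herm: "reachable m X Y \<Longrightarrow> X \<in> Herm m \<Longrightarrow> Y \<in> Herm m"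
  unfolding reachable_def using unitary_moves_Herm by blast

lemma reachable_real_cong: "orthogonal_matrix A \<Longrightarrow> det A = 1 \<Longrightarrow> reachable m X (real_cong A X)"
  unfolding reachable_def using unitary_moves.rot by blast

lemma real_cong_nth: "real_cong A X $ i $ j =
    (\<Sum>k\<in>UNIV. \<Sum>l\<in>UNIV. (A$i$k * A$j$l) *\<^sub>R X$k$l)"
  by (simp add: real_cong_def lmul_nth rmul_nth sum_3 algebra_simps)

lemma reachable_cycle: "reachable m (herm a b c x y z) (herm b c a y z x)"
proof -
  define A :: "real^3^3" where "A = vector [vector [0, 1, 0], vector [0, 0, 1], vector [1, 0, 0]]"
  have "orthogonal_matrix A" "det A = 1"
    by (simp_all add: A_def orthogonal_matrix det_3 omat_eq_iff matrix_matrix_mult_def transpose_def sum_3 mat_def)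
  moreover have "real_cong A (herm a b c x y z) = herm b c a y z x"
    by (simp add: omat_eq_iff real_cong_nth sum_3 A_def)
  ultimately show ?thesis using reachable_real_cong by metis
qed

lemma reachable_swap: "reachable m (Diag a b c) (Diag b a c)"
proof -
  define A :: "real^3^3" where "A = vector [vector [0, 1, 0], vector [1, 0, 0], vector [0, 0, - 1]]"
  have "orthogonal_matrix A" "det A = 1"
    by (simp_all add: A_def orthogonal_matrix det_3 omat_eq_iff matrix_matrix_mult_def transpose_def sum_3 mat_def)
  moreover have "real_cong A (Diag a b c) = Diag b a c"
    by (simp add: omat_eq_iff real_cong_nth sum_3 A_def Diag_eq_herm)
  ultimately show ?thesis using reachable_real_cong by metis
qed

lemma reachable_Diag_cycle: "reachable m (Diag a b c) (Diag b c a)"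
  using reachable_cycle[of m a b c 0 0 0] by (simp add: Diag_eq_herm)

lemma reachable_Diag_swap23: "reachable m (Diag a b c) (Diag a c b)"
  using reachable_Diag_cycle[of m a b c] reachable_swap[of m b c a] reachable_Diag_cycle[of m c b a]
    reachable_Diag_cycle[of m b a c] by (meson reachable_trans)

lemma reachable_Diag_sorted:
  obtains l1 l2 l3 where "l1 \<le> l2" "l2 \<le> l3" "reachable m (Diag a b c) (Diag l1 l2 l3)"
proof -
  have *: "\<exists>l1 l2 l3. l1 \<le> l2 \<and> l2 \<le> l3 \<and> reachable m (Diag a b c) (Diag l1 l2 l3)" if ab: "a \<le> b" for a b c
  proof -
    consider "b \<le> c" | "a \<le> c" "c \<le> b" | "c \<le> a" by linarith
    then show ?thesis
    proof cases
      case 1 then show ?thesis using ab reachable_refl by blast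
    next
      case 2 then show ?thesis using reachable_Diag_swap23 by blast
    next
      case 3 then show ?thesis using ab reachable_Diag_cycle reachable_trans by blast
    qed
  qed
  show thesis
  proof (cases "a \<le> b")
    case True then show ?thesis using *[of a b c] that by blast
  next
    case False
    then show ?thesis using *[of b a c] that reachable_swap reachable_trans by (meson linear)
  qed
qed

text \<open>A Jacobi rotation in the (1,3) plane: the rotated entry is r at angle 0 and -r at angle
  pi/2, so it vanishes in between. The last clause keeps existing zeros, as the final step of
  \<open>reachable_Diag_real\<close> requires.\<close>

lemma reachable_rotate31:
  "\<exists>a' c' x' z'. reachable m (herm a b c x (oct_of_real r) z) (herm a' b c' x' 0 z')
     \<and> (x = 0 \<and> z = 0 \<longrightarrow> x' = 0 \<and> z' = 0)"
proof -
  define f where "f t = sin t * cos t * (a - c) + r * ((cos t)\<^sup>2 - (sin t)\<^sup>2)" for t :: real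
  have "\<exists>t. f t = 0"
  proof -
    have c: "continuous_on {0..pi/2} f" unfolding f_def by (intro continuous_intros)
    have f0: "f 0 = r" and f1: "f (pi/2) = - r" by (simp_all add: f_def)
    show ?thesis
    proof (cases "r \<le> 0")
      case True
      then show ?thesis using IVT'[of f 0 0 "pi/2"] c f0 f1 by auto
    next
      case False
      then show ?thesis using IVT2'[of f "pi/2" 0 0] c f0 f1 by auto
    qed
  qed
  then obtain t where t: "f t = 0" ..
  define A :: "real^3^3" where
    "A = vector [vector [cos t, 0, - sin t], vector [0, 1, 0], vector [sin t, 0, cos t]]"
  have sc: "cos t * cos t + sin t * sin t = 1" "sin t * sin t + cos t * cos t = 1"
    using sin_cos_squared_add[of t] by (simp_all add: power2_eq_square)
  have A: "orthogonal_matrix A" "det A = 1"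
    using sc by (simp_all add: A_def orthogonal_matrix det_3 omat_eq_iff matrix_matrix_mult_def
        transpose_def sum_3 mat_def mult.commute)
  let ?X = "herm a b c x (oct_of_real r) z"
  have "(real_cong A ?X)$3$1 = oct_of_real (f t)"
    by (simp add: real_cong_nth sum_3 A_def f_def oct_of_real_scaleR power2_eq_square algebra_simps
        flip: oct_of_real_add oct_of_real_diff oct_of_real_minus)
  moreover have "(real_cong A ?X)$2$2 = oct_of_real b"
    by (simp add: real_cong_nth sum_3 A_def)
  moreover obtain a' b' c' x' y' z' where X': "real_cong A ?X = herm a' b' c' x' y' z'"
    using real_cong_Herm[of ?X 3 A] HermE[of "real_cong A ?X" 3]
    by (metis div_alg_top herm_in_Herm order_refl)
  ultimately have yb: "y' = 0" "b' = b" using t by simp_all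
  have r: "reachable m ?X (herm a' b c' x' 0 z')"
    using reachable_real_cong[OF A, of m ?X] unfolding X' yb .
  have xz: "x' = (real_cong A ?X)$2$3" "z' = (real_cong A ?X)$1$2"
    by (simp_all only: X' herm_nth)
  have 0: "x' = 0" "z' = 0" if xz0: "x = 0" "z = 0"
    unfolding xz xz0 by (simp_all add: real_cong_nth sum_3 A_def)
  have "x = 0 \<and> z = 0 \<longrightarrow> x' = 0 \<and> z' = 0" using 0 by simp
  with r show ?thesis by metis
qed

text \<open>A nonreal octonion generates with the reals a copy of the complex numbers, in which w is
  a cube root of the inverse phase of z. Three factors occur because the moves that keep the other
  entry real multiply z by w three times, see \<open>reachable_Diag\<close>.\<close>

lemma ex_cube_phase:
  assumes "z \<in> div_alg m"
  obtains w r where "w \<in> div_alg m" "norm w = 1" "w \<odot> ((w \<odot> z) \<odot> w) = oct_of_real r"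
proof (cases "z = oct_of_real (oct_Re z)")
  case True
  then show ?thesis
    by (intro that[of "oct_of_real 1" "oct_Re z"]) simp_all
next
  case False
  define v where "v = z - oct_of_real (oct_Re z)"
  define u where "u = (1 / norm v) *\<^sub>R v"
  have v: "v \<noteq> 0" "v \<in> div_alg m" using False assms by (auto simp: v_def intro: div_alg_diff)
  have u: "norm u = 1" "u \<in> div_alg m" using v by (simp_all add: u_def div_alg_scaleR)
  have "ocnj v = - v"
    using ocnj_add_self[of z] oct_of_real_add[of "oct_Re z" "oct_Re z"]
    by (simp add: v_def ocnj_diff algebra_simps)
  then have cu: "ocnj u = - u" by (simp add: u_def)
  then have uu: "u \<odot> u = oct_of_real (- 1)"
    using omult_ocnj_self[of u] norm_1_inner[OF u(1)] oct_of_real_minus[of 1]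
    by (simp add: omult_minus_right minus_equation_iff)
  \<comment> \<open>Embeds the complex numbers, with u in the role of the imaginary unit.\<close>
  define \<phi> where "\<phi> d = oct_of_real (Re d) + Im d *\<^sub>R u" for d
  have mult: "\<phi> d \<odot> \<phi> e = \<phi> (d * e)" for d e
    by (simp add: \<phi>_def omult_add_left omult_add_right uu oct_of_real_diff oct_of_real_scaleR
        oct_of_real_minus algebra_simps)
  have cnj: "ocnj (\<phi> d) = \<phi> (cnj d)" for d by (simp add: \<phi>_def ocnj_add cu)
  have in_D: "\<phi> d \<in> div_alg m" for d using u by (simp add: \<phi>_def div_alg_intros)
  have "oct_of_real (inner (\<phi> d) (\<phi> d)) = oct_of_real ((norm d)\<^sup>2)" for d
    unfolding omult_ocnj_self[symmetric] cnj mult complex_norm_square[symmetric] by (simp add: \<phi>_def)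
  then have norm: "norm (\<phi> d) = norm d" for d by (simp add: norm_eq_sqrt_inner)
  have z: "z = \<phi> (Complex (oct_Re z) (norm v))"
    using v by (simp add: \<phi>_def u_def) (simp add: v_def)
  define Z where "Z = Complex (oct_Re z) (norm v)"
  obtain t where t: "Z = of_real (norm Z) * cis t"
    using cis_Arg[of Z] v by (metis complex_norm_eq_1_exp mult.commute of_real_0 mult_zero_left
        rcis_cmod_Arg rcis_def)
  \<comment> \<open>Three factors of angle -t/3 cancel the argument t of Z.\<close>
  have "cis (- t / 3) * (cis (- t / 3) * Z * cis (- t / 3)) = of_real (norm Z)"
    by (subst t) (simp add: cis_mult)
  then have "\<phi> (cis (- t / 3)) \<odot> ((\<phi> (cis (- t / 3)) \<odot> z) \<odot> \<phi> (cis (- t / 3))) = oct_of_real (norm Z)"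
    by (subst z) (simp add: mult flip: Z_def, simp add: \<phi>_def)
  then show ?thesis by (intro that[OF in_D]) (simp_all add: norm)
qed

lemma ex_phase_real:
  assumes "x \<in> div_alg m"
  obtains u where "u \<in> div_alg m" "norm u = 1" "x \<odot> u = oct_of_real (norm x)"
proof (cases "x = 0")
  case True
  then show ?thesis by (intro that[of "oct_of_real 1"]) simp_all
next
  case False
  then show ?thesis using assms
    by (intro that[of "(1 / norm x) *\<^sub>R ocnj x"])
      (simp_all add: div_alg_intros omult_ocnj_self oct_of_real_scaleR dot_square_norm power2_eq_square)
qed

lemma reachable_phase:
  "u \<in> div_alg m \<Longrightarrow> norm u = 1 \<Longrightarrow>
    reachable m (herm a b c x y z) (herm a b c (x \<odot> u) ((ocnj u \<odot> y) \<odot> ocnj u) (u \<odot> z))"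
  unfolding reachable_def by (rule bexI[of _ "phase u"]) (simp_all add: unitary_moves.phase)

text \<open>This is \<open>reachable_phase\<close> conjugated by the cyclic permutation of the
  indices.\<close>

lemma reachable_phase':
  assumes "u \<in> div_alg m" "norm u = 1"
  shows "reachable m (herm a b c x y z) (herm a b c (u \<odot> x) (y \<odot> u) ((ocnj u \<odot> z) \<odot> ocnj u))"
  using reachable_cycle[of m a b c x y z] reachable_phase[OF assms, of b c a y z x]
    reachable_cycle[of m b c a "y \<odot> u" "(ocnj u \<odot> z) \<odot> ocnj u" "u \<odot> x"]
    reachable_cycle[of m c a b "(ocnj u \<odot> z) \<odot> ocnj u" "u \<odot> x" "y \<odot> u"]
  by (meson reachable_trans)

lemma ex_cubic_root: "\<exists>t::real. t^3 + p * t\<^sup>2 + q * t + r = 0"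
proof -
  define f where "f t = t^3 + p * t\<^sup>2 + q * t + r" for t
  \<comment> \<open>Chosen so that at |s| = T the lower terms are bounded by (T - 1) T^2, which is
    less than T^3.\<close>
  define T where "T = 1 + \<bar>p\<bar> + \<bar>q\<bar> + \<bar>r\<bar>"
  have T: "T \<ge> 1" by (simp add: T_def)
  have b: "\<bar>p * s\<^sup>2 + q * s + r\<bar> < T^3" if s: "\<bar>s\<bar> = T" for s
  proof -
    have s2: "s\<^sup>2 = T\<^sup>2" using s by (metis power2_abs)
    have TT: "T \<le> T\<^sup>2" "1 \<le> T\<^sup>2" using T by (simp_all add: power2_eq_square mult_ge1_I)
    have "\<bar>p * s\<^sup>2 + q * s + r\<bar> \<le> \<bar>p\<bar> * T\<^sup>2 + \<bar>q\<bar> * T + \<bar>r\<bar>"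
      using abs_triangle_ineq[of "p * s\<^sup>2 + q * s" r] abs_triangle_ineq[of "p * s\<^sup>2" "q * s"]
      by (simp add: abs_mult s s2)
    also have "\<dots> \<le> \<bar>p\<bar> * T\<^sup>2 + \<bar>q\<bar> * T\<^sup>2 + \<bar>r\<bar> * T\<^sup>2"
      using mult_left_mono[OF TT(1), of "\<bar>q\<bar>"] mult_left_mono[OF TT(2), of "\<bar>r\<bar>"] by simp
    also have "\<dots> = (T - 1) * T\<^sup>2" by (simp add: T_def algebra_simps)
    also have "\<dots> < T * T\<^sup>2" using T by (intro mult_strict_right_mono) auto
    finally show ?thesis by (simp add: power3_eq_cube power2_eq_square)
  qed
  have "f (- T) < 0" "0 < f T"
    using b[of "- T"] b[of T] T by (simp_all add: f_def abs_less_iff)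
  moreover have "continuous_on {-T..T} f" unfolding f_def by (intro continuous_intros)
  ultimately obtain t where "f t = 0" using IVT'[of f "-T" 0 T] T by auto
  then show ?thesis unfolding f_def by blast
qed

lemma ex_eigenvector:
  fixes M :: "real^3^3"
  obtains v l where "norm v = 1" "M *v v = l *\<^sub>R v"
proof -
  have "det (M - t *\<^sub>R mat 1) = - (t^3 + (- (M$1$1 + M$2$2 + M$3$3)) * t\<^sup>2
      + (M$1$1 * M$2$2 - M$1$2 * M$2$1 + M$1$1 * M$3$3 - M$1$3 * M$3$1 + M$2$2 * M$3$3 - M$2$3 * M$3$2) * t
      + (- det M))" for t
    by (simp add: det_3 mat_def power2_eq_square power3_eq_cube algebra_simps)
  then obtain t where t: "det (M - t *\<^sub>R mat 1) = 0" using ex_cubic_root by (metis neg_equal_0_iff_equal)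
  then have "\<not> invertible (M - t *\<^sub>R mat 1)" by (simp add: invertible_det_nz)
  then obtain w where w: "(M - t *\<^sub>R mat 1) *v w = 0" "w \<noteq> 0"
    using matrix_left_invertible_ker[of "M - t *\<^sub>R mat 1"] invertible_left_inverse by blast
  then have "M *v w = t *\<^sub>R w"
    by (simp add: matrix_vector_mult_diff_rdistrib scaleR_matrix_vector_assoc[symmetric])
  then show ?thesis using w(2)
    by (intro that[of "(1 / norm w) *\<^sub>R w" t]) (simp_all add: matrix_vector_mult_scaleR)
qed

text \<open>A rotation takes a real eigenvector to the second axis, which clears the entries (1,2)
  and (3,2); a rotation in the (1,3) plane clears the last one.\<close>

lemma reachable_Diag_real:
  "\<exists>l1 l2 l3. reachable m (herm a b c (oct_of_real x) (oct_of_real y) (oct_of_real z)) (Diag l1 l2 l3)"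
proof -
  define M :: "real^3^3" where "M = vector [vector [a, z, y], vector [z, b, x], vector [y, x, c]]"
  let ?X = "herm a b c (oct_of_real x) (oct_of_real y) (oct_of_real z)"
  have M: "?X $ i $ j = oct_of_real (M $ i $ j)" for i j
    using exhaust_3[of i] exhaust_3[of j] by (auto simp: M_def)
  obtain v l where v: "norm v = 1" "M *v v = l *\<^sub>R v" by (rule ex_eigenvector)
  obtain B where B: "rotation_matrix B" "B *v axis 2 1 = v"
    using rotation_matrix_exists_basis[of v 2] v(1) by auto
  \<comment> \<open>The second row of A is the eigenvector, since B maps the second basis vector to
    v.\<close>
  define A where "A = transpose B"
  have A: "orthogonal_matrix A" "det A = 1"
    using B by (simp_all add: A_def rotation_matrix_def det_transpose)
  have col: "A $ 2 $ k = v $ k" for k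
    using arg_cong[OF B(2), of "\<lambda>w. w $ k"]
    by (simp add: A_def transpose_def matrix_vector_mult_def axis_def if_distrib cong: if_cong)
  have row: "(\<Sum>l\<in>UNIV. M$k$l * v$l) = l * v$k" for k
    using arg_cong[OF v(2), of "\<lambda>w. w $ k"] by (simp add: matrix_vector_mult_def)
  have "A ** transpose A = mat 1" using A(1) by (simp add: orthogonal_matrix_def)
  then have "(A ** transpose A) $ i $ 2 = mat 1 $ i $ 2" for i by simp
  then have dual: "(\<Sum>k\<in>UNIV. A$i$k * A$2$k) = (if i = 2 then 1 else 0)" for i
    by (simp add: matrix_matrix_mult_def transpose_def mat_def)
  let ?N = "\<lambda>i j. \<Sum>k\<in>UNIV. \<Sum>l\<in>UNIV. A$i$k * A$j$l * M$k$l"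
  have N: "real_cong A ?X $ i $ j = oct_of_real (?N i j)" for i j
    unfolding real_cong_nth M by (simp add: sum_3 oct_of_real_add oct_of_real_scaleR)
  have N2: "?N i 2 = (if i = 2 then l else 0)" for i
  proof -
    have "?N i 2 = (\<Sum>k\<in>UNIV. A$i$k * (\<Sum>l\<in>UNIV. M$k$l * v$l))"
      by (simp add: sum_3 col algebra_simps)
    also have "\<dots> = l * (\<Sum>k\<in>UNIV. A$i$k * A$2$k)"
      unfolding row by (simp add: col sum_3 algebra_simps)
    finally show ?thesis by (simp add: dual)
  qed
  have "real_cong A ?X \<in> Herm 0" by (rule real_cong_Herm) simp
  then obtain a' b' c' x' y' z' where X': "real_cong A ?X = herm a' b' c' x' y' z'"
    by (rule HermE)
  have "oct_of_real (?N 3 2) = 0" "oct_of_real (?N 1 2) = 0" unfolding N2 by simp_all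
  then have xyz: "x' = 0" "z' = 0" "y' = oct_of_real (?N 3 1)"
    using N[of 3 2] N[of 1 2] N[of 3 1] unfolding X' herm_nth by (metis ocnj_eq_0_iff)+
  have r: "reachable m ?X (herm a' b' c' 0 (oct_of_real (?N 3 1)) 0)"
    using reachable_real_cong[OF A, of m ?X] unfolding X' xyz .
  obtain a'' c'' x'' z'' where r': "reachable m (herm a' b' c' 0 (oct_of_real (?N 3 1)) 0) (herm a'' b' c'' x'' 0 z'')"
      "x'' = 0" "z'' = 0"
    using reachable_rotate31[of m a' b' c' 0 "?N 3 1" 0] by blast
  have "reachable m ?X (Diag a'' b' c'')"
    using reachable_trans[OF r r'(1)] unfolding r'(2,3) Diag_eq_herm .
  then show ?thesis by blast
qed

text \<open>A phase makes one off-diagonal entry real and a rotation then kills it. With one entry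
  zero, the other two can both be made real, by \<open>ex_phase_real\<close> and
  \<open>ex_cube_phase\<close>, and the real symmetric case remains.\<close>

lemma reachable_Diag:
  assumes "X \<in> Herm m" shows "\<exists>l1 l2 l3. reachable m X (Diag l1 l2 l3)"
proof -
  obtain a b c x y z where X: "X = herm a b c x y z" "x \<in> div_alg m" "y \<in> div_alg m" "z \<in> div_alg m"
    using assms by (rule HermE)
  obtain u where "u \<in> div_alg m" "norm u = 1" "x \<odot> u = oct_of_real (norm x)"
    using X(2) by (rule ex_phase_real)
  then obtain y1 z1 where r1: "reachable m X (herm a b c (oct_of_real (norm x)) y1 z1)"
    using reachable_phase X(1) by metis
  have r2: "reachable m X (herm c a b z1 (oct_of_real (norm x)) y1)"
    using r1 reachable_cycle reachable_trans by metis
  obtain a2 c2 x2 z2 where r3: "reachable m X (herm a2 a c2 x2 0 z2)"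
    using r2 reachable_rotate31 reachable_trans by metis
  have "herm a2 a c2 x2 0 z2 \<in> Herm m" using r3 assms by (rule reachable_Herm)
  then have x2: "x2 \<in> div_alg m" by simp
  obtain u2 where u2: "u2 \<in> div_alg m" "norm u2 = 1" "x2 \<odot> u2 = oct_of_real (norm x2)"
    using x2 by (rule ex_phase_real)
  define z3 where "z3 = u2 \<odot> z2"
  have r4: "reachable m X (herm a2 a c2 (oct_of_real (norm x2)) 0 z3)"
    using reachable_trans[OF r3 reachable_phase[OF u2(1,2)]] by (simp add: u2(3) z3_def)
  have "herm a2 a c2 (oct_of_real (norm x2)) 0 z3 \<in> Herm m" using r4 assms by (rule reachable_Herm)
  then have "z3 \<in> div_alg m" by simp
  then obtain w r where w: "w \<in> div_alg m" "norm w = 1" "w \<odot> ((w \<odot> z3) \<odot> w) = oct_of_real r"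
    by (rule ex_cube_phase)
  \<comment> \<open>Two phases in different positions: their effects on the entry x2 cancel, while
    z3 picks up w on both sides and then once more on the left.\<close>
  have "reachable m (herm a2 a c2 (oct_of_real (norm x2)) 0 z3)
      (herm a2 a c2 (norm x2 *\<^sub>R ocnj w) 0 ((w \<odot> z3) \<odot> w))"
    using reachable_phase'[of "ocnj w" m a2 a c2 "oct_of_real (norm x2)" 0 z3] w by simp
  also have "reachable m \<dots> (herm a2 a c2 (oct_of_real (norm x2)) (oct_of_real 0) (oct_of_real r))"
    using reachable_phase[of w m a2 a c2 "norm x2 *\<^sub>R ocnj w" 0 "(w \<odot> z3) \<odot> w"] w
    by (simp add: ocnj_omult_self norm_1_inner oct_of_real_scaleR)
  finally have "reachable m X (herm a2 a c2 (oct_of_real (norm x2)) (oct_of_real 0) (oct_of_real r))"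
    using r4 reachable_trans by metis
  then show ?thesis using reachable_Diag_real reachable_trans by metis
qed

section \<open>Jordan automorphisms and eigenvalues\<close>

lemma jordan_autD:
  assumes "g \<in> jordan_aut m"
  shows jordan_aut_bij: "bij_betw g (Herm m) (Herm m)"
    and jordan_aut_add: "X \<in> Herm m \<Longrightarrow> Y \<in> Herm m \<Longrightarrow> g (X + Y) = g X + g Y"
    and jordan_aut_scaleR: "X \<in> Herm m \<Longrightarrow> g (c *\<^sub>R X) = c *\<^sub>R g X"
    and jordan_aut_jordan: "X \<in> Herm m \<Longrightarrow> Y \<in> Herm m \<Longrightarrow> g (jordan_prod X Y) = jordan_prod (g X) (g Y)"
    and jordan_aut_in: "X \<in> Herm m \<Longrightarrow> g X \<in> Herm m"
  using assms by (auto simp: jordan_aut_def GL_on_def Bij_def bij_betw_def)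

lemma restrict_in_GL_on:
  assumes "linear f" "subspace V" "\<And>x. x \<in> V \<Longrightarrow> f x \<in> V" "\<And>x. x \<in> V \<Longrightarrow> g x \<in> V"
    and "\<And>x. x \<in> V \<Longrightarrow> g (f x) = x" "\<And>x. x \<in> V \<Longrightarrow> f (g x) = x"
  shows "restrict f V \<in> GL_on V"
proof -
  have "bij_betw f V V" using assms by (intro bij_betwI[where g = g]) auto
  then show ?thesis
    using assms by (auto simp: GL_on_def Bij_def subspace_def linear_add linear_cmul cong: bij_betw_cong)
qed

lemma unitary_moves_jordan_aut:
  assumes "f \<in> unitary_moves m" "m \<le> k" "k \<le> 3"
  shows "restrict f (Herm k) \<in> jordan_aut k"
proof -
  obtain g where g: "g \<in> unitary_moves m" "\<forall>X\<in>Herm 3. g (f X) = X \<and> f (g X) = X"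
    using unitary_moves_inverse[OF assms(1)] by blast
  have H3: "X \<in> Herm 3" if "X \<in> Herm k" for X using that assms(3) Herm_mono by blast
  have "restrict f (Herm k) \<in> GL_on (Herm k)"
    using g H3 unitary_moves_Herm[OF assms(1,2)] unitary_moves_Herm[OF g(1) assms(2)]
    by (intro restrict_in_GL_on[where g = g] unitary_moves_linear[OF assms(1)] subspace_Herm) blast+
  then show ?thesis
    using unitary_moves_jordan[OF assms(1)] H3 by (simp add: jordan_aut_def jordan_prod_in_Herm)
qed

lemma jordan_aut_one:
  assumes g: "g \<in> jordan_aut m" and m: "m \<le> 3" shows "g (Diag 1 1 1) = Diag 1 1 1"
proof -
  let ?I = "Diag 1 1 1"
  obtain X where X: "X \<in> Herm m" "g X = ?I"
    using jordan_aut_bij[OF g] by (metis Diag_in_Herm bij_betw_iff_bijections)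
  have 3: "Y \<in> Herm 3" if "Y \<in> Herm m" for Y using that m Herm_mono by blast
  have "?I = g (jordan_prod X ?I)" using X 3 by (simp add: jordan_prod_one)
  also have "\<dots> = jordan_prod (g ?I) ?I" using X by (simp add: jordan_aut_jordan[OF g] jordan_prod_commute)
  also have "\<dots> = g ?I" using jordan_aut_in[OF g] 3 by (simp add: jordan_prod_one)
  finally show ?thesis by simp
qed

text \<open>After diagonalisation the entries are 0 or 1, and not all of them are 0.\<close>

lemma idempotent_trace_ge_1:
  assumes "P \<in> Herm m" "m \<le> 3" "jordan_prod P P = P" "P \<noteq> 0"
  shows "herm_trace P \<ge> 1"
proof -
  have P3: "P \<in> Herm 3" using assms Herm_mono by blast
  obtain p q r where "reachable m P (Diag p q r)" using reachable_Diag[OF assms(1)] by blast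
  then obtain f where f: "f \<in> unitary_moves m" "f P = Diag p q r" unfolding reachable_def by blast
  have "jordan_prod (Diag p q r) (Diag p q r) = Diag p q r"
    using unitary_moves_jordan[OF f(1) P3 P3] assms(3) f(2) by simp
  then have pqr: "p * p = p" "q * q = q" "r * r = r" by (simp_all add: Diag_eq_herm jordan_prod_herm)
  have tr: "herm_trace P = p + q + r"
    using unitary_moves_trace[OF f(1) P3] f(2) by (simp add: Diag_eq_herm)
  have "\<not> (p = 0 \<and> q = 0 \<and> r = 0)"
  proof
    assume "p = 0 \<and> q = 0 \<and> r = 0"
    then have "f P = 0" using f(2) by (simp add: Diag_eq_herm herm_0)
    obtain g where g: "g \<in> unitary_moves m" "\<forall>X\<in>Herm 3. g (f X) = X \<and> f (g X) = X"
      using unitary_moves_inverse[OF f(1)] by blast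
    then have "P = g 0" using P3 \<open>f P = 0\<close> by metis
    then show False using assms(4) linear_0[OF unitary_moves_linear[OF g(1)]] by simp
  qed
  moreover have "p = 0 \<or> p = 1" "q = 0 \<or> q = 1" "r = 0 \<or> r = 1" using pqr by auto
  ultimately show ?thesis unfolding tr by auto
qed

text \<open>An automorphism maps a frame of three primitive idempotents to three nonzero idempotents with
  sum \<open>1\<close>; their traces are at least \<open>1\<close> and add up to \<open>3\<close>.\<close>

lemma jordan_aut_trace:
  assumes g: "g \<in> jordan_aut m" and m: "m \<le> 3" and X: "X \<in> Herm m"
  shows "herm_trace (g X) = herm_trace X"
proof -
  have H3: "Y \<in> Herm 3" if "Y \<in> Herm m" for Y using that m Herm_mono by blast
  obtain l1 l2 l3 where "reachable m X (Diag l1 l2 l3)" using reachable_Diag[OF X] by blast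
  then obtain f where f: "f \<in> unitary_moves m" "f (Diag l1 l2 l3) = X"
    using reachable_sym[OF _ H3[OF X]] unfolding reachable_def by blast
  note lin = unitary_moves_linear[OF f(1)]
  define F where "F a b c = f (Diag a b c)" for a b c
  have FH: "F a b c \<in> Herm m" for a b c
    unfolding F_def by (rule unitary_moves_Herm[OF f(1) order_refl Diag_in_Herm])
  have FF: "jordan_prod (F a b c) (F a b c) = F (a * a) (b * b) (c * c)" for a b c
    unfolding F_def unitary_moves_jordan[OF f(1) Diag_in_Herm Diag_in_Herm, symmetric]
    by (simp add: Diag_eq_herm jordan_prod_herm)
  have F_tr: "herm_trace (F a b c) = a + b + c" for a b c
    unfolding F_def using unitary_moves_trace[OF f(1) Diag_in_Herm] by (simp add: Diag_eq_herm)
  have F_lin: "F a b c = a *\<^sub>R F 1 0 0 + b *\<^sub>R F 0 1 0 + c *\<^sub>R F 0 0 1" for a b c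
    unfolding F_def linear_cmul[OF lin, symmetric] linear_add[OF lin, symmetric]
    by (simp add: Diag_eq_herm herm_ops)
  have gF: "g (F a b c) = a *\<^sub>R g (F 1 0 0) + b *\<^sub>R g (F 0 1 0) + c *\<^sub>R g (F 0 0 1)" for a b c
    unfolding F_lin[of a b c]
    by (simp add: jordan_aut_add[OF g] jordan_aut_scaleR[OF g] FH Herm_intros)
  have ge: "herm_trace (g (F a b c)) \<ge> 1" if abc: "a * a = a" "b * b = b" "c * c = c" "a + b + c = 1" for a b c
  proof (rule idempotent_trace_ge_1[OF jordan_aut_in[OF g FH] m])
    show "jordan_prod (g (F a b c)) (g (F a b c)) = g (F a b c)"
      using jordan_aut_jordan[OF g FH FH, of a b c a b c] FF[of a b c] abc by simp
    show "g (F a b c) \<noteq> 0"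
    proof
      assume "g (F a b c) = 0"
      then have "g (F a b c) = g (0 *\<^sub>R F a b c)" unfolding jordan_aut_scaleR[OF g FH] by simp
      then have "F a b c = 0 *\<^sub>R F a b c"
        using jordan_aut_bij[OF g] FH Herm_intros(3)[OF FH] by (metis bij_betw_iff_bijections)
      then show False using F_tr[of a b c] abc(4) by (simp add: herm_trace_def)
    qed
  qed
  have unit: "F 1 1 1 = Diag 1 1 1"
    unfolding F_def
    using jordan_aut_one[OF unitary_moves_jordan_aut[OF f(1) order_refl m] m] by simp
  have "herm_trace (g (F 1 1 1)) = 3"
    unfolding unit jordan_aut_one[OF g m] by (simp add: Diag_eq_herm)
  then have "herm_trace (g (F 1 0 0)) = 1" "herm_trace (g (F 0 1 0)) = 1" "herm_trace (g (F 0 0 1)) = 1"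
    using ge[of 1 0 0] ge[of 0 1 0] ge[of 0 0 1] unfolding gF[of 1 1 1]
    by (simp_all add: herm_trace_add)
  then have "herm_trace (g (F l1 l2 l3)) = l1 + l2 + l3"
    unfolding gF[of l1 l2 l3] by (simp add: herm_trace_add herm_trace_scaleR)
  then show ?thesis using F_tr[of l1 l2 l3] f(2) by (simp add: F_def)
qed

text \<open>Once the trace is preserved, Newton's identities give \<open>sec3\<close> and
  \<open>det3\<close>, and the formula for the square gives the adjoint.\<close>

lemma jordan_aut_invariants:
  assumes g: "g \<in> jordan_aut m" and m: "m \<le> 3" and X: "X \<in> Herm m"
  shows jordan_aut_sec3: "sec3 (g X) = sec3 X"
    and jordan_aut_det3: "det3 (g X) = det3 X"
    and jordan_aut_adj3: "adj3 (g X) = g (adj3 X)"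
proof -
  have H3: "Y \<in> Herm 3" if "Y \<in> Herm m" for Y using that m Herm_mono by blast
  note gX = jordan_aut_in[OF g X] and XX = jordan_prod_in_Herm[OF X X]
  note tr = jordan_aut_trace[OF g m]
  show s: "sec3 (g X) = sec3 X"
    using trace_square_eq[OF H3[OF gX]] trace_square_eq[OF H3[OF X]] tr[OF X] tr[OF XX]
    by (simp add: jordan_aut_jordan[OF g X X])
  show "det3 (g X) = det3 X"
    using trace_cube_eq[OF H3[OF gX]] trace_cube_eq[OF H3[OF X]] tr[OF X] s
      tr[OF jordan_prod_in_Herm[OF X XX]]
    by (simp add: jordan_aut_jordan[OF g X X] jordan_aut_jordan[OF g X XX])
  have "g (jordan_prod X X) = g (adj3 X + herm_trace X *\<^sub>R X + (- sec3 X) *\<^sub>R Diag 1 1 1)"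
    using square_eq_adj3[OF H3[OF X]] by simp
  also have "\<dots> = g (adj3 X) + herm_trace X *\<^sub>R g X + (- sec3 X) *\<^sub>R Diag 1 1 1"
    using X by (simp add: jordan_aut_add[OF g] jordan_aut_scaleR[OF g] Herm_intros adj3_in_Herm
        jordan_aut_one[OF g m] del: scaleR_minus_left)
  finally show "adj3 (g X) = g (adj3 X)"
    using square_eq_adj3[OF H3[OF gX]] by (simp add: jordan_aut_jordan[OF g X X] s tr[OF X])
qed

section \<open>Eigenvalues, and polynomial descriptions of the plane, the cone and its
  boundary\<close>

lemma det3_Diag: "det3 (Diag a b c) = a * b * c"
  and sec3_Diag: "sec3 (Diag a b c) = a * b + b * c + c * a"
  and trace_Diag: "herm_trace (Diag a b c) = a + b + c"
  and adj3_Diag: "adj3 (Diag a b c) = Diag (b * c) (c * a) (a * b)"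
  by (simp_all add: Diag_eq_herm det3_herm sec3_herm adj3_herm)

lemma reachable_invariants:
  assumes "reachable m X Y" "m \<le> 3" "X \<in> Herm m"
  shows reachable_trace: "herm_trace Y = herm_trace X"
    and reachable_sec3: "sec3 Y = sec3 X"
    and reachable_det3: "det3 Y = det3 X"
    and reachable_adj3: "reachable m (adj3 X) (adj3 Y)"
proof -
  obtain f where f: "f \<in> unitary_moves m" "f X = Y" using assms(1) unfolding reachable_def by blast
  note a = unitary_moves_jordan_aut[OF f(1) order_refl assms(2)]
  show "herm_trace Y = herm_trace X" "sec3 Y = sec3 X" "det3 Y = det3 X"
    using jordan_aut_trace[OF a assms(2,3)] jordan_aut_sec3[OF a assms(2,3)]
      jordan_aut_det3[OF a assms(2,3)] assms(3) f(2) by simp_all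
  show "reachable m (adj3 X) (adj3 Y)"
    unfolding reachable_def using jordan_aut_adj3[OF a assms(2,3)] f assms(3) adj3_in_Herm[OF assms(3)]
    by (intro bexI[of _ f]) simp_all
qed

lemma has_eigenvalues_det3:
  assumes "has_eigenvalues m X l1 l2 l3" "m \<le> 3" "X \<in> Herm m"
  shows "det3 X = l1 * l2 * l3" "sec3 X = l1 * l2 + l2 * l3 + l3 * l1" "herm_trace X = l1 + l2 + l3"
proof -
  obtain g where g: "g \<in> jordan_aut m" "g X = Diag l1 l2 l3"
    using assms(1) unfolding has_eigenvalues_def by blast
  show "det3 X = l1 * l2 * l3" "sec3 X = l1 * l2 + l2 * l3 + l3 * l1" "herm_trace X = l1 + l2 + l3"
    using jordan_aut_det3[OF g(1) assms(2,3)] jordan_aut_sec3[OF g(1) assms(2,3)]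
      jordan_aut_trace[OF g(1) assms(2,3)] g(2) by (simp_all add: det3_Diag sec3_Diag trace_Diag)
qed

lemma ex_eigenvalues:
  assumes "X \<in> Herm m" "m \<le> 3"
  obtains l1 l2 l3 where "has_eigenvalues m X l1 l2 l3" "reachable m X (Diag l1 l2 l3)"
proof -
  obtain a b c where r: "reachable m X (Diag a b c)" using reachable_Diag[OF assms(1)] by blast
  obtain l1 l2 l3 where l: "l1 \<le> l2" "l2 \<le> l3" "reachable m (Diag a b c) (Diag l1 l2 l3)"
    by (rule reachable_Diag_sorted)
  have r: "reachable m X (Diag l1 l2 l3)" using reachable_trans[OF r l(3)] .
  then obtain f where f: "f \<in> unitary_moves m" "f X = Diag l1 l2 l3" unfolding reachable_def by blast
  have "has_eigenvalues m X l1 l2 l3"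
    unfolding has_eigenvalues_def using l(1,2) f(2) assms(1) unitary_moves_jordan_aut[OF f(1) order_refl assms(2)]
    by (auto intro!: bexI[of _ "restrict f (Herm m)"])
  then show ?thesis using r by (rule that)
qed

text \<open>Justifies the \<open>THE\<close> in the definition: eigenvalues exist, and their product
  does not depend on the diagonalising automorphism because it is the value of an invariant
  polynomial.\<close>

lemma herm_det_eq_det3:
  assumes "X \<in> Herm m" "m \<le> 3" shows "herm_det m X = det3 X"
proof -
  obtain l1 l2 l3 where "has_eigenvalues m X l1 l2 l3" using ex_eigenvalues[OF assms] by blast
  then show ?thesis
    unfolding herm_det_def using has_eigenvalues_det3(1)[OF _ assms(2,1)] by (intro the_equality) metis+
qed

text \<open>The adjoint of a diagonal matrix consists of the products of two eigenvalues. If it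
  vanishes, at most one eigenvalue survives, and the trace makes it 1; permutations bring it to the
  first place.\<close>

lemma Plane_eq:
  assumes "n \<le> 3" shows "Plane n = {X \<in> Herm1 n. adj3 X = 0}"
proof (intro equalityI subsetI)
  fix X assume "X \<in> Plane n"
  then obtain g where g: "g \<in> jordan_aut n" "X = g (Diag 1 0 0)" unfolding Plane_def by blast
  have "adj3 (Diag 1 0 0) = 0 *\<^sub>R Diag 1 0 0" by (simp add: adj3_Diag) (simp add: Diag_eq_herm herm_0)
  then have "adj3 X = 0"
    using jordan_aut_adj3[OF g(1) assms Diag_in_Herm] jordan_aut_scaleR[OF g(1) Diag_in_Herm, of 0]
    unfolding g(2) by simp
  then show "X \<in> {X \<in> Herm1 n. adj3 X = 0}"
    using jordan_aut_trace[OF g(1) assms Diag_in_Herm] jordan_aut_in[OF g(1) Diag_in_Herm]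
    by (simp add: g(2) Herm1_def trace_Diag)
next
  fix X assume X: "X \<in> {X \<in> Herm1 n. adj3 X = 0}"
  then have XH: "X \<in> Herm n" "herm_trace X = 1" by (simp_all add: Herm1_def)
  obtain l1 l2 l3 where r: "reachable n X (Diag l1 l2 l3)" using reachable_Diag[OF XH(1)] by blast
  obtain f where f: "f \<in> unitary_moves n" "f (adj3 X) = adj3 (Diag l1 l2 l3)"
    using reachable_adj3[OF r assms XH(1)] unfolding reachable_def by blast
  have "Diag (l2 * l3) (l3 * l1) (l1 * l2) = 0"
    using X f(2) linear_0[OF unitary_moves_linear[OF f(1)]] by (simp add: adj3_Diag)
  then have l0: "l2 * l3 = 0" "l3 * l1 = 0" "l1 * l2 = 0" by (simp_all add: Diag_eq_herm herm_0)
  have "l1 + l2 + l3 = 1" using reachable_trace[OF r assms XH(1)] XH(2) by (simp add: trace_Diag)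
  with l0 consider "l1 = 1" "l2 = 0" "l3 = 0" | "l1 = 0" "l2 = 1" "l3 = 0" | "l1 = 0" "l2 = 0" "l3 = 1"
    by auto
  then have "reachable n (Diag l1 l2 l3) (Diag 1 0 0)"
    by cases (metis reachable_refl, metis reachable_swap, metis reachable_Diag_cycle reachable_trans)
  then have "reachable n X (Diag 1 0 0)" using r reachable_trans by blast
  then have "reachable n (Diag 1 0 0) X"
    using reachable_sym Herm_mono[OF assms XH(1)] by blast
  then obtain f where f: "f \<in> unitary_moves n" "f (Diag 1 0 0) = X" unfolding reachable_def by blast
  then show "X \<in> Plane n"
    unfolding Plane_def using unitary_moves_jordan_aut[OF f(1) order_refl assms]
    by (auto intro!: exI[of _ "restrict f (Herm n)"])
qed

text \<open>Suppose l1 < 0. The largest eigenvalue is positive, so det \<ge> 0 forces l2 \<le> 0.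
  With a = -(l1 + l2) > 0 the second symmetric function equals l1 l2 - a^2 - a, which is negative
  because l1 l2 \<le> a^2.\<close>

lemma smallest_eigenvalue_nonneg:
  fixes l1 l2 l3 :: real
  assumes "l1 \<le> l2" "l2 \<le> l3" "l1 + l2 + l3 = 1" "0 \<le> l1 * l2 + l2 * l3 + l3 * l1" "0 \<le> l1 * l2 * l3"
  shows "0 \<le> l1"
proof (rule ccontr)
  assume "\<not> 0 \<le> l1"
  then have l1: "l1 < 0" by simp
  have "0 < l3" using assms(1-3) l1 by linarith
  have l2: "l2 \<le> 0"
  proof (rule ccontr)
    assume "\<not> l2 \<le> 0"
    then have "0 < l2 * l3" using \<open>0 < l3\<close> by simp
    then have "l1 * (l2 * l3) < 0" using l1 by (simp add: mult_neg_pos)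
    then show False using assms(5) by (simp add: mult.assoc)
  qed
  define a where "a = - (l1 + l2)"
  have "a > 0" using l1 l2 by (simp add: a_def)
  have l3: "l3 = 1 - l1 - l2" using assms(3) by simp
  have "l1 * l2 + l2 * l3 + l3 * l1 = l1 * l2 - a * a - a" by (simp add: a_def l3 algebra_simps)
  moreover have "l1 * l2 \<le> a * a"
    using l1 l2 mult_nonpos_nonpos[of l1 l2] by (simp add: a_def algebra_simps)
  ultimately show False using assms(4) \<open>a > 0\<close> by linarith
qed

lemma pos_symmetric_functions:
  fixes a b c :: real
  assumes "0 < a" "0 < b" "0 < c"
  shows "0 < a * b * c \<and> 0 < a * b + b * c + c * a"
  using assms by (intro conjI mult_pos_pos add_pos_pos)

text \<open>Replaces a condition on eigenvalues by two strict polynomial inequalities, from which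
  openness is immediate.\<close>

lemma Lambda_pos_eq:
  assumes "m \<le> 3" shows "Lambda_pos m = {X \<in> Herm1 m. 0 < det3 X \<and> 0 < sec3 X}"
proof (intro equalityI subsetI)
  fix X assume "X \<in> Lambda_pos m"
  then obtain l1 l2 l3 where X: "X \<in> Herm1 m" and l: "has_eigenvalues m X l1 l2 l3" "0 < l1"
    unfolding Lambda_pos_def by blast
  have "0 < l2" "0 < l3" using l by (simp_all add: has_eigenvalues_def)
  with l(2) have "0 < l1 * l2 * l3" "0 < l1 * l2 + l2 * l3 + l3 * l1"
    using pos_symmetric_functions[of l1 l2 l3] by simp_all
  then show "X \<in> {X \<in> Herm1 m. 0 < det3 X \<and> 0 < sec3 X}"
    using X has_eigenvalues_det3(1,2)[OF l(1) assms] by (simp add: Herm1_def)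
next
  fix X assume X: "X \<in> {X \<in> Herm1 m. 0 < det3 X \<and> 0 < sec3 X}"
  then have XH: "X \<in> Herm m" "herm_trace X = 1" by (simp_all add: Herm1_def)
  obtain l1 l2 l3 where l: "has_eigenvalues m X l1 l2 l3" using ex_eigenvalues[OF XH(1) assms] by blast
  note e = has_eigenvalues_det3[OF l assms XH(1)]
  have "l1 \<le> l2" "l2 \<le> l3" using l by (simp_all add: has_eigenvalues_def)
  moreover have "l1 + l2 + l3 = 1" "0 < l1 * l2 * l3" "0 < l1 * l2 + l2 * l3 + l3 * l1"
    using X XH(2) unfolding mem_Collect_eq e by simp_all
  ultimately have "0 \<le> l1" by - (rule smallest_eigenvalue_nonneg[of l1 l2 l3]; simp)
  moreover have "l1 \<noteq> 0" using \<open>0 < l1 * l2 * l3\<close> by auto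
  ultimately have "0 < l1" by simp
  then show "X \<in> Lambda_pos m" unfolding Lambda_pos_def using X l by blast
qed

lemma continuous_on_entry: "continuous_on S (\<lambda>X::omat. X$i$j)"
  by (intro continuous_on_component continuous_on_id)

lemmas entry_continuous = continuous_on_add continuous_on_diff continuous_on_mult continuous_on_inner
  continuous_on_omult continuous_on_scaleR continuous_on_oct continuous_on_entry continuous_on_const

lemma continuous_on_trace [continuous_intros]: "continuous_on S herm_trace"
  unfolding herm_trace_def[abs_def] sum_3 by (rule entry_continuous)+

lemma continuous_on_det3 [continuous_intros]: "continuous_on S det3"
  unfolding det3_def[abs_def] by (rule entry_continuous)+

lemma continuous_on_sec3 [continuous_intros]: "continuous_on S sec3"
  unfolding sec3_def[abs_def] adj3_def herm_trace_herm by (rule entry_continuous)+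

text \<open>The closure of the cone is given by the weak inequalities: they force nonnegative
  eigenvalues, and pushing these towards 1/3 yields positive definite matrices that converge to the
  given one. Removing the open cone leaves det = 0, because within the closure det > 0 already
  forces \<open>sec3\<close> to be positive.\<close>

lemma Sigma_bd_eq:
  assumes "m \<le> 3" shows "Sigma_bd m = {X \<in> Herm1 m. det3 X = 0 \<and> 0 \<le> sec3 X}"
proof -
  let ?T = "top_of_set (Herm1 m)" and ?L = "{X \<in> Herm1 m. 0 < det3 X \<and> 0 < sec3 X}"
  let ?C = "{X \<in> Herm1 m. 0 \<le> det3 X \<and> 0 \<le> sec3 X}"
  have nonneg: "\<exists>l1 l2 l3. reachable m X (Diag l1 l2 l3) \<and> 0 \<le> l1 \<and> l1 \<le> l2 \<and> l2 \<le> l3 \<and> l1 + l2 + l3 = 1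
      \<and> det3 X = l1 * l2 * l3 \<and> sec3 X = l1 * l2 + l2 * l3 + l3 * l1"
    if X: "X \<in> ?C" for X
  proof -
    have XH: "X \<in> Herm m" "herm_trace X = 1" using X by (simp_all add: Herm1_def)
    obtain l1 l2 l3 where l: "has_eigenvalues m X l1 l2 l3" "reachable m X (Diag l1 l2 l3)"
      using ex_eigenvalues[OF XH(1) assms] by blast
    note e = has_eigenvalues_det3[OF l(1) assms XH(1)]
    have o: "l1 \<le> l2" "l2 \<le> l3" using l(1) by (simp_all add: has_eigenvalues_def)
    have t: "l1 + l2 + l3 = 1" using e(3) XH(2) by simp
    have "0 \<le> l1 * l2 + l2 * l3 + l3 * l1" "0 \<le> l1 * l2 * l3"
      using X unfolding mem_Collect_eq e by simp_all
    then have "0 \<le> l1" by (rule smallest_eigenvalue_nonneg[OF o t])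
    then show ?thesis using l(2) o t e(1,2) by (intro exI[of _ l1] exI[of _ l2] exI[of _ l3] conjI)
  qed
  have op: "openin ?T ?L"
  proof -
    have "open ({X. 0 < det3 X} \<inter> {X. 0 < sec3 X})"
      by (rule open_Int[OF open_Collect_less[OF continuous_on_const continuous_on_det3]
            open_Collect_less[OF continuous_on_const continuous_on_sec3]])
    moreover have "?L = Herm1 m \<inter> ({X. 0 < det3 X} \<inter> {X. 0 < sec3 X})" by blast
    ultimately show ?thesis by (simp add: openin_open_Int)
  qed
  have "?T closure_of ?L = ?C"
  proof
    have "closed ({X. 0 \<le> det3 X} \<inter> {X. 0 \<le> sec3 X})"
      by (rule closed_Int[OF closed_Collect_le[OF continuous_on_const continuous_on_det3]
            closed_Collect_le[OF continuous_on_const continuous_on_sec3]])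
    moreover have "?C = Herm1 m \<inter> ({X. 0 \<le> det3 X} \<inter> {X. 0 \<le> sec3 X})" by blast
    ultimately have "closedin ?T ?C" by (simp add: closedin_closed_Int)
    moreover have "?L \<subseteq> ?C" by (simp add: Collect_mono)
    ultimately show "?T closure_of ?L \<subseteq> ?C" by (simp add: closure_of_minimal)
  next
    show "?C \<subseteq> ?T closure_of ?L"
    proof
      fix X assume X: "X \<in> ?C"
      then have XH: "X \<in> Herm m" "herm_trace X = 1" by (simp_all add: Herm1_def)
      obtain l1 l2 l3 where l: "reachable m X (Diag l1 l2 l3)" "0 \<le> l1" "l1 \<le> l2" "l2 \<le> l3" "l1 + l2 + l3 = 1"
        using nonneg[OF X] by blast
      obtain f where f: "f \<in> unitary_moves m" "f (Diag l1 l2 l3) = X"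
        using reachable_sym[OF l(1) Herm_mono[OF assms XH(1)]] unfolding reachable_def by blast
      note lin = unitary_moves_linear[OF f(1)]
      \<comment> \<open>The eigenvalues move linearly from l1, l2, l3 towards 1/3, which keeps the
        trace equal to 1.\<close>
      define Y where "Y e = f (Diag (l1 + e * (1/3 - l1)) (l2 + e * (1/3 - l2)) (l3 + e * (1/3 - l3)))" for e
      have Y: "Y e = X + e *\<^sub>R f (Diag (1/3 - l1) (1/3 - l2) (1/3 - l3))" for e
        unfolding Y_def f(2)[symmetric] linear_cmul[OF lin, symmetric] linear_add[OF lin, symmetric]
        by (simp add: Diag_eq_herm herm_ops)
      have YL: "Y e \<in> ?L" if e: "0 < e" "e \<le> 1" for e
      proof -
        have pos: "0 < l + e * (1/3 - l)" if "0 \<le> l" for l :: real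
        proof -
          have "l + e * (1/3 - l) = (1 - e) * l + e / 3" by (simp add: algebra_simps)
          then show ?thesis using e that by (simp add: add_nonneg_pos)
        qed
        have r: "reachable m (Diag (l1 + e * (1/3 - l1)) (l2 + e * (1/3 - l2)) (l3 + e * (1/3 - l3))) (Y e)"
          unfolding Y_def reachable_def using f(1) by blast
        note inv = reachable_invariants[OF r assms Diag_in_Herm] and YH = reachable_Herm[OF r Diag_in_Herm]
        have p: "0 < l1 + e * (1/3 - l1)" "0 < l2 + e * (1/3 - l2)" "0 < l3 + e * (1/3 - l3)"
          using pos l by simp_all
        have "l1 + e * (1/3 - l1) + (l2 + e * (1/3 - l2)) + (l3 + e * (1/3 - l3))
            = (l1 + l2 + l3) + e * (1 - (l1 + l2 + l3))" by (simp add: algebra_simps)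
        then have "herm_trace (Y e) = 1" unfolding inv(1) trace_Diag by (simp add: l(5))
        then show ?thesis using p YH
          unfolding Herm1_def mem_Collect_eq inv(2,3) det3_Diag sec3_Diag
          using pos_symmetric_functions[OF p] by blast
      qed
      have "(\<lambda>k. Y (inverse (real (Suc k)))) \<longlonglongrightarrow> X + 0 *\<^sub>R f (Diag (1/3 - l1) (1/3 - l2) (1/3 - l3))"
        unfolding Y by (intro tendsto_intros LIMSEQ_inverse_real_of_nat)
      moreover have "Y (inverse (real (Suc k))) \<in> ?L" for k by (rule YL) (simp_all add: field_simps)
      ultimately have "X \<in> closure ?L"
        unfolding closure_sequential scaleR_zero_left add_0_right
        by - (rule exI[of _ "\<lambda>k. Y (inverse (real (Suc k)))"], blast)
      moreover have "Herm1 m \<inter> ?L = ?L" by blast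
      ultimately show "X \<in> ?T closure_of ?L" using X unfolding closure_of_subtopology by simp
    qed
  qed
  then have "Sigma_bd m = ?C - ?L"
    unfolding Sigma_bd_def Lambda_pos_eq[OF assms] frontier_of_def interior_of_openin[OF op] by simp
  also have "\<dots> = {X \<in> Herm1 m. det3 X = 0 \<and> 0 \<le> sec3 X}"
  proof -
    have "sec3 X \<noteq> 0" if C: "X \<in> ?C" and d: "0 < det3 X" for X
    proof -
      obtain l1 l2 l3 where l: "0 \<le> l1" "l1 \<le> l2" "l2 \<le> l3"
        "det3 X = l1 * l2 * l3" "sec3 X = l1 * l2 + l2 * l3 + l3 * l1"
        using nonneg[OF C] by blast
      then have "0 < l1" using d by (cases "l1 = 0") auto
      then have "0 < l2 * l3" "0 \<le> l1 * l2" "0 \<le> l3 * l1" using l(1-3) by simp_all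
      then show ?thesis using l(5) by linarith
    qed
    then show ?thesis by (auto simp: less_le)
  qed
  finally show ?thesis .
qed

section \<open>Matrices over the associative algebras\<close>

abbreviation omat_one :: omat where "omat_one \<equiv> Diag 1 1 1"

lemma Diag_nth:
  "Diag a b c $ 1 $ 1 = oct_of_real a" "Diag a b c $ 2 $ 2 = oct_of_real b" "Diag a b c $ 3 $ 3 = oct_of_real c"
  "Diag a b c $ 1 $ 2 = 0" "Diag a b c $ 1 $ 3 = 0" "Diag a b c $ 2 $ 1 = 0"
  "Diag a b c $ 2 $ 3 = 0" "Diag a b c $ 3 $ 1 = 0" "Diag a b c $ 3 $ 2 = 0"
  by (simp_all add: Diag_eq_herm)

lemma mat_over_nth: "X \<in> mat_over m \<Longrightarrow> X$i$j \<in> div_alg m"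
  by (simp add: mat_over_def)

lemma mat_over_mono: "m \<le> k \<Longrightarrow> X \<in> mat_over m \<Longrightarrow> X \<in> mat_over k"
  unfolding mat_over_def using div_alg_mono by blast

lemma mat_over_mult: "X \<in> mat_over m \<Longrightarrow> Y \<in> mat_over m \<Longrightarrow> X \<odot>\<odot> Y \<in> mat_over m"
  by (simp add: mat_over_def mmult_nth div_alg_intros)

lemma mat_over_adjoint: "X \<in> mat_over m \<Longrightarrow> adjoint_mat X \<in> mat_over m"
  by (simp add: mat_over_def adjoint_mat_def)

lemma mat_over_Diag: "Diag a b c \<in> mat_over m"
  using Diag_in_Herm by (simp add: Herm_def)

lemma mmult_assoc:
  assumes "X \<in> mat_over 2" "Y \<in> mat_over 2" "Z \<in> mat_over 2"
  shows "(X \<odot>\<odot> Y) \<odot>\<odot> Z = X \<odot>\<odot> (Y \<odot>\<odot> Z)"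
  using assms[THEN mat_over_nth]
  by (simp add: vec_eq_iff mmult_nth omult_add_left omult_add_right omult_assoc algebra_simps)

lemma adjoint_mmult: "adjoint_mat (X \<odot>\<odot> Y) = adjoint_mat Y \<odot>\<odot> adjoint_mat X"
  by (simp add: vec_eq_iff mmult_nth adjoint_mat_def ocnj_add ocnj_omult)

lemma adjoint_adjoint [simp]: "adjoint_mat (adjoint_mat X) = X"
  by (simp add: vec_eq_iff adjoint_mat_def)

lemma adjoint_Diag [simp]: "adjoint_mat (Diag a b c) = Diag a b c"
  by (simp add: omat_eq_iff adjoint_mat_def Diag_nth)

lemma mmult_one [simp]: "X \<odot>\<odot> omat_one = X" "omat_one \<odot>\<odot> X = X"
  by (simp_all add: omat_eq_iff mmult_nth Diag_nth)

lemma Herm_iff_adjoint: "X \<in> Herm m \<longleftrightarrow> X \<in> mat_over m \<and> adjoint_mat X = X"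
  by (auto simp: Herm_def adjoint_mat_def vec_eq_iff)

lemma congruence_in_Herm:
  assumes "m \<le> 2" "A \<in> mat_over m" "S \<in> Herm m" shows "congruence A S \<in> Herm m"
proof -
  have 2: "A \<in> mat_over 2" "S \<in> mat_over 2" "adjoint_mat A \<in> mat_over 2"
    using assms by (auto simp: Herm_iff_adjoint intro: mat_over_mono mat_over_adjoint)
  show ?thesis
    using assms by (simp add: Herm_iff_adjoint congruence_def mat_over_mult mat_over_adjoint adjoint_mmult
      mmult_assoc[OF 2])
qed

lemma congruence_mmult:
  assumes "A \<in> mat_over 2" "A' \<in> mat_over 2" "S \<in> mat_over 2"
  shows "congruence (A \<odot>\<odot> A') S = congruence A (congruence A' S)"
  using assms by (simp add: congruence_def adjoint_mmult mmult_assoc mat_over_mult mat_over_adjoint)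

lemma congruence_one [simp]: "congruence omat_one S = S"
  by (simp add: congruence_def)

lemma congruence_nth: "congruence A X $ i $ j = (\<Sum>k\<in>UNIV. \<Sum>l\<in>UNIV. (A$i$l \<odot> X$l$k) \<odot> ocnj (A$j$k))"
  by (simp add: congruence_def mmult_def adjoint_mat_def omult_sum_left)

lemma linear_congruence: "linear (congruence A)"
  by (rule linearI)
    (simp_all add: vec_eq_iff congruence_nth omult_add_left omult_add_right sum.distrib scaleR_sum_right)

section \<open>Row vectors and Hermitian forms over the associative algebras\<close>

definition vec_over :: "nat \<Rightarrow> (octonion^3) set" where
  "vec_over m = {v. \<forall>i. v$i \<in> div_alg m}"

definition row_mult :: "octonion^3 \<Rightarrow> omat \<Rightarrow> octonion^3" where
  "row_mult v B = (\<chi> j. \<Sum>i\<in>UNIV. v$i \<odot> B$i$j)"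

definition herm_dot :: "octonion^3 \<Rightarrow> octonion^3 \<Rightarrow> octonion" where
  "herm_dot v w = (\<Sum>i\<in>UNIV. v$i \<odot> ocnj (w$i))"

text \<open>The value \<open>v S v\<^sup>*\<close> of the Hermitian form \<open>S\<close> on a row vector, and the rank one matrix \<open>v\<^sup>* v\<close>.\<close>

definition herm_form :: "omat \<Rightarrow> octonion^3 \<Rightarrow> real" where
  "herm_form S v = oct_Re (herm_dot (row_mult v S) v)"

definition outer :: "octonion^3 \<Rightarrow> omat" where
  "outer v = herm (inner (v$1) (v$1)) (inner (v$2) (v$2)) (inner (v$3) (v$3))
     (ocnj (v$2) \<odot> v$3) (ocnj (v$3) \<odot> v$1) (ocnj (v$1) \<odot> v$2)"

lemma row_mult_nth: "row_mult v B $ j = v$1 \<odot> B$1$j + v$2 \<odot> B$2$j + v$3 \<odot> B$3$j"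
  by (simp add: row_mult_def sum_3)

lemma vec_over_nth: "v \<in> vec_over m \<Longrightarrow> v$i \<in> div_alg m"
  by (simp add: vec_over_def)

lemma vec_over_mono: "m \<le> k \<Longrightarrow> v \<in> vec_over m \<Longrightarrow> v \<in> vec_over k"
  unfolding vec_over_def using div_alg_mono by blast

lemma row_mult_in: "v \<in> vec_over m \<Longrightarrow> B \<in> mat_over m \<Longrightarrow> row_mult v B \<in> vec_over m"
  by (simp add: vec_over_def row_mult_nth mat_over_def div_alg_intros)

lemma row_mult_mmult:
  assumes "v \<in> vec_over 2" "B \<in> mat_over 2" "C \<in> mat_over 2"
  shows "row_mult v (B \<odot>\<odot> C) = row_mult (row_mult v B) C"
  using assms(1)[THEN vec_over_nth] assms(2,3)[THEN mat_over_nth]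
  by (simp add: vec_eq_iff row_mult_nth mmult_nth omult_add_left omult_add_right omult_assoc algebra_simps)

lemma row_mult_one [simp]: "row_mult v omat_one = v"
  by (simp add: vec_eq_iff forall_3 row_mult_nth Diag_nth)

lemma linear_row_mult: "linear (\<lambda>v. row_mult v B)"
  by (rule linearI) (simp_all add: vec_eq_iff row_mult_nth omult_add_left algebra_simps)

lemma herm_dot_row_mult:
  assumes "v \<in> vec_over 2" "w \<in> vec_over 2" "B \<in> mat_over 2"
  shows "herm_dot v (row_mult w B) = herm_dot (row_mult v (adjoint_mat B)) w"
  using assms(1,2)[THEN vec_over_nth] assms(3)[THEN mat_over_nth]
  by (simp add: herm_dot_def row_mult_nth sum_3 adjoint_mat_def ocnj_add ocnj_omult omult_add_left
      omult_add_right omult_assoc algebra_simps)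

text \<open>Substituting v B and the congruence into the form puts B A and its adjoint next to S,
  where they cancel: v transforms contragrediently to S.\<close>

lemma herm_form_congruence:
  assumes "m \<le> 2" "A \<in> mat_over m" "B \<in> mat_over m" "B \<odot>\<odot> A = omat_one" "S \<in> Herm m" "v \<in> vec_over m"
  shows "herm_form (congruence A S) (row_mult v B) = herm_form S v"
proof -
  have A: "A \<in> mat_over 2" "B \<in> mat_over 2" "S \<in> mat_over 2" "v \<in> vec_over 2"
    using assms by (auto simp: Herm_iff_adjoint intro: mat_over_mono vec_over_mono)
  note cl = A mat_over_mult mat_over_adjoint row_mult_in
  have "adjoint_mat A \<odot>\<odot> adjoint_mat B = omat_one"
    using arg_cong[OF assms(4), of adjoint_mat] by (simp add: adjoint_mmult)
  moreover have "B \<odot>\<odot> (A \<odot>\<odot> (S \<odot>\<odot> adjoint_mat A)) = S \<odot>\<odot> adjoint_mat A"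
    using assms(4) by (simp add: mmult_assoc[symmetric] cl)
  ultimately show ?thesis
    by (simp add: herm_form_def herm_dot_row_mult congruence_def cl mmult_assoc flip: row_mult_mmult)
qed

lemma herm_form_herm:
  "herm_form (herm a b c x y z) v = a * inner (v$1) (v$1) + b * inner (v$2) (v$2) + c * inner (v$3) (v$3)
     + 2 * oct_Re ((v$2 \<odot> x) \<odot> ocnj (v$3)) + 2 * oct_Re ((v$3 \<odot> y) \<odot> ocnj (v$1))
     + 2 * oct_Re ((v$1 \<odot> z) \<odot> ocnj (v$2))"
proof -
  have r: "oct_Re ((p \<odot> ocnj x) \<odot> ocnj q) = oct_Re ((q \<odot> x) \<odot> ocnj p)" for p q x
  proof -
    have "oct_Re ((p \<odot> ocnj x) \<odot> ocnj q) = oct_Re (ocnj ((p \<odot> ocnj x) \<odot> ocnj q))" by simp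
    also have "\<dots> = oct_Re ((q \<odot> x) \<odot> ocnj p)" by (simp add: ocnj_omult oct_Re_assoc)
    finally show ?thesis .
  qed
  show ?thesis
    by (simp add: herm_form_def herm_dot_def row_mult_nth sum_3 omult_add_left inner_oct r algebra_simps
        flip: ocnj_scaleR)
qed

subsection \<open>The splitting \<open>H\<^sub>m\<^sub>+\<^sub>1 = H\<^sub>m \<oplus> A\<^sub>m\<^sup>3\<close>\<close>

text \<open>The coordinate v_i sits at the entry opposite to the index i, and since conjugation
  changes the sign of multiples of \<open>cd_unit m\<close>, the second summand is a skew matrix
  times that unit. This is the identification of the exterior square of a three-dimensional space
  with its dual, and it explains why v transforms by the inverse matrix.\<close>

definition emb :: "nat \<Rightarrow> omat \<Rightarrow> octonion^3 \<Rightarrow> omat" where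
  "emb m S v = S + herm 0 0 0 (v$1 \<odot> cd_unit m) (v$2 \<odot> cd_unit m) (v$3 \<odot> cd_unit m)"

definition off_part :: "nat \<Rightarrow> omat \<Rightarrow> octonion^3" where
  "off_part m X = vector [cd_snd m (X$2$3), cd_snd m (X$3$1), cd_snd m (X$1$2)]"

lemma emb_herm: "emb m (herm a b c x y z) v =
    herm a b c (x + v$1 \<odot> cd_unit m) (y + v$2 \<odot> cd_unit m) (z + v$3 \<odot> cd_unit m)"
  by (simp add: emb_def herm_ops)

lemma linear_proj_off: "linear (off_part m)"
  by (rule linearI) (simp_all add: vec_eq_iff forall_3 off_part_def linear_add[OF linear_cd_snd]
      linear_cmul[OF linear_cd_snd])

lemma emb_in_Herm:
  assumes "m \<le> 2" "S \<in> Herm m" "v \<in> vec_over m" shows "emb m S v \<in> Herm (Suc m)"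
proof -
  obtain a b c x y z where S: "S = herm a b c x y z" "x \<in> div_alg m" "y \<in> div_alg m" "z \<in> div_alg m"
    using assms(2) by (rule HermE)
  have D: "d \<in> div_alg (Suc m)" if "d \<in> div_alg m" for d using that by (rule div_alg_mono[rotated]) simp
  show ?thesis unfolding S emb_herm herm_in_Herm
    using S(2-4) assms(3)[THEN vec_over_nth] cd_unit_in[OF assms(1)] D by (simp add: div_alg_intros)
qed

lemma emb_parts:
  assumes "m \<le> 2" "S \<in> Herm m" "v \<in> vec_over m"
  shows proj_mat_emb: "proj_mat m (emb m S v) = S" and off_part_emb: "off_part m (emb m S v) = v"
proof -
  obtain a b c x y z where S: "S = herm a b c x y z" "x \<in> div_alg m" "y \<in> div_alg m" "z \<in> div_alg m"
    using assms(2) by (rule HermE)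
  note v = assms(3)[THEN vec_over_nth]
  show "proj_mat m (emb m S v) = S"
    unfolding S emb_herm proj_mat_herm using S(2-4) v assms(1) by (simp add: cd_fst_pair)
  show "off_part m (emb m S v) = v"
    unfolding S emb_herm off_part_def using S(2-4) v assms(1)
    by (simp add: cd_snd_pair vec_eq_iff forall_3)
qed

lemma off_part_in: "m \<le> 2 \<Longrightarrow> off_part m X \<in> vec_over m"
  by (simp add: vec_over_def forall_3 off_part_def)

lemma proj_mat_in: "X \<in> Herm k \<Longrightarrow> proj_mat m X \<in> Herm m"
  by (elim HermE) (simp add: proj_mat_herm)

lemma emb_proj_off:
  assumes "m \<le> 2" "X \<in> Herm (Suc m)" shows "emb m (proj_mat m X) (off_part m X) = X"
  using assms(2) by (elim HermE) (simp add: proj_mat_herm emb_herm off_part_def cd_decomp[OF assms(1)])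

lemma emb_cases:
  assumes "m \<le> 2" "X \<in> Herm (Suc m)"
  obtains S v where "X = emb m S v" "S \<in> Herm m" "v \<in> vec_over m"
  using emb_proj_off[OF assms] proj_mat_in[OF assms(2)] off_part_in[OF assms(1)] by metis

lemma emb_eq_iff:
  assumes "m \<le> 2" "S \<in> Herm m" "v \<in> vec_over m" "S' \<in> Herm m" "v' \<in> vec_over m"
  shows "emb m S v = emb m S' v' \<longleftrightarrow> S = S' \<and> v = v'"
  using assms emb_parts by metis

lemma emb_zero [simp]: "emb m S 0 = S"
  by (simp add: emb_def flip: herm_0)

lemma emb_add: "emb m S v + emb m S' v' = emb m (S + S') (v + v')"
  and emb_scaleR: "c *\<^sub>R emb m S v = emb m (c *\<^sub>R S) (c *\<^sub>R v)"
  by (simp_all add: emb_def scaleR_add_right herm_ops omult_add_left add.assoc[symmetric])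

lemma trace_emb:
  assumes "m \<le> 2" "S \<in> Herm m" shows "herm_trace (emb m S v) = herm_trace S"
  using assms(2) by (elim HermE) (simp add: emb_herm)

lemma det3_emb:
  assumes "m \<le> 2" "S \<in> Herm m" "v \<in> vec_over m"
  shows "det3 (emb m S v) = det3 S - herm_form S v"
proof -
  obtain a b c x y z where S: "S = herm a b c x y z" "x \<in> div_alg m" "y \<in> div_alg m" "z \<in> div_alg m"
    using assms(2) by (rule HermE)
  note v = assms(3)[THEN vec_over_nth] and D = S(2-4)
  \<comment> \<open>Cyclicity and conjugation invariance of the real part bring the mixed terms to
    the shape of \<open>herm_form_herm\<close>.\<close>
  have r1: "oct_Re ((ocnj q \<odot> p) \<odot> w) = oct_Re ((p \<odot> w) \<odot> ocnj q)" for p q w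
    by (metis oct_Re_assoc oct_Re_commute)
  have r2: "oct_Re (ocnj q \<odot> (p \<odot> w)) = oct_Re ((p \<odot> w) \<odot> ocnj q)" for p q w
    by (metis oct_Re_commute)
  have r3: "oct_Re (ocnj q \<odot> (p \<odot> ocnj w)) = oct_Re ((q \<odot> w) \<odot> ocnj p)" for p q w
  proof -
    have "oct_Re (ocnj q \<odot> (p \<odot> ocnj w)) = oct_Re (ocnj (ocnj q \<odot> (p \<odot> ocnj w)))" by simp
    also have "\<dots> = oct_Re ((w \<odot> ocnj p) \<odot> q)" by (simp add: ocnj_omult)
    also have "\<dots> = oct_Re ((q \<odot> w) \<odot> ocnj p)" by (metis oct_Re_assoc oct_Re_commute)
    finally show ?thesis .
  qed
  have "oct_Re (((x + v$1 \<odot> cd_unit m) \<odot> (y + v$2 \<odot> cd_unit m)) \<odot> (z + v$3 \<odot> cd_unit m)) =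
     oct_Re ((x \<odot> y) \<odot> z) - oct_Re ((ocnj (v$2) \<odot> v$1) \<odot> z)
       - oct_Re (ocnj (v$3) \<odot> (v$2 \<odot> x)) - oct_Re (ocnj (v$3) \<odot> (v$1 \<odot> ocnj y))"
  proof -
    have "(x + v$1 \<odot> cd_unit m) \<odot> (y + v$2 \<odot> cd_unit m) =
        (x \<odot> y - ocnj (v$2) \<odot> v$1) + (v$2 \<odot> x + v$1 \<odot> ocnj y) \<odot> cd_unit m"
      using v D assms(1) by (intro cd_mult)
    also have "\<dots> \<odot> (z + v$3 \<odot> cd_unit m) =
        ((x \<odot> y - ocnj (v$2) \<odot> v$1) \<odot> z - ocnj (v$3) \<odot> (v$2 \<odot> x + v$1 \<odot> ocnj y))
        + (v$3 \<odot> (x \<odot> y - ocnj (v$2) \<odot> v$1) + (v$2 \<odot> x + v$1 \<odot> ocnj y) \<odot> ocnj z) \<odot> cd_unit m"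
      using v D assms(1) by (intro cd_mult) (simp_all add: div_alg_intros)
    finally have eq: "((x + v$1 \<odot> cd_unit m) \<odot> (y + v$2 \<odot> cd_unit m)) \<odot> (z + v$3 \<odot> cd_unit m) = \<dots>" .
    \<comment> \<open>The component along \<open>cd_unit m\<close> has no real part, so only the
      first component of the product counts.\<close>
    have "v$3 \<odot> (x \<odot> y - ocnj (v$2) \<odot> v$1) + (v$2 \<odot> x + v$1 \<odot> ocnj y) \<odot> ocnj z \<in> div_alg m"
      using v D by (simp add: div_alg_intros)
    from oct_Re_cd[OF assms(1) this] show ?thesis
      unfolding eq by (simp add: omult_add_right omult_diff_left)
  qed
  then show ?thesis
    unfolding S emb_herm det3_herm herm_form_herm r1 r2[of "v$3" "v$2" x] r3[of "v$3" "v$1" y]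
      inner_cd[OF assms(1) D(1) v[of 1] D(1) v[of 1]] inner_cd[OF assms(1) D(2) v[of 2] D(2) v[of 2]]
      inner_cd[OF assms(1) D(3) v[of 3] D(3) v[of 3]]
    by (simp add: algebra_simps)
qed

lemma outer_in: "v \<in> vec_over m \<Longrightarrow> outer v \<in> Herm m"
  using vec_over_nth[of v m] by (simp add: outer_def div_alg_intros)

lemma adj3_emb:
  assumes "m \<le> 2" "S \<in> Herm m" "v \<in> vec_over m"
  shows "adj3 (emb m S v) = emb m (adj3 S - outer v) (- row_mult v S)"
proof -
  obtain a b c x y z where S: "S = herm a b c x y z" "x \<in> div_alg m" "y \<in> div_alg m" "z \<in> div_alg m"
    using assms(2) by (rule HermE)
  note v = assms(3)[THEN vec_over_nth] and D = S(2-4)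
  have e: "ocnj ((p + q \<odot> cd_unit m) \<odot> (p' + q' \<odot> cd_unit m)) - t *\<^sub>R (r + s \<odot> cd_unit m) =
     ocnj (p \<odot> p') - t *\<^sub>R r - ocnj q \<odot> q' + (- (t *\<^sub>R s + q \<odot> ocnj p' + q' \<odot> p)) \<odot> cd_unit m"
    if "p \<in> div_alg m" "p' \<in> div_alg m" "q \<in> div_alg m" "q' \<in> div_alg m" for p p' q q' r s t
  proof -
    have "ocnj ((p + q \<odot> cd_unit m) \<odot> (p' + q' \<odot> cd_unit m)) =
        ocnj ((p \<odot> p' - ocnj q' \<odot> q) + (q' \<odot> p + q \<odot> ocnj p') \<odot> cd_unit m)"
      using that assms(1) by (simp only: cd_mult)
    also have "\<dots> = ocnj (p \<odot> p' - ocnj q' \<odot> q) + (- (q' \<odot> p + q \<odot> ocnj p')) \<odot> cd_unit m"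
      using that assms(1) by (intro cd_cnj) (simp_all add: div_alg_intros)
    finally show ?thesis
      by (simp add: ocnj_diff ocnj_omult omult_add_left omult_minus_left omult_diff_left algebra_simps)
  qed
  show ?thesis
    unfolding S emb_herm adj3_herm outer_def herm_ops
      e[OF D(2) D(3) v[of 2] v[of 3]] e[OF D(3) D(1) v[of 3] v[of 1]] e[OF D(1) D(2) v[of 1] v[of 2]]
      inner_cd[OF assms(1) D(1) v[of 1] D(1) v[of 1]] inner_cd[OF assms(1) D(2) v[of 2] D(2) v[of 2]]
      inner_cd[OF assms(1) D(3) v[of 3] D(3) v[of 3]]
    by (simp add: row_mult_nth add.commute add.left_commute)
qed

lemma Plane_emb_iff:
  assumes "m \<le> 2" "S \<in> Herm m" "v \<in> vec_over m"
  shows "emb m S v \<in> Plane (Suc m) \<longleftrightarrow> herm_trace S = 1 \<and> adj3 S = outer v \<and> row_mult v S = 0"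
proof -
  have "adj3 (emb m S v) = 0 \<longleftrightarrow> emb m (adj3 S - outer v) (- row_mult v S) = emb m 0 0"
    using adj3_emb[OF assms] by simp
  also have "\<dots> \<longleftrightarrow> adj3 S - outer v = 0 \<and> - row_mult v S = 0"
  proof (rule emb_eq_iff)
    have "S \<in> mat_over m" using assms(2) by (simp add: Herm_def)
    then show "- row_mult v S \<in> vec_over m"
      using row_mult_in[OF assms(3)] by (simp add: vec_over_def div_alg_minus)
  qed (use assms in \<open>simp_all add: Herm_intros adj3_in_Herm outer_in vec_over_def\<close>)
  finally show ?thesis
    using assms(1) emb_in_Herm[OF assms]
    by (simp add: Plane_eq Herm1_def trace_emb[OF assms(1,2)])
qed

section \<open>The special linear groups\<close>

text \<open>Real and complex matrices are both handled as complex ones, reality for m = 0 being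
  expressed by \<open>mat_over 0\<close>; the ordinary complex determinant then serves both
  cases.\<close>

definition cmat :: "complex^3^3 \<Rightarrow> omat" where
  "cmat M = (\<chi> i j. oct_of_complex (M$i$j))"

definition adjugate :: "complex^3^3 \<Rightarrow> complex^3^3" where
  "adjugate M = vector [
     vector [M$2$2 * M$3$3 - M$2$3 * M$3$2, M$1$3 * M$3$2 - M$1$2 * M$3$3, M$1$2 * M$2$3 - M$1$3 * M$2$2],
     vector [M$2$3 * M$3$1 - M$2$1 * M$3$3, M$1$1 * M$3$3 - M$1$3 * M$3$1, M$1$3 * M$2$1 - M$1$1 * M$2$3],
     vector [M$2$1 * M$3$2 - M$2$2 * M$3$1, M$1$2 * M$3$1 - M$1$1 * M$3$2, M$1$1 * M$2$2 - M$1$2 * M$2$1]]"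

lemma adjugate_mult:
  assumes "det M = 1" shows "M ** adjugate M = mat 1" "adjugate M ** M = mat 1"
  using assms by (simp_all add: omat_eq_iff matrix_matrix_mult_def sum_3 adjugate_def mat_def det_3 algebra_simps)

lemma oct_of_complex_ops:
  "oct_of_complex a \<odot> oct_of_complex b = oct_of_complex (a * b)"
  "oct_of_complex a + oct_of_complex b = oct_of_complex (a + b)"
  "oct_of_complex a - oct_of_complex b = oct_of_complex (a - b)"
  "- oct_of_complex a = oct_of_complex (- a)"
  "ocnj (oct_of_complex a) = oct_of_complex (cnj a)"
  "oct_of_complex 0 = 0" "oct_of_complex 1 = oct_one"
  by (simp_all add: oct_unfold)

lemma oct_of_complex_of_real: "oct_of_complex (complex_of_real t) = oct_of_real t"
  by (simp add: oct_of_real_def)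

lemma oct_of_complex_inj [simp]: "oct_of_complex a = oct_of_complex b \<longleftrightarrow> a = b"
  by (simp add: oct_unfold)

lemma cmat_mult: "cmat M \<odot>\<odot> cmat N = cmat (M ** N)"
  by (simp add: vec_eq_iff cmat_def mmult_nth matrix_matrix_mult_def sum_3 oct_of_complex_ops)

lemma cmat_one: "cmat (mat 1) = omat_one"
  by (simp add: omat_eq_iff cmat_def mat_def Diag_nth oct_of_complex_ops)

lemma cmat_inj [simp]: "cmat M = cmat N \<longleftrightarrow> M = N"
  by (simp add: cmat_def vec_eq_iff)

lemma oct_of_complex_in_div_alg: "oct_of_complex z \<in> div_alg m \<longleftrightarrow> m \<noteq> 0 \<or> Im z = 0"
  by (auto simp: div_alg_iff oct_of_complex_def oct_of_quat_def)

lemma div_alg_1E: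
  assumes "x \<in> div_alg m" "m \<le> 1" obtains z where "x = oct_of_complex z"
proof -
  have "x \<in> div_alg 1" using assms div_alg_mono by blast
  then show ?thesis using that by (auto simp: div_alg_def)
qed

lemma cmat_over: "cmat M \<in> mat_over m \<longleftrightarrow> m \<noteq> 0 \<or> (\<forall>i j. Im (M$i$j) = 0)"
  by (auto simp: mat_over_def cmat_def oct_of_complex_in_div_alg)

lemma SL3_commutative:
  assumes "m \<le> 1" shows "SL3 m = {cmat M | M. det M = 1 \<and> cmat M \<in> mat_over m}"
proof (cases "m = 0")
  case True
  have det_of_real: "det (\<chi> i j. complex_of_real (A$i$j)) = complex_of_real (det A)" for A :: "real^3^3"
    by (simp add: det_3)
  have 1: "\<exists>M. (\<chi> i j. oct_of_real (A$i$j)) = cmat M \<and> det M = 1 \<and> cmat M \<in> mat_over 0"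
    if "det A = 1" for A :: "real^3^3"
  proof (intro exI conjI)
    let ?M = "\<chi> i j. complex_of_real (A$i$j)"
    show "(\<chi> i j. oct_of_real (A$i$j)) = cmat ?M" by (simp add: cmat_def oct_of_real_def)
    show "det ?M = 1" using det_of_real that by simp
  qed (simp add: cmat_over)
  have 2: "\<exists>A. cmat M = (\<chi> i j. oct_of_real (A$i$j)) \<and> det A = 1"
    if "det M = 1" "cmat M \<in> mat_over 0" for M
  proof (intro exI conjI)
    let ?A = "\<chi> i j. Re (M$i$j)"
    have M: "complex_of_real (Re (M$i$j)) = M$i$j" for i j
      using that(2) by (simp add: cmat_over complex_eq_iff)
    show "cmat M = (\<chi> i j. oct_of_real (?A$i$j))"
      by (simp add: cmat_def oct_of_real_def M)
    have "complex_of_real (det ?A) = det M" using det_of_real[of ?A] by (simp add: M)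
    then show "det ?A = 1" using that(1) by (metis of_real_eq_1_iff)
  qed
  have "SL3 0 = {(\<chi> i j. oct_of_real (A$i$j)) | A :: real^3^3. det A = 1}" by (simp add: SL3_def)
  note SL30 = this
  show ?thesis unfolding True
  proof (intro equalityI subsetI)
    fix X assume "X \<in> SL3 0"
    then obtain A where "X = (\<chi> i j. oct_of_real (A$i$j))" "det A = 1" unfolding SL30 by blast
    then show "X \<in> {cmat M | M. det M = 1 \<and> cmat M \<in> mat_over 0}" using 1[of A] by blast
  next
    fix X assume "X \<in> {cmat M | M. det M = 1 \<and> cmat M \<in> mat_over 0}"
    then obtain M where "X = cmat M" "det M = 1" "cmat M \<in> mat_over 0" by blast
    then show "X \<in> SL3 0" unfolding SL30 using 2[of M] by simp
  qed
next
  case False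
  then have m: "m = 1" using assms by simp
  have "SL3 1 = {cmat M | M. det M = 1}" by (simp add: SL3_def cmat_def)
  then show ?thesis by (simp add: m cmat_over)
qed

lemma SL3_quaternionic:
  "SL3 2 = {A \<in> mat_over 2. (\<exists>B\<in>mat_over 2. A \<odot>\<odot> B = omat_one \<and> B \<odot>\<odot> A = omat_one) \<and>
     (\<forall>S\<in>Herm 2. det3 (congruence A S) = det3 S)}"
proof -
  have "(\<forall>S\<in>Herm 2. herm_det 2 (congruence A S) = herm_det 2 S) \<longleftrightarrow> (\<forall>S\<in>Herm 2. det3 (congruence A S) = det3 S)"
    if "A \<in> mat_over 2" for A
    using that by (simp add: herm_det_eq_det3 congruence_in_Herm)
  moreover have "SL3 2 = {A \<in> GL3H. \<forall>X\<in>Herm 2. herm_det 2 (congruence A X) = herm_det 2 X}"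
    by (simp add: SL3_def)
  ultimately show ?thesis unfolding GL3H_def by blast
qed

text \<open>The inverse is carried along as data: it enters the action, and with pairs connectedness
  can be shown without a formula for inverting a quaternionic matrix.\<close>

definition sl_pairs :: "nat \<Rightarrow> (omat \<times> omat) set" where
  "sl_pairs m = {(A, B). A \<in> SL3 m \<and> A \<in> mat_over m \<and> B \<in> mat_over m \<and>
     A \<odot>\<odot> B = omat_one \<and> B \<odot>\<odot> A = omat_one}"

lemma sl_pairsD:
  assumes "(A, B) \<in> sl_pairs m"
  shows "A \<in> SL3 m" "A \<in> mat_over m" "B \<in> mat_over m" "A \<odot>\<odot> B = omat_one" "B \<odot>\<odot> A = omat_one"
  using assms by (auto simp: sl_pairs_def)

text \<open>Inverses are unique, and for a complex matrix of determinant 1 the adjugate is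
  one.\<close>

lemma sl_pairs_commutative:
  assumes "m \<le> 1"
  shows "(A, B) \<in> sl_pairs m \<longleftrightarrow>
    (\<exists>M. A = cmat M \<and> B = cmat (adjugate M) \<and> det M = 1 \<and> cmat M \<in> mat_over m)"
proof
  assume AB: "(A, B) \<in> sl_pairs m"
  then obtain M where M: "A = cmat M" "det M = 1" "cmat M \<in> mat_over m"
    using sl_pairsD(1) SL3_commutative[OF assms] by blast
  have 2: "A \<in> mat_over 2" "B \<in> mat_over 2" "cmat (adjugate M) \<in> mat_over 2"
    using sl_pairsD(2,3)[OF AB] assms by (auto simp: cmat_over intro: mat_over_mono[of m 2])
  have "B = B \<odot>\<odot> (A \<odot>\<odot> cmat (adjugate M))"
    by (simp add: M cmat_mult adjugate_mult cmat_one)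
  also have "\<dots> = cmat (adjugate M)"
    using sl_pairsD(5)[OF AB] by (simp add: mmult_assoc[symmetric] 2)
  finally show "\<exists>M. A = cmat M \<and> B = cmat (adjugate M) \<and> det M = 1 \<and> cmat M \<in> mat_over m"
    using M by blast
next
  assume "\<exists>M. A = cmat M \<and> B = cmat (adjugate M) \<and> det M = 1 \<and> cmat M \<in> mat_over m"
  then obtain M where M: "A = cmat M" "B = cmat (adjugate M)" "det M = 1" "cmat M \<in> mat_over m" by blast
  moreover have "cmat (adjugate M) \<in> mat_over m"
    using M(4) by (auto simp: cmat_over adjugate_def forall_3)
  ultimately show "(A, B) \<in> sl_pairs m"
    unfolding sl_pairs_def using SL3_commutative[OF assms]
    by (auto simp: cmat_mult adjugate_mult cmat_one)
qed

lemma SL3_pair: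
  assumes "m \<le> 2" "A \<in> SL3 m" obtains B where "(A, B) \<in> sl_pairs m"
proof (cases "m \<le> 1")
  case True
  then show ?thesis
    using assms(2) that sl_pairs_commutative[OF True] unfolding SL3_commutative[OF True] by blast
next
  case False
  then have m: "m = 2" using assms(1) by simp
  obtain B where "A \<in> mat_over 2" "B \<in> mat_over 2" "A \<odot>\<odot> B = omat_one" "B \<odot>\<odot> A = omat_one"
    using assms(2) unfolding m SL3_quaternionic by blast
  then show ?thesis using assms(2) by (intro that[of B]) (simp add: sl_pairs_def m)
qed

lemma det3_cmat:
  assumes "cmat N \<in> Herm 1" shows "complex_of_real (det3 (cmat N)) = det N"
proof -
  have h: "N$j$i = cnj (N$i$j)" for i j
    using assms by (simp add: Herm_def cmat_def oct_of_complex_ops)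
  have r: "N$i$i = complex_of_real (Re (N$i$i))" for i
    using h[of i i] by (simp add: complex_eq_iff)
  have "N$1$1 = complex_of_real (Re (N$1$1))" "N$2$2 = complex_of_real (Re (N$2$2))"
    "N$3$3 = complex_of_real (Re (N$3$3))" by (rule r)+
  moreover have "N$2$1 = cnj (N$1$2)" "N$3$2 = cnj (N$2$3)" "N$1$3 = cnj (N$3$1)" by (rule h)+
  ultimately show ?thesis
    unfolding det_3 det3_def cmat_def inner_oct
    by (simp add: oct_of_complex_ops complex_eq_iff) (simp add: oct_unfold algebra_simps)
qed

text \<open>For m \<le> 1 by multiplicativity of the determinant, the adjoint having determinant 1
  as well; for m = 2 by the definition of SL(3, H).\<close>

lemma sl_pairs_det3:
  assumes "m \<le> 2" "(A, B) \<in> sl_pairs m" "S \<in> Herm m"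
  shows "det3 (congruence A S) = det3 S"
proof (cases "m \<le> 1")
  case True
  obtain M where M: "A = cmat M" "det M = 1" using sl_pairs_commutative[OF True] assms(2) by blast
  have S1: "S \<in> Herm 1" using assms(3) True Herm_mono by blast
  define N where "N = (\<chi> i j. fst (fst (S$i$j)))"
  have "S$i$j \<in> div_alg 1" for i j using S1 by (simp add: Herm_def mat_over_def)
  then have "S$i$j = oct_of_complex (N$i$j)" for i j
    by (simp add: N_def div_alg_iff oct_of_complex_def oct_of_quat_def prod_eq_iff)
  then have SN: "S = cmat N" by (simp add: cmat_def vec_eq_iff)
  define M' where "M' = (\<chi> i j. cnj (M$j$i))"
  have adj: "adjoint_mat A = cmat M'"
    by (simp add: M'_def M adjoint_mat_def cmat_def oct_of_complex_ops)
  have "det M' = cnj (det M)" by (simp add: M'_def det_3)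
  then have dM': "det M' = 1" using M(2) by simp
  have AS: "congruence A S = cmat (M ** N ** M')"
    unfolding congruence_def SN M(1) adj[unfolded M(1)] cmat_mult ..
  have "A \<in> mat_over 1" using sl_pairsD(2)[OF assms(2)] True mat_over_mono by blast
  then have "congruence A S \<in> Herm 1" using S1 by (intro congruence_in_Herm) simp_all
  then have "complex_of_real (det3 (congruence A S)) = det (M ** N ** M')"
    unfolding AS by (rule det3_cmat)
  also have "\<dots> = complex_of_real (det3 S)"
    using det3_cmat[of N] S1 SN by (simp add: det_mul M dM')
  finally show ?thesis by (simp only: of_real_eq_iff)
next
  case False
  then have m: "m = 2" using assms(1) by simp
  show ?thesis using sl_pairsD(1)[OF assms(2)] assms(3) unfolding m SL3_quaternionic by blast
qed

lemma sl_pairs_mono2: "m \<le> 2 \<Longrightarrow> (A, B) \<in> sl_pairs m \<Longrightarrow> A \<in> mat_over 2 \<and> B \<in> mat_over 2"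
  using mat_over_mono sl_pairsD by blast

lemma sl_pairs_swap:
  assumes "m \<le> 2" "(A, B) \<in> sl_pairs m" shows "(B, A) \<in> sl_pairs m"
proof (cases "m \<le> 1")
  case True
  then obtain M where M: "A = cmat M" "B = cmat (adjugate M)" "det M = 1" "cmat M \<in> mat_over m"
    using sl_pairs_commutative assms(2) by blast
  have "det (M ** adjugate M) = 1" using adjugate_mult[OF M(3)] by simp
  then have d: "det (adjugate M) = 1" using M(3) by (simp add: det_mul)
  then have "B \<in> SL3 m" using SL3_commutative[OF True] M(2) sl_pairsD(3)[OF assms(2)] by blast
  then show ?thesis using sl_pairsD[OF assms(2)] by (simp add: sl_pairs_def)
next
  case False
  then have m: "m = 2" using assms(1) by simp
  note AB = assms(2)[unfolded m]
  have "det3 (congruence B S) = det3 S" if S: "S \<in> Herm 2" for S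
  proof -
    have BS: "congruence B S \<in> Herm 2" using sl_pairsD(3)[OF AB] S by (intro congruence_in_Herm) simp_all
    have "congruence A (congruence B S) = S"
      using congruence_mmult[of A B S] sl_pairsD[OF AB] S by (simp add: Herm_def)
    then show ?thesis using sl_pairs_det3[OF order_refl AB BS] by simp
  qed
  then show ?thesis
    unfolding m using sl_pairsD[OF AB] by (auto simp: sl_pairs_def SL3_quaternionic)
qed

lemma sl_pairs_one: "m \<le> 2 \<Longrightarrow> (omat_one, omat_one) \<in> sl_pairs m"
proof (cases "m \<le> 1")
  case True
  have "omat_one = cmat (mat 1)" "det (mat 1 :: complex^3^3) = 1" by (simp_all add: cmat_one)
  then have "omat_one \<in> SL3 m"
    unfolding SL3_commutative[OF True] mem_Collect_eq using mat_over_Diag by metis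
  then show ?thesis by (simp add: sl_pairs_def mat_over_Diag)
next
  case False
  moreover assume "m \<le> 2"
  ultimately have "m = 2" by simp
  then show ?thesis by (auto simp: sl_pairs_def SL3_quaternionic mat_over_Diag)
qed

lemma sl_pairs_mult:
  assumes "m \<le> 2" "(A, B) \<in> sl_pairs m" "(A', B') \<in> sl_pairs m"
  shows "(A \<odot>\<odot> A', B' \<odot>\<odot> B) \<in> sl_pairs m"
proof -
  have 2: "A \<in> mat_over 2" "B \<in> mat_over 2" "A' \<in> mat_over 2" "B' \<in> mat_over 2"
    using sl_pairs_mono2 assms by blast+
  have "(A \<odot>\<odot> A') \<odot>\<odot> (B' \<odot>\<odot> B) = A \<odot>\<odot> ((A' \<odot>\<odot> B') \<odot>\<odot> B)"
    "(B' \<odot>\<odot> B) \<odot>\<odot> (A \<odot>\<odot> A') = B' \<odot>\<odot> ((B \<odot>\<odot> A) \<odot>\<odot> A')"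
    using 2 by (simp_all add: mmult_assoc mat_over_mult)
  then have inv: "(A \<odot>\<odot> A') \<odot>\<odot> (B' \<odot>\<odot> B) = omat_one" "(B' \<odot>\<odot> B) \<odot>\<odot> (A \<odot>\<odot> A') = omat_one"
    using sl_pairsD[OF assms(2)] sl_pairsD[OF assms(3)] by simp_all
  have over: "A \<odot>\<odot> A' \<in> mat_over m" "B' \<odot>\<odot> B \<in> mat_over m"
    using sl_pairsD[OF assms(2)] sl_pairsD[OF assms(3)] by (simp_all add: mat_over_mult)
  have "A \<odot>\<odot> A' \<in> SL3 m"
  proof (cases "m \<le> 1")
    case True
    obtain M M' where "A = cmat M" "det M = 1" "A' = cmat M'" "det M' = 1"
      using sl_pairs_commutative[OF True] assms(2,3) by blast
    then have "A \<odot>\<odot> A' = cmat (M ** M')" "det (M ** M') = 1" by (simp_all add: cmat_mult det_mul)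
    then show ?thesis unfolding SL3_commutative[OF True] using over by force
  next
    case False
    then have m: "m = 2" using assms(1) by simp
    have "det3 (congruence (A \<odot>\<odot> A') S) = det3 S" if "S \<in> Herm 2" for S
    proof -
      have S: "S \<in> mat_over 2" using that by (simp add: Herm_def)
      have "congruence A' S \<in> Herm 2" using 2 that by (intro congruence_in_Herm) simp_all
      then show ?thesis
        unfolding congruence_mmult[OF 2(1,3) S]
        using sl_pairs_det3[OF assms(1,2), of "congruence A' S"] sl_pairs_det3[OF assms(1,3), of S] that
        by (simp add: m)
    qed
    then show ?thesis using inv over unfolding m SL3_quaternionic by blast
  qed
  then show ?thesis using inv over by (simp add: sl_pairs_def)
qed

text \<open>For \<open>A \<in> SL(3, A\<^sub>m)\<close> with inverse \<open>B\<close>, the action on \<open>H\<^sub>m\<^sub>+\<^sub>1 = H\<^sub>m \<oplus> A\<^sub>m\<^sup>3\<close> is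
  \<open>(S, v) \<mapsto> (A S A\<^sup>*, v B)\<close>.\<close>

definition act :: "nat \<Rightarrow> omat \<Rightarrow> omat \<Rightarrow> omat \<Rightarrow> omat" where
  "act m A B X = emb m (congruence A (proj_mat m X)) (row_mult (off_part m X) B)"

lemma act_emb:
  assumes "m \<le> 2" "S \<in> Herm m" "v \<in> vec_over m"
  shows "act m A B (emb m S v) = emb m (congruence A S) (row_mult v B)"
  by (simp add: act_def emb_parts[OF assms])

lemma linear_act: "linear (act m A B)"
proof (rule linearI)
  fix X Y :: omat and c :: real
  show "act m A B (X + Y) = act m A B X + act m A B Y"
    unfolding act_def linear_add[OF linear_proj_mat] linear_add[OF linear_proj_off]
      linear_add[OF linear_congruence] linear_add[OF linear_row_mult] emb_add ..
  show "act m A B (c *\<^sub>R X) = c *\<^sub>R act m A B X"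
    unfolding act_def linear_cmul[OF linear_proj_mat] linear_cmul[OF linear_proj_off]
      linear_cmul[OF linear_congruence] linear_cmul[OF linear_row_mult] emb_scaleR ..
qed

lemma act_closed:
  assumes "m \<le> 2" "(A, B) \<in> sl_pairs m"
  shows "S \<in> Herm m \<Longrightarrow> congruence A S \<in> Herm m" "v \<in> vec_over m \<Longrightarrow> row_mult v B \<in> vec_over m"
    "X \<in> Herm (Suc m) \<Longrightarrow> act m A B X \<in> Herm (Suc m)"
proof -
  show 1: "S \<in> Herm m \<Longrightarrow> congruence A S \<in> Herm m" for S
    using congruence_in_Herm[OF assms(1)] sl_pairsD[OF assms(2)] by blast
  show 2: "v \<in> vec_over m \<Longrightarrow> row_mult v B \<in> vec_over m" for v
    using row_mult_in sl_pairsD[OF assms(2)] by blast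
  show "X \<in> Herm (Suc m) \<Longrightarrow> act m A B X \<in> Herm (Suc m)"
    by (elim emb_cases[OF assms(1)]) (simp add: act_emb[OF assms(1)] emb_in_Herm[OF assms(1)] 1 2)
qed

lemma act_act:
  assumes "m \<le> 2" "(A, B) \<in> sl_pairs m" "(A', B') \<in> sl_pairs m" "X \<in> Herm (Suc m)"
  shows "act m A B (act m A' B' X) = act m (A \<odot>\<odot> A') (B' \<odot>\<odot> B) X"
proof -
  obtain S v where X: "X = emb m S v" "S \<in> Herm m" "v \<in> vec_over m" using assms(1,4) by (rule emb_cases)
  have 2: "A \<in> mat_over 2" "B \<in> mat_over 2" "A' \<in> mat_over 2" "B' \<in> mat_over 2"
    using sl_pairs_mono2 assms by blast+
  have "S \<in> mat_over 2" "v \<in> vec_over 2"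
    using X assms(1) by (auto simp: Herm_def intro: mat_over_mono vec_over_mono)
  then show ?thesis
    using X(2,3) 2 by (simp add: X(1) act_emb[OF assms(1)] act_closed[OF assms(1,3)] congruence_mmult row_mult_mmult)
qed

lemma act_one: "m \<le> 2 \<Longrightarrow> X \<in> Herm (Suc m) \<Longrightarrow> act m omat_one omat_one X = X"
  by (simp add: act_def emb_proj_off)

lemma act_inverse:
  assumes "m \<le> 2" "(A, B) \<in> sl_pairs m" "X \<in> Herm (Suc m)"
  shows "act m B A (act m A B X) = X" "act m A B (act m B A X) = X"
  using act_act[OF assms(1) sl_pairs_swap[OF assms(1,2)] assms(2,3)]
    act_act[OF assms(1,2) sl_pairs_swap[OF assms(1,2)] assms(3)] sl_pairsD[OF assms(2)] assms(1,3)
  by (simp_all add: act_one)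

text \<open>In \<open>det S - v S v\<^sup>*\<close> both terms are invariant.\<close>

lemma act_det3:
  assumes "m \<le> 2" "(A, B) \<in> sl_pairs m" "X \<in> Herm (Suc m)"
  shows "det3 (act m A B X) = det3 X"
proof -
  obtain S v where X: "X = emb m S v" "S \<in> Herm m" "v \<in> vec_over m" using assms(1,3) by (rule emb_cases)
  note c = act_closed[OF assms(1,2)] and d = sl_pairsD[OF assms(2)]
  show ?thesis
    unfolding X(1) act_emb[OF assms(1) X(2,3)] det3_emb[OF assms(1) X(2,3)]
      det3_emb[OF assms(1) c(1)[OF X(2)] c(2)[OF X(3)]]
      herm_form_congruence[OF assms(1) d(2,3,5) X(2,3)] sl_pairs_det3[OF assms(1,2) X(2)] ..
qed

lemma act_in_GL_on:
  assumes "m \<le> 2" "(A, B) \<in> sl_pairs m"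
  shows "restrict (act m A B) (Herm (Suc m)) \<in> GL_on (Herm (Suc m))"
  by (rule restrict_in_GL_on[where g = "act m B A"])
    (simp_all add: linear_act subspace_Herm act_closed[OF assms] act_inverse[OF assms]
      act_closed[OF assms(1) sl_pairs_swap[OF assms]])

text \<open>For commutative A_m conjugation can be moved across the unit,
  \<open>cd_unit m \<odot> ocnj c = c \<odot> cd_unit m\<close>. The congruence therefore acts on
  the skew summand V as \<open>A V A\<^sup>T\<close>.\<close>

lemma cd_unit_congruence:
  assumes "m \<le> 1" "a \<in> div_alg m" "b \<in> div_alg m" "c \<in> div_alg m"
  shows "(a \<odot> (b \<odot> cd_unit m)) \<odot> ocnj c = ((b \<odot> a) \<odot> c) \<odot> cd_unit m"
proof -
  consider "m = 0" | "m = 1" using assms(1) by linarith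
  then show ?thesis
    using assms(2-) by cases (auto simp: div_alg_def cd_unit_def oct_unfold prod_eq_iff complex_eq_iff)
qed

text \<open>On skew 3 by 3 matrices V the map \<open>A V A\<^sup>T\<close> multiplies the
  corresponding row v by the adjugate of A, and the adjugate is the inverse because det A =
  1.\<close>

lemma congruence_eq_act:
  assumes "m \<le> 1" "(A, B) \<in> sl_pairs m" "X \<in> Herm (Suc m)"
  shows "congruence A X = act m A B X"
proof -
  have m2: "m \<le> 2" using assms(1) by simp
  obtain S v where X: "X = emb m S v" "S \<in> Herm m" "v \<in> vec_over m" using m2 assms(3) by (rule emb_cases)
  obtain M where M: "A = cmat M" "B = cmat (adjugate M)" "det M = 1"
    using sl_pairs_commutative[OF assms(1)] assms(2) by blast
  have aD: "oct_of_complex (M$i$j) \<in> div_alg m" for i j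
    using sl_pairsD(2)[OF assms(2)] by (simp add: M cmat_def mat_over_def)
  note vD = X(3)[THEN vec_over_nth]
  obtain z1 z2 z3 where z: "v$1 = oct_of_complex z1" "v$2 = oct_of_complex z2" "v$3 = oct_of_complex z3"
    using div_alg_1E[OF vD assms(1)] by metis
  have zD: "oct_of_complex z1 \<in> div_alg m" "oct_of_complex z2 \<in> div_alg m" "oct_of_complex z3 \<in> div_alg m"
    using vD[of 1] vD[of 2] vD[of 3] by (simp_all add: z)
  have neg: "ocnj (p \<odot> cd_unit m) = (- p) \<odot> cd_unit m" if "p \<in> div_alg m" for p
    using cd_cnj[OF m2 div_alg_0 that] by simp
  have t: "(oct_of_complex (M$i$j) \<odot> (p \<odot> cd_unit m)) \<odot> ocnj (oct_of_complex (M$k$l)) =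
      ((p \<odot> oct_of_complex (M$i$j)) \<odot> oct_of_complex (M$k$l)) \<odot> cd_unit m" if "p \<in> div_alg m" for p i j k l
    using cd_unit_congruence[OF assms(1) aD that aD] .
  have t: "(oct_of_complex (M$i$j) \<odot> (oct_of_complex z \<odot> cd_unit m)) \<odot> oct_of_complex (cnj (M$k$l)) =
      oct_of_complex (z * M$i$j * M$k$l) \<odot> cd_unit m" if "oct_of_complex z \<in> div_alg m" for z i j k l
    using t[OF that, of i j k l] by (simp add: oct_of_complex_ops)
  have mD: "oct_of_complex (- z) \<in> div_alg m" if "oct_of_complex z \<in> div_alg m" for z
    using div_alg_minus[OF that] by (simp add: oct_of_complex_ops)
  have plus: "oct_of_complex p \<odot> cd_unit m + oct_of_complex q \<odot> cd_unit m = oct_of_complex (p + q) \<odot> cd_unit m" for p q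
    by (simp add: omult_add_left[symmetric] oct_of_complex_ops)
  let ?V = "herm 0 0 0 (v$1 \<odot> cd_unit m) (v$2 \<odot> cd_unit m) (v$3 \<odot> cd_unit m)"
  let ?w = "row_mult v B"
  have wD: "?w$i \<in> div_alg m" for i
    using act_closed(2)[OF m2 assms(2) X(3)] by (rule vec_over_nth)
  have e1: "congruence A ?V = herm 0 0 0 (?w$1 \<odot> cd_unit m) (?w$2 \<odot> cd_unit m) (?w$3 \<odot> cd_unit m)"
    unfolding omat_eq_iff herm_nth neg[OF wD]
    unfolding congruence_nth sum_3 herm_nth z neg[OF zD(1)] neg[OF zD(2)] neg[OF zD(3)] M cmat_def vec_lambda_beta
    by (simp add: t zD mD plus oct_of_complex_ops row_mult_nth z adjugate_def omult_add_left algebra_simps)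
  show ?thesis
    unfolding X(1) act_emb[OF m2 X(2,3)] unfolding emb_def linear_add[OF linear_congruence] e1 ..
qed

lemma G_sub_eq_act_commutative:
  assumes "m \<le> 1"
  shows "G_sub (Suc m) = {restrict (act m A B) (Herm (Suc m)) | A B. (A, B) \<in> sl_pairs m}"
proof -
  have m2: "m \<le> 2" using assms by simp
  have r: "restrict (congruence A) (Herm (Suc m)) = restrict (act m A B) (Herm (Suc m))"
    if "(A, B) \<in> sl_pairs m" for A B
    using congruence_eq_act[OF assms that] by (intro restrict_ext)
  have G: "G_sub (Suc m) = {restrict (congruence A) (Herm (Suc m)) | A. A \<in> SL3 m}"
    using assms by (simp add: G_sub_def)
  show ?thesis
  proof (intro equalityI subsetI)
    fix g assume "g \<in> G_sub (Suc m)"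
    then obtain A where A: "A \<in> SL3 m" "g = restrict (congruence A) (Herm (Suc m))" unfolding G by blast
    obtain B where B: "(A, B) \<in> sl_pairs m" using SL3_pair[OF m2 A(1)] .
    show "g \<in> {restrict (act m A B) (Herm (Suc m)) | A B. (A, B) \<in> sl_pairs m}"
      using A(2) r[OF B] B by blast
  next
    fix g assume "g \<in> {restrict (act m A B) (Herm (Suc m)) | A B. (A, B) \<in> sl_pairs m}"
    then obtain A B where "(A, B) \<in> sl_pairs m" "g = restrict (act m A B) (Herm (Suc m))" by blast
    then have "g = restrict (congruence A) (Herm (Suc m))" "A \<in> SL3 m"
      using r[of A B] sl_pairsD(1)[of A B m] by simp_all
    then show "g \<in> G_sub (Suc m)" unfolding G by blast
  qed
qed

subsection \<open>Elements of the special linear groups\<close>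

lemma sl_pairsI:
  assumes "m \<le> 2" "A \<in> mat_over m" "B \<in> mat_over m" "A \<odot>\<odot> B = omat_one" "B \<odot>\<odot> A = omat_one"
    and "m \<le> 1 \<Longrightarrow> \<exists>M. A = cmat M \<and> det M = 1"
    and "\<And>S. m = 2 \<Longrightarrow> S \<in> Herm 2 \<Longrightarrow> det3 (congruence A S) = det3 S"
  shows "(A, B) \<in> sl_pairs m"
proof (cases "m \<le> 1")
  case True
  obtain M where "A = cmat M" "det M = 1" using assms(6)[OF True] by blast
  then have "A \<in> SL3 m" using SL3_commutative[OF True] assms(2) by blast
  then show ?thesis using assms(2-5) by (simp add: sl_pairs_def)
next
  case False
  then have m: "m = 2" using assms(1) by simp
  have "A \<in> SL3 2" unfolding SL3_quaternionic using assms(2-5) assms(7)[OF m] unfolding m by blast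
  then show ?thesis using assms(2-5) by (simp add: sl_pairs_def m)
qed

lemma inner_oct_of_real [simp]: "inner (oct_of_real a) (oct_of_real b) = a * b"
  by (simp add: inner_oct)

definition rmat :: "real^3^3 \<Rightarrow> omat" where
  "rmat R = (\<chi> i j. oct_of_real (R$i$j))"

lemma congruence_rmat: "congruence (rmat R) X = real_cong R X"
  by (simp add: vec_eq_iff congruence_nth real_cong_nth rmat_def sum_3 algebra_simps)

lemma rmat_mult: "rmat R \<odot>\<odot> rmat R' = rmat (R ** R')"
  by (simp add: vec_eq_iff rmat_def mmult_nth matrix_matrix_mult_def sum_3 oct_of_real_add oct_of_real_scaleR
      mult.commute)

lemma rmat_one: "rmat (mat 1) = omat_one"
  by (simp add: omat_eq_iff rmat_def mat_def Diag_nth)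

lemma rmat_over: "rmat R \<in> mat_over m"
  by (simp add: rmat_def mat_over_def)

lemma rotation_in_sl_pairs:
  assumes "m \<le> 2" "orthogonal_matrix R" "det R = 1"
  shows "(rmat R, rmat (transpose R)) \<in> sl_pairs m"
proof (rule sl_pairsI[OF assms(1) rmat_over rmat_over])
  show "rmat R \<odot>\<odot> rmat (transpose R) = omat_one" "rmat (transpose R) \<odot>\<odot> rmat R = omat_one"
    using assms(2) by (simp_all add: rmat_mult orthogonal_matrix_def rmat_one)
  have "rmat R = cmat (\<chi> i j. complex_of_real (R$i$j))"
    by (simp add: rmat_def cmat_def oct_of_complex_of_real)
  moreover have "det (\<chi> i j. complex_of_real (R$i$j)) = complex_of_real (det R)" by (simp add: det_3)
  ultimately show "\<exists>M. rmat R = cmat M \<and> det M = 1" using assms(3) by (metis of_real_1)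
  fix S assume "S \<in> Herm 2"
  then show "det3 (congruence (rmat R) S) = det3 S"
    unfolding congruence_rmat using reachable_det3[OF reachable_real_cong[OF assms(2,3)], of 2 S] by simp
qed

definition diag_mat :: "octonion \<Rightarrow> octonion \<Rightarrow> octonion \<Rightarrow> omat" where
  "diag_mat p q r = vector [vector [p, 0, 0], vector [0, q, 0], vector [0, 0, r]]"

lemma diag_mat_nth [simp]:
  "diag_mat a b c $ 1 $ 1 = a" "diag_mat a b c $ 2 $ 2 = b" "diag_mat a b c $ 3 $ 3 = c"
  "diag_mat a b c $ 1 $ 2 = 0" "diag_mat a b c $ 1 $ 3 = 0" "diag_mat a b c $ 2 $ 1 = 0"
  "diag_mat a b c $ 2 $ 3 = 0" "diag_mat a b c $ 3 $ 1 = 0" "diag_mat a b c $ 3 $ 2 = 0"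
  by (simp_all add: diag_mat_def)

lemma diag_mat_over: "p \<in> div_alg m \<Longrightarrow> q \<in> div_alg m \<Longrightarrow> r \<in> div_alg m \<Longrightarrow> diag_mat p q r \<in> mat_over m"
  by (simp add: mat_over_def forall_3)

lemma diag_mat_mult: "diag_mat p q r \<odot>\<odot> diag_mat p' q' r' = diag_mat (p \<odot> p') (q \<odot> q') (r \<odot> r')"
  by (simp add: omat_eq_iff mmult_nth)

lemma diag_mat_of_real: "diag_mat (oct_of_real a) (oct_of_real b) (oct_of_real c) = Diag a b c"
  by (simp add: omat_eq_iff Diag_nth)

lemma congruence_diag_mat:
  assumes "p \<in> div_alg 2" "q \<in> div_alg 2" "r \<in> div_alg 2" "x \<in> div_alg 2" "y \<in> div_alg 2" "z \<in> div_alg 2"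
  shows "congruence (diag_mat p q r) (herm a b c x y z) =
    herm (inner p p * a) (inner q q * b) (inner r r * c) ((q \<odot> x) \<odot> ocnj r) ((r \<odot> y) \<odot> ocnj p) ((p \<odot> z) \<odot> ocnj q)"
  unfolding omat_eq_iff congruence_nth sum_3 herm_nth diag_mat_nth
  using assms by (simp add: omult_ocnj_self oct_of_real_scaleR ocnj_omult omult_assoc div_alg_intros mult.commute)

lemma det3_congruence_diag_mat:
  assumes "p \<in> div_alg 2" "q \<in> div_alg 2" "r \<in> div_alg 2" "S \<in> Herm 2"
  shows "det3 (congruence (diag_mat p q r) S) = inner p p * inner q q * inner r r * det3 S"
proof -
  obtain a b c x y z where S: "S = herm a b c x y z" and D: "x \<in> div_alg 2" "y \<in> div_alg 2" "z \<in> div_alg 2"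
    using assms(4) by (rule HermE)
  have i: "inner (s \<odot> x) (s \<odot> x) = inner s s * inner x x" "inner (x \<odot> s) (x \<odot> s) = inner s s * inner x x"
    for s x by (simp_all add: inner_omult_omult_left inner_omult_omult_right)
  have "(((q \<odot> x) \<odot> ocnj r) \<odot> ((r \<odot> y) \<odot> ocnj p)) \<odot> ((p \<odot> z) \<odot> ocnj q) =
      (q \<odot> (x \<odot> ((ocnj r \<odot> (r \<odot> y)) \<odot> (ocnj p \<odot> (p \<odot> z))))) \<odot> ocnj q"
    using assms(1-3) D by (simp add: omult_assoc div_alg_intros)
  also have "\<dots> = (inner r r * inner p p) *\<^sub>R ((q \<odot> ((x \<odot> y) \<odot> z)) \<odot> ocnj q)"
    using assms(1-3) D by (simp add: ocnj_cancel_left omult_assoc div_alg_intros mult.commute)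
  also have "oct_Re \<dots> = inner r r * inner p p * (inner q q * oct_Re ((x \<odot> y) \<odot> z))"
    using oct_Re_commute[of "q \<odot> ((x \<odot> y) \<odot> z)" "ocnj q"] by (simp add: ocnj_cancel_left)
  finally show ?thesis
    unfolding S congruence_diag_mat[OF assms(1-3) D] det3_herm
    by (simp add: i algebra_simps)
qed

lemma diag_mat_in_sl_pairs:
  assumes "p \<in> div_alg 2" "q \<in> div_alg 2" "r \<in> div_alg 2" "inner p p * inner q q * inner r r = 1"
    and "p \<odot> p' = oct_one" "q \<odot> q' = oct_one" "r \<odot> r' = oct_one"
    and "p' \<odot> p = oct_one" "q' \<odot> q = oct_one" "r' \<odot> r = oct_one"
    and "p' \<in> div_alg 2" "q' \<in> div_alg 2" "r' \<in> div_alg 2"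
  shows "(diag_mat p q r, diag_mat p' q' r') \<in> sl_pairs 2"
  using assms by (intro sl_pairsI) (simp_all add: diag_mat_over diag_mat_mult diag_mat_of_real det3_congruence_diag_mat)

lemma phase_in_sl_pairs:
  assumes "m \<le> 2" "u \<in> div_alg m" "norm u = 1"
  shows "(diag_mat u oct_one (ocnj u), diag_mat (ocnj u) oct_one u) \<in> sl_pairs m"
proof -
  note u1 = norm_1_inner[OF assms(3)]
  have u2: "u \<in> div_alg 2" using assms(1,2) by (rule div_alg_mono)
  show ?thesis
  proof (rule sl_pairsI)
    show "\<exists>M. diag_mat u oct_one (ocnj u) = cmat M \<and> det M = 1" if m1: "m \<le> 1"
    proof -
      obtain z where z: "u = oct_of_complex z" using div_alg_1E[OF assms(2) m1] .
      have "oct_of_complex (z * cnj z) = oct_of_complex 1"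
        using omult_ocnj_self[of u] u1 by (simp add: z oct_of_complex_ops)
      then have "z * cnj z = 1" by (simp only: oct_of_complex_inj)
      then show ?thesis
        by (intro exI[of _ "vector [vector [z, 0, 0], vector [0, 1, 0], vector [0, 0, cnj z]]"])
          (simp add: omat_eq_iff cmat_def oct_of_complex_ops z det_3)
    qed
  qed (use assms u1 u2 in \<open>simp_all add: diag_mat_over diag_mat_mult diag_mat_of_real omult_ocnj_self
      ocnj_omult_self det3_congruence_diag_mat\<close>)
qed

lemma scaling_in_sl_pairs:
  assumes "m \<le> 2" "q \<noteq> 0"
  shows "(Diag 1 q (1/q), Diag 1 (1/q) q) \<in> sl_pairs m"
proof (rule sl_pairsI[OF assms(1)])
  show "\<exists>M. Diag 1 q (1/q) = cmat M \<and> det M = 1"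
    using assms(2) of_real_mult[of q "1/q", where 'a = complex]
    by (intro exI[of _ "vector [vector [1, 0, 0], vector [0, of_real q, 0], vector [0, 0, of_real (1/q)]]"])
      (simp add: omat_eq_iff cmat_def oct_of_complex_ops oct_of_complex_of_real det_3 Diag_nth del: of_real_divide of_real_mult)
qed (use assms(2) in \<open>simp_all add: mat_over_Diag diag_mat_mult oct_of_real_scaleR power2_eq_square
    det3_congruence_diag_mat diag_mat_over flip: diag_mat_of_real\<close>)

text \<open>Places the diagonalising moves inside SL(3, A_m), so that reducing S to diagonal form is
  an operation of the group.\<close>

lemma unitary_moves_congruence:
  assumes "f \<in> unitary_moves m" "m \<le> 2"
  shows "\<exists>A B. (A, B) \<in> sl_pairs m \<and> (\<forall>S\<in>Herm m. f S = congruence A S)"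
  using assms(1)
proof (induction rule: unitary_moves.induct)
  case (rot R)
  then show ?case using rotation_in_sl_pairs[OF assms(2)] congruence_rmat by metis
next
  case (phase u)
  have "phase u S = congruence (diag_mat u oct_one (ocnj u)) S" if S: "S \<in> Herm m" for S
  proof -
    obtain a b c x y z where "S = herm a b c x y z" "x \<in> div_alg 2" "y \<in> div_alg 2" "z \<in> div_alg 2"
      using Herm_mono[OF assms(2) S] by (rule HermE)
    then show ?thesis
      using phase div_alg_mono[OF assms(2)] by (simp add: congruence_diag_mat norm_1_inner)
  qed
  then show ?case using phase_in_sl_pairs[OF assms(2)] phase by blast
next
  case (comp f g)
  then obtain A B A' B' where AB: "(A, B) \<in> sl_pairs m" "\<forall>S\<in>Herm m. f S = congruence A S"
    "(A', B') \<in> sl_pairs m" "\<forall>S\<in>Herm m. g S = congruence A' S" by blast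
  have "(f \<circ> g) S = congruence (A \<odot>\<odot> A') S" if S: "S \<in> Herm m" for S
  proof -
    have "S \<in> mat_over 2" using Herm_mono[OF assms(2) S] by (simp add: Herm_def)
    then have "congruence (A \<odot>\<odot> A') S = congruence A (congruence A' S)"
      using sl_pairs_mono2[OF assms(2)] AB(1,3) by (intro congruence_mmult) blast+
    then show ?thesis using AB S act_closed(1)[OF assms(2) AB(3) S] by simp
  qed
  then show ?case using sl_pairs_mult[OF assms(2) AB(1,3)] by blast
qed

section \<open>Transvections\<close>

definition transvection :: "3 \<Rightarrow> 3 \<Rightarrow> octonion \<Rightarrow> omat" where
  "transvection i j t = (\<chi> p q. if p = q then oct_one else if p = i \<and> q = j then t else 0)"

lemma transvection_over: "t \<in> div_alg m \<Longrightarrow> transvection i j t \<in> mat_over m"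
  by (simp add: transvection_def mat_over_def)

lemma transvection_0: "transvection i j 0 = omat_one"
  by (simp add: transvection_def omat_eq_iff Diag_nth)

lemma transvection_inverse: "i \<noteq> j \<Longrightarrow> transvection i j t \<odot>\<odot> transvection i j (- t) = omat_one"
  using exhaust_3[of i] exhaust_3[of j]
  by (auto simp: omat_eq_iff mmult_nth transvection_def Diag_nth)

text \<open>The two shapes arise from adding t times the second row to the first and conversely,
  with the matching column operation; the other four positions follow by cyclic permutation.\<close>

lemma det3_shear:
  "det3 (herm (a + 2 * inner t z + b * inner t t) b c x (y + ocnj x \<odot> ocnj t) (z + b *\<^sub>R t)) =
    det3 (herm a b c x y z)"
  "det3 (herm a (b + 2 * inner t (ocnj z) + a * inner t t) c (x + t \<odot> ocnj y) y (z + a *\<^sub>R ocnj t)) =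
    det3 (herm a b c x y z)"
proof -
  have y: "inner y (ocnj x \<odot> ocnj t) = oct_Re ((x \<odot> y) \<odot> t)" "inner (ocnj x \<odot> ocnj t) y = oct_Re ((x \<odot> y) \<odot> t)"
    by (simp_all add: inner_commute[of "ocnj x \<odot> ocnj t"]) (simp_all add: inner_oct ocnj_omult, (metis oct_Re_assoc oct_Re_commute)+)
  have x: "inner x (t \<odot> ocnj y) = oct_Re ((x \<odot> y) \<odot> ocnj t)" "inner (t \<odot> ocnj y) x = oct_Re ((x \<odot> y) \<odot> ocnj t)"
    by (simp_all add: inner_commute[of "t \<odot> ocnj y"]) (simp_all add: inner_oct ocnj_omult oct_Re_assoc)
  have xt: "inner (ocnj x \<odot> ocnj t) (ocnj x \<odot> ocnj t) = inner x x * inner t t"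
    "inner (t \<odot> ocnj y) (t \<odot> ocnj y) = inner t t * inner y y"
    by (simp_all add: inner_omult_omult_left)
  have c: "x \<odot> (ocnj x \<odot> ocnj t) = inner x x *\<^sub>R ocnj t" "(t \<odot> ocnj y) \<odot> y = inner y y *\<^sub>R t"
    by (simp_all add: ocnj_cancel_left' ocnj_cancel_right')
  have r: "oct_Re (ocnj t \<odot> z) = inner t z" "oct_Re (t \<odot> z) = inner t (ocnj z)"
    "oct_Re (ocnj t \<odot> t) = inner t t" "oct_Re (t \<odot> ocnj t) = inner t t"
    by (simp_all add: inner_oct) (metis oct_Re_commute inner_oct inner_commute)+
  have iz: "inner z t = inner t z" "inner z (ocnj t) = inner t (ocnj z)"
    by (simp_all add: inner_commute) (metis inner_ocnj ocnj_ocnj inner_commute)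
  have it: "inner (ocnj t) z = inner t (ocnj z)" using iz(2) by (simp add: inner_commute)
  show "det3 (herm (a + 2 * inner t z + b * inner t t) b c x (y + ocnj x \<odot> ocnj t) (z + b *\<^sub>R t)) =
    det3 (herm a b c x y z)"
    by (simp add: det3_herm inner_add_left inner_add_right y xt omult_add_left omult_add_right c r iz algebra_simps)
  show "det3 (herm a (b + 2 * inner t (ocnj z) + a * inner t t) c (x + t \<odot> ocnj y) y (z + a *\<^sub>R ocnj t)) =
    det3 (herm a b c x y z)"
    by (simp add: det3_herm inner_add_left inner_add_right x xt omult_add_left omult_add_right c r iz it algebra_simps)
qed

lemma det3_cycle: "det3 (herm a b c x y z) = det3 (herm b c a y z x)"
  using oct_Re_triple_cyclic[of y z x] by (simp add: det3_herm algebra_simps)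

lemma det3_transvection:
  assumes "i \<noteq> j" "S \<in> Herm 3"
  shows "det3 (congruence (transvection i j t) S) = det3 S"
proof -
  obtain a b c x y z where S: "S = herm a b c x y z" using assms(2) by (rule HermE)
  have e: "w \<odot> ocnj t = oct_of_real (2 * inner t w) - t \<odot> ocnj w" for w
    using ocnj_add_self[of "t \<odot> ocnj w"] by (simp add: ocnj_omult inner_oct algebra_simps)
  have 12: "congruence (transvection 1 2 t) S =
      herm (a + 2 * inner t z + b * inner t t) b c x (y + ocnj x \<odot> ocnj t) (z + b *\<^sub>R t)"
    unfolding S omat_eq_iff congruence_nth sum_3 herm_nth transvection_def
    by (simp add: e[of z] omult_add_left omult_ocnj_self ocnj_add ocnj_omult oct_of_real_add oct_of_real_scaleR)
  have 23: "congruence (transvection 2 3 t) S =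
      herm a (b + 2 * inner t x + c * inner t t) c (x + c *\<^sub>R t) y (z + ocnj y \<odot> ocnj t)"
    unfolding S omat_eq_iff congruence_nth sum_3 herm_nth transvection_def
    by (simp add: e[of x] omult_add_left omult_ocnj_self ocnj_add ocnj_omult oct_of_real_add oct_of_real_scaleR)
  have 31: "congruence (transvection 3 1 t) S =
      herm a b (c + 2 * inner t y + a * inner t t) (x + ocnj z \<odot> ocnj t) (y + a *\<^sub>R t) z"
    unfolding S omat_eq_iff congruence_nth sum_3 herm_nth transvection_def
    by (simp add: e[of y] omult_add_left omult_ocnj_self ocnj_add ocnj_omult oct_of_real_add oct_of_real_scaleR)
  have 21: "congruence (transvection 2 1 t) S =
      herm a (b + 2 * inner t (ocnj z) + a * inner t t) c (x + t \<odot> ocnj y) y (z + a *\<^sub>R ocnj t)"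
    unfolding S omat_eq_iff congruence_nth sum_3 herm_nth transvection_def
    by (simp add: e[of "ocnj z"] omult_add_left omult_ocnj_self ocnj_add ocnj_omult oct_of_real_add oct_of_real_scaleR)
  have 32: "congruence (transvection 3 2 t) S =
      herm a b (c + 2 * inner t (ocnj x) + b * inner t t) (x + b *\<^sub>R ocnj t) (y + t \<odot> ocnj z) z"
    unfolding S omat_eq_iff congruence_nth sum_3 herm_nth transvection_def
    by (simp add: e[of "ocnj x"] omult_add_left omult_ocnj_self ocnj_add ocnj_omult oct_of_real_add oct_of_real_scaleR)
  have 13: "congruence (transvection 1 3 t) S =
      herm (a + 2 * inner t (ocnj y) + c * inner t t) b c x (y + c *\<^sub>R ocnj t) (z + t \<odot> ocnj x)"
    unfolding S omat_eq_iff congruence_nth sum_3 herm_nth transvection_def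
    by (simp add: e[of "ocnj y"] omult_add_left omult_ocnj_self ocnj_add ocnj_omult oct_of_real_add oct_of_real_scaleR)
  consider "i = 1 \<and> j = 2" | "i = 2 \<and> j = 3" | "i = 3 \<and> j = 1" | "i = 2 \<and> j = 1" | "i = 3 \<and> j = 2" | "i = 1 \<and> j = 3"
    using assms(1) exhaust_3[of i] exhaust_3[of j] by auto
  then have "det3 (congruence (transvection i j t) S) = det3 (herm a b c x y z)"
  proof cases
    case 1 then show ?thesis by (simp only: 12 det3_shear)
  next
    \<comment> \<open>Position (2,3) becomes position (1,2) after a cyclic shift of the indices; the
      cases (3,1), (3,2) and (1,3) are reduced likewise.\<close>
    case 2 then show ?thesis
      using det3_shear(1)[of b t x c a y z] det3_cycle[of a b c x y z] by (simp only: 23) (subst det3_cycle, simp)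
  next
    case 3 then show ?thesis
      using det3_shear(1)[of c t y a b z x] det3_cycle[of c a b z x y] by (simp only: 31) (subst det3_cycle[symmetric], simp)
  next
    case 4 then show ?thesis by (simp only: 21 det3_shear)
  next
    case 5 then show ?thesis
      using det3_shear(2)[of b c t x a y z] det3_cycle[of a b c x y z] by (simp only: 32) (subst det3_cycle, simp)
  next
    case 6 then show ?thesis
      using det3_shear(2)[of c a t y b z x] det3_cycle[of c a b z x y] by (simp only: 13) (subst det3_cycle[symmetric], simp)
  qed
  then show ?thesis unfolding S .
qed

lemma transvection_in_sl_pairs:
  assumes "i \<noteq> j" "t \<in> div_alg 2" shows "(transvection i j t, transvection i j (- t)) \<in> sl_pairs 2"
proof (rule sl_pairsI)
  show "transvection i j (- t) \<odot>\<odot> transvection i j t = omat_one"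
    using transvection_inverse[OF assms(1), of "- t"] by simp
  show "det3 (congruence (transvection i j t) S) = det3 S" if "S \<in> Herm 2" for S
    using det3_transvection[OF assms(1)] Herm_mono[of 2 3 S] that by simp
qed (use assms in \<open>simp_all add: transvection_over transvection_inverse div_alg_minus\<close>)

section \<open>The centralizer of \<open>Sp(1)\<close> in \<open>E\<^sub>6\<close>\<close>

lemma Suc_2_eq_3: "Suc 2 = 3"
  by simp

lemmas emb3 = emb_in_Herm[OF order_refl, unfolded Suc_2_eq_3]
lemmas emb3_eq_iff = emb_eq_iff[OF order_refl]

lemma emb3_cases:
  assumes "X \<in> Herm 3"
  obtains S v where "X = emb 2 S v" "S \<in> Herm 2" "v \<in> vec_over 2"
  using emb_cases[OF order_refl, of X] assms by auto

lemma octonion_cases: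
  obtains a b where "x = a + b \<odot> cd_unit 2" "a \<in> div_alg 2" "b \<in> div_alg 2"
  using cd_decomp[of 2 x] that[of "cd_fst 2 x" "cd_snd 2 x"] by simp

definition twist :: "octonion \<Rightarrow> octonion \<Rightarrow> octonion" where
  "twist p x = cd_fst 2 x + (p \<odot> cd_snd 2 x) \<odot> cd_unit 2"

definition twist_mat :: "octonion \<Rightarrow> omat \<Rightarrow> omat" where
  "twist_mat p X = (\<chi> i j. twist p (X$i$j))"

definition left_mult :: "octonion \<Rightarrow> octonion^3 \<Rightarrow> octonion^3" where
  "left_mult p v = (\<chi> i. p \<odot> v$i)"

lemma twist_pair:
  "a \<in> div_alg 2 \<Longrightarrow> b \<in> div_alg 2 \<Longrightarrow> twist p (a + b \<odot> cd_unit 2) = a + (p \<odot> b) \<odot> cd_unit 2"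
  by (simp add: twist_def cd_fst_pair cd_snd_pair)

lemma linear_twist: "linear (twist p)"
  by (rule linearI)
    (simp_all add: twist_def linear_add[OF linear_cd_fst] linear_add[OF linear_cd_snd]
      linear_cmul[OF linear_cd_fst] linear_cmul[OF linear_cd_snd] omult_add_left omult_add_right algebra_simps)

text \<open>In the first component of the doubling formula p cancels because its norm is 1; in the
  second it stands at the left end of both terms and can be pulled out.\<close>

lemma twist_mult:
  assumes "p \<in> div_alg 2" "norm p = 1"
  shows "twist p (x \<odot> y) = twist p x \<odot> twist p y"
proof -
  obtain a b where x: "x = a + b \<odot> cd_unit 2" "a \<in> div_alg 2" "b \<in> div_alg 2" by (rule octonion_cases)
  obtain c d where y: "y = c + d \<odot> cd_unit 2" "c \<in> div_alg 2" "d \<in> div_alg 2" by (rule octonion_cases)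
  have cancel: "ocnj (p \<odot> d) \<odot> (p \<odot> b) = ocnj d \<odot> b"
    using assms(1) x y norm_1_inner[OF assms(2)]
    by (simp add: ocnj_omult omult_assoc div_alg_intros ocnj_cancel_left)
  have "x \<odot> y = (a \<odot> c - ocnj d \<odot> b) + (d \<odot> a + b \<odot> ocnj c) \<odot> cd_unit 2"
    unfolding x(1) y(1) using x y by (intro cd_mult) simp_all
  moreover have "(a + (p \<odot> b) \<odot> cd_unit 2) \<odot> (c + (p \<odot> d) \<odot> cd_unit 2) =
      (a \<odot> c - ocnj (p \<odot> d) \<odot> (p \<odot> b)) + ((p \<odot> d) \<odot> a + (p \<odot> b) \<odot> ocnj c) \<odot> cd_unit 2"
    using x y assms(1) by (intro cd_mult) (simp_all add: div_alg_mult)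
  ultimately show ?thesis
    unfolding x(1) y(1) using x(2,3) y(2,3) assms(1)
    by (simp only: twist_pair cancel div_alg_intros) (simp add: omult_add_right omult_assoc div_alg_ocnj)
qed

lemma twist_of_real [simp]: "twist p (oct_of_real t) = oct_of_real t"
  using twist_pair[of "oct_of_real t" 0 p] by simp

lemma twist_ocnj: "p \<in> div_alg 2 \<Longrightarrow> twist p (ocnj x) = ocnj (twist p x)"
proof -
  assume p: "p \<in> div_alg 2"
  obtain a b where x: "x = a + b \<odot> cd_unit 2" "a \<in> div_alg 2" "b \<in> div_alg 2" by (rule octonion_cases)
  have pb: "p \<odot> b \<in> div_alg 2" using p x by (simp add: div_alg_mult)
  have "twist p (ocnj x) = twist p (ocnj a + (- b) \<odot> cd_unit 2)"
    unfolding x(1) using cd_cnj[of 2 a b] x by simp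
  also have "\<dots> = ocnj a + (p \<odot> (- b)) \<odot> cd_unit 2" using x by (intro twist_pair) (simp_all add: div_alg_intros)
  also have "\<dots> = ocnj (a + (p \<odot> b) \<odot> cd_unit 2)"
    using cd_cnj[OF order_refl x(2) pb] by (simp add: omult_minus_right)
  also have "\<dots> = ocnj (twist p x)" unfolding x(1) using x by (simp add: twist_pair)
  finally show ?thesis .
qed

lemma twist_mat_herm:
  "p \<in> div_alg 2 \<Longrightarrow> twist_mat p (herm a b c x y z) = herm a b c (twist p x) (twist p y) (twist p z)"
  by (simp add: omat_eq_iff twist_mat_def twist_ocnj)

lemma twist_mat_emb:
  assumes "p \<in> div_alg 2" "S \<in> Herm 2" "v \<in> vec_over 2"
  shows "twist_mat p (emb 2 S v) = emb 2 S (left_mult p v)"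
proof -
  obtain a b c x y z where S: "S = herm a b c x y z" "x \<in> div_alg 2" "y \<in> div_alg 2" "z \<in> div_alg 2"
    using assms(2) by (rule HermE)
  then show ?thesis
    using assms(1) assms(3)[THEN vec_over_nth] by (simp add: emb_herm twist_mat_herm twist_pair left_mult_def)
qed

lemma vec_over_add: "v \<in> vec_over m \<Longrightarrow> w \<in> vec_over m \<Longrightarrow> v + w \<in> vec_over m"
  by (simp add: vec_over_def div_alg_add)

lemma left_mult_in: "p \<in> div_alg m \<Longrightarrow> v \<in> vec_over m \<Longrightarrow> left_mult p v \<in> vec_over m"
  by (simp add: left_mult_def vec_over_def div_alg_mult)

text \<open>Supplies one element of Sp(1) for each unit quaternion; commuting with these alone will
  already determine the centralizer.\<close>

lemma twist_mat_in_Sp1: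
  assumes "p \<in> div_alg 2" "norm p = 1"
  shows "restrict (twist_mat p) (Herm 3) \<in> Sp1"
proof -
  have lin: "linear (twist_mat p)"
    by (rule linearI) (simp_all add: twist_mat_def vec_eq_iff linear_add[OF linear_twist] linear_cmul[OF linear_twist])
  have H: "twist_mat p X \<in> Herm 3" if "X \<in> Herm 3" "p \<in> div_alg 2" for X p
    using that by (elim HermE) (simp add: twist_mat_herm)
  have inv: "twist_mat (ocnj q) (twist_mat q X) = X" if X: "X \<in> Herm 3" and q: "q \<in> div_alg 2" "norm q = 1" for X q
  proof -
    obtain S v where X: "X = emb 2 S v" "S \<in> Herm 2" "v \<in> vec_over 2" using X by (rule emb3_cases)
    have "left_mult (ocnj q) (left_mult q v) = v"
      using norm_1_inner[OF q(2)] by (simp add: left_mult_def ocnj_cancel_left vec_eq_iff)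
    then show ?thesis using X q by (simp add: twist_mat_emb left_mult_in)
  qed
  have GL: "restrict (twist_mat p) (Herm 3) \<in> GL_on (Herm 3)"
    by (rule restrict_in_GL_on[where g = "twist_mat (ocnj p)", OF lin subspace_Herm])
      (use assms inv[of _ p] inv[of _ "ocnj p"] in \<open>simp_all add: H\<close>)
  have mm: "twist_mat p (X \<odot>\<odot> Y) = twist_mat p X \<odot>\<odot> twist_mat p Y" for X Y
    by (simp add: twist_mat_def vec_eq_iff mmult_nth linear_add[OF linear_twist] twist_mult[OF assms])
  have "twist_mat p (jordan_prod X Y) = jordan_prod (twist_mat p X) (twist_mat p Y)" for X Y
    by (simp add: jordan_prod_def mm linear_add[OF lin] linear_cmul[OF lin])
  then have "restrict (twist_mat p) (Herm 3) \<in> jordan_aut 3"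
    using GL by (simp add: jordan_aut_def jordan_prod_in_Herm)
  moreover have "twist_mat p X = X" if "X \<in> Herm 2" for X
    using twist_mat_emb[OF assms(1) that, of 0] by (simp add: vec_over_def left_mult_def zero_vec_def[symmetric])
  ultimately show ?thesis using Herm_mono[of 2 3] by (simp add: Sp1_def)
qed

text \<open>Coordinate vectors detect the diagonal. Vectors with two nonzero entries 1 and w detect
  the inner products of the off-diagonal entries with w, and w is then taken to be the difference of
  the entries to be compared.\<close>

lemma herm_form_eq_imp_eq:
  assumes "S \<in> Herm 2" "S' \<in> Herm 2" "\<And>v. v \<in> vec_over 2 \<Longrightarrow> herm_form S v = herm_form S' v"
  shows "S = S'"
proof -
  obtain a b c x y z where S: "S = herm a b c x y z" "x \<in> div_alg 2" "y \<in> div_alg 2" "z \<in> div_alg 2"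
    using assms(1) by (rule HermE)
  obtain a' b' c' x' y' z' where S': "S' = herm a' b' c' x' y' z'" "x' \<in> div_alg 2" "y' \<in> div_alg 2" "z' \<in> div_alg 2"
    using assms(2) by (rule HermE)
  have eq: "herm_form S (vector [p, q, r]) = herm_form S' (vector [p, q, r])"
    if "p \<in> div_alg 2" "q \<in> div_alg 2" "r \<in> div_alg 2" for p q r
    using assms(3)[of "vector [p, q, r]"] that by (simp add: vec_over_def forall_3)
  have "a = a'" "b = b'" "c = c'"
    using eq[of oct_one 0 0] eq[of 0 oct_one 0] eq[of 0 0 oct_one] by (simp_all add: S(1) S'(1) herm_form_herm)
  then have re: "oct_Re (x \<odot> ocnj w) = oct_Re (x' \<odot> ocnj w)" "oct_Re (y \<odot> ocnj w) = oct_Re (y' \<odot> ocnj w)"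
    "oct_Re (z \<odot> ocnj w) = oct_Re (z' \<odot> ocnj w)" if "w \<in> div_alg 2" for w
    using eq[of 0 oct_one w] eq[of w 0 oct_one] eq[of oct_one w 0] that by (simp_all add: S(1) S'(1) herm_form_herm)
  have d: "u = u'" if "oct_Re (u \<odot> ocnj (u - u')) = oct_Re (u' \<odot> ocnj (u - u'))" for u u'
  proof -
    have "inner (u - u') (u - u') = inner u (u - u') - inner u' (u - u')" by (rule inner_diff_left)
    also have "\<dots> = 0" using that by (simp only: inner_oct)
    finally show ?thesis by simp
  qed
  have "x = x'" "y = y'" "z = z'"
    using S(2-4) S'(2-4) by - (rule d, rule re, simp add: div_alg_diff)+
  then show ?thesis using \<open>a = a'\<close> \<open>b = b'\<close> \<open>c = c'\<close> by (simp add: S(1) S'(1))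
qed

text \<open>The automorphism preserves the trace form, hence the complement \<open>A\<^sub>2\<^sup>3\<close> of \<open>H\<^sub>2\<close>; since it preserves \<open>v S v\<^sup>*\<close>
  for every \<open>S\<close>, it preserves all products \<open>v\<^sub>i\<^sup>* w\<^sub>j\<close> with \<open>i \<noteq> j\<close>.\<close>

lemma Sp1_left_mult:
  assumes "h \<in> Sp1"
  obtains p where "p \<in> div_alg 2" "\<And>S v. S \<in> Herm 2 \<Longrightarrow> v \<in> vec_over 2 \<Longrightarrow> h (emb 2 S v) = emb 2 S (left_mult p v)"
proof -
  have h: "h \<in> jordan_aut 3" and fix2: "\<And>S. S \<in> Herm 2 \<Longrightarrow> h S = S" using assms by (auto simp: Sp1_def)
  have 0: "(0::octonion^3) \<in> vec_over 2" and H0: "(0::omat) \<in> Herm 2" by (simp_all add: vec_over_def Herm_intros)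
  have H3: "S \<in> Herm 3" if "S \<in> Herm 2" for S using that Herm_mono[of 2 3] by simp
  define \<eta> where "\<eta> v = off_part 2 (h (emb 2 0 v))" for v
  have \<eta>: "h (emb 2 0 v) = emb 2 0 (\<eta> v)" "\<eta> v \<in> vec_over 2" if v: "v \<in> vec_over 2" for v
  proof -
    have E: "emb 2 0 v \<in> Herm 3" using emb3[OF H0 v] .
    obtain W w where W: "h (emb 2 0 v) = emb 2 W w" "W \<in> Herm 2" "w \<in> vec_over 2"
      using jordan_aut_in[OF h E] by (rule emb3_cases)
    have tr: "herm_trace (jordan_prod (emb 2 T u) W) = herm_trace (jordan_prod T W)" if T2: "T \<in> Herm 2" and u2: "u \<in> vec_over 2" for T u
    proof -
      obtain a b c x y z where T: "T = herm a b c x y z" "x \<in> div_alg 2" "y \<in> div_alg 2" "z \<in> div_alg 2"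
        using T2 by (rule HermE)
      obtain a' b' c' x' y' z' where W': "W = herm a' b' c' x' y' z'" "x' \<in> div_alg 2" "y' \<in> div_alg 2" "z' \<in> div_alg 2"
        using W(2) by (rule HermE)
      have i: "inner (d + u$k \<odot> cd_unit 2) e = inner d e" if "d \<in> div_alg 2" "e \<in> div_alg 2" for d e k
        using inner_cd[of 2 d "u$k" e 0] that u2[THEN vec_over_nth] by simp
      show ?thesis unfolding T(1) W'(1) emb_herm jordan_prod_herm herm_trace_herm using T W' by (simp add: i)
    qed
    \<comment> \<open>W is fixed by h, and the trace form pairs H_2 trivially with its complement.
      So tr(W W) equals tr(h(v) h(W)) = tr(v W) = 0, and W = 0 by definiteness.\<close>
    have "herm_trace (jordan_prod W W) = herm_trace (jordan_prod (h (emb 2 0 v)) (h W))"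
      unfolding W(1) fix2[OF W(2)] tr[OF W(2,3)] ..
    also have "\<dots> = herm_trace (h (jordan_prod (emb 2 0 v) W))"
      by (simp add: jordan_aut_jordan[OF h E H3[OF W(2)]])
    also have "\<dots> = herm_trace (jordan_prod (emb 2 0 v) W)"
      by (rule jordan_aut_trace[OF h order_refl jordan_prod_in_Herm[OF E H3[OF W(2)]]])
    also have "\<dots> = 0" using tr[OF H0 v] jordan_prod_bilinear(3)[of 0 0 W] by (simp add: herm_trace_def)
    finally have "W = 0" using trace_form_pos[OF H3[OF W(2)]] by simp
    then have e: "h (emb 2 0 v) = emb 2 0 w" using W(1) by simp
    then have "\<eta> v = w" unfolding \<eta>_def using off_part_emb[OF order_refl H0 W(3)] by simp
    then show "h (emb 2 0 v) = emb 2 0 (\<eta> v)" "\<eta> v \<in> vec_over 2" using e W(3) by simp_all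
  qed
  have h_emb: "h (emb 2 S v) = emb 2 S (\<eta> v)" if "S \<in> Herm 2" "v \<in> vec_over 2" for S v
  proof -
    have "emb 2 S v = S + emb 2 0 v" using emb_add[of 2 S 0 0 v] by simp
    then have "h (emb 2 S v) = S + emb 2 0 (\<eta> v)"
      using jordan_aut_add[OF h H3[OF that(1)] emb3[OF H0 that(2)]] fix2[OF that(1)] \<eta>(1)[OF that(2)] by simp
    then show ?thesis using emb_add[of 2 S 0 0 "\<eta> v"] by simp
  qed
  have form: "herm_form S (\<eta> v) = herm_form S v" if "S \<in> Herm 2" "v \<in> vec_over 2" for S v
    using jordan_aut_det3[OF h order_refl emb3[OF that]] that
    by (simp add: h_emb det3_emb \<eta>(2))
  have detect: "d = d'" if "d \<in> div_alg 2" "d' \<in> div_alg 2"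
      "\<And>w. w \<in> div_alg 2 \<Longrightarrow> oct_Re (d \<odot> w) = oct_Re (d' \<odot> w)" for d d'
  proof -
    have "inner (d - d') (d - d') = 0"
      using that(3)[of "ocnj (d - d')"] that(1,2) by (simp add: inner_oct omult_diff_left div_alg_intros)
    then show ?thesis by simp
  qed
  have r: "oct_Re ((q \<odot> w) \<odot> ocnj s) = oct_Re ((ocnj s \<odot> q) \<odot> w)" for q w s
    by (metis oct_Re_assoc oct_Re_commute)
  have inv: "ocnj (\<eta> v $ 3) \<odot> \<eta> v $ 2 = ocnj (v$3) \<odot> v$2" "ocnj (\<eta> v $ 1) \<odot> \<eta> v $ 3 = ocnj (v$1) \<odot> v$3"
    "ocnj (\<eta> v $ 2) \<odot> \<eta> v $ 1 = ocnj (v$2) \<odot> v$1"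
    "inner (\<eta> v $ 1) (\<eta> v $ 1) = inner (v$1) (v$1)" "inner (\<eta> v $ 2) (\<eta> v $ 2) = inner (v$2) (v$2)"
    "inner (\<eta> v $ 3) (\<eta> v $ 3) = inner (v$3) (v$3)" if v: "v \<in> vec_over 2" for v
  proof -
    note D = v[THEN vec_over_nth] \<eta>(2)[OF v, THEN vec_over_nth]
    show "ocnj (\<eta> v $ 3) \<odot> \<eta> v $ 2 = ocnj (v$3) \<odot> v$2"
      by (rule detect) (use D form[of "herm 0 0 0 w 0 0" v for w] v in \<open>simp_all add: div_alg_intros herm_form_herm r\<close>)
    show "ocnj (\<eta> v $ 1) \<odot> \<eta> v $ 3 = ocnj (v$1) \<odot> v$3"
      by (rule detect) (use D form[of "herm 0 0 0 0 w 0" v for w] v in \<open>simp_all add: div_alg_intros herm_form_herm r\<close>)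
    show "ocnj (\<eta> v $ 2) \<odot> \<eta> v $ 1 = ocnj (v$2) \<odot> v$1"
      by (rule detect) (use D form[of "herm 0 0 0 0 0 w" v for w] v in \<open>simp_all add: div_alg_intros herm_form_herm r\<close>)
    show "inner (\<eta> v $ 1) (\<eta> v $ 1) = inner (v$1) (v$1)" "inner (\<eta> v $ 2) (\<eta> v $ 2) = inner (v$2) (v$2)"
      "inner (\<eta> v $ 3) (\<eta> v $ 3) = inner (v$3) (v$3)"
      using form[of "Diag 1 0 0" v] form[of "Diag 0 1 0" v] form[of "Diag 0 0 1" v] v
      by (simp_all add: Diag_eq_herm herm_form_herm)
  qed
  have \<eta>_add: "\<eta> (v + w) = \<eta> v + \<eta> w" if "v \<in> vec_over 2" "w \<in> vec_over 2" for v w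
  proof -
    have "emb 2 0 (v + w) = emb 2 0 v + emb 2 0 w" by (simp add: emb_add)
    then have "emb 2 0 (\<eta> (v + w)) = emb 2 0 (\<eta> v + \<eta> w)"
      using jordan_aut_add[OF h emb3[OF H0 that(1)] emb3[OF H0 that(2)]] that
      by (simp add: \<eta>(1)[symmetric] vec_over_add emb_add[of 2 0 _ 0, simplified, symmetric])
    then show ?thesis using emb3_eq_iff[OF H0 _ H0] \<eta>(2) that by (metis vec_over_add)
  qed
  define p where "p i d = \<eta> (axis i d) $ i" for i d
  have ax: "axis i d \<in> vec_over 2" if "d \<in> div_alg 2" for i d using that by (simp add: vec_over_def axis_def)
  \<comment> \<open>Each component of \<open>\<eta> v\<close> keeps its norm, so the coordinate axes
    are preserved.\<close>
  have off: "\<eta> (axis i d) $ j = 0" if "d \<in> div_alg 2" "j \<noteq> i" for i j d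
    using inv(4-6)[OF ax[OF that(1), of i]] that(2) exhaust_3[of i] exhaust_3[of j] by (auto simp: axis_def)
  have p1: "inner (p i oct_one) (p i oct_one) = 1" for i
    using inv(4-6)[OF ax, of oct_one i] exhaust_3[of i] by (auto simp: axis_def p_def)
  have pD: "p i d \<in> div_alg 2" if "d \<in> div_alg 2" for i d
    unfolding p_def using \<eta>(2)[OF ax[OF that]] by (rule vec_over_nth)
  \<comment> \<open>The preserved product of components i and j, tested on the vector with entries 1
    and d, determines \<open>p j d\<close> from \<open>p i oct_one\<close>. The three pairs close up
    cyclically, so all components are multiplied by the same quaternion on the left.\<close>
  have step: "p j d = p i oct_one \<odot> d" if d: "d \<in> div_alg 2" and ij: "(i, j) \<in> {(3, 2), (1, 3), (2, 1)}" for i j d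
  proof -
    have "i \<noteq> j" using ij by auto
    let ?v = "axis i oct_one + axis j d"
    have v: "?v \<in> vec_over 2" using d by (intro vec_over_add ax) simp_all
    have e: "\<eta> ?v $ i = p i oct_one" "\<eta> ?v $ j = p j d"
      using \<eta>_add[OF ax ax[OF d], of oct_one i j] off[of oct_one j i] off[OF d, of i j] \<open>i \<noteq> j\<close> by (simp_all add: p_def)
    have "ocnj (\<eta> ?v $ i) \<odot> \<eta> ?v $ j = ocnj (?v$i) \<odot> ?v$j"
      using ij inv(1-3)[OF v] by auto
    then have "ocnj (p i oct_one) \<odot> p j d = d" unfolding e using \<open>i \<noteq> j\<close> by (simp add: axis_def)
    then show ?thesis using ocnj_cancel_left'[of "p i oct_one" "p j d"] p1 by simp
  qed
  have eq: "p 2 oct_one = p 3 oct_one" "p 3 oct_one = p 1 oct_one"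
    using step[of oct_one 3 2] step[of oct_one 1 3] by simp_all
  have all: "p i d = p 1 oct_one \<odot> d" if "d \<in> div_alg 2" for i d
    using step[OF that, of 3 2] step[OF that, of 1 3] step[OF that, of 2 1] eq exhaust_3[of i] by auto
  have "\<eta> v = left_mult (p 1 oct_one) v" if v: "v \<in> vec_over 2" for v
  proof -
    note D = vec_over_nth[OF v]
    have "v = axis 1 (v$1) + (axis 2 (v$2) + axis 3 (v$3))" by (simp add: vec_eq_iff forall_3 axis_def)
    then have "\<eta> v = \<eta> (axis 1 (v$1)) + (\<eta> (axis 2 (v$2)) + \<eta> (axis 3 (v$3)))"
      using D by (metis \<eta>_add ax vec_over_add)
    then show ?thesis
      using all[OF D, unfolded p_def] off[OF D]
      by (simp add: vec_eq_iff forall_3 left_mult_def p_def)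
  qed
  then show thesis using that[of "p 1 oct_one"] pD h_emb by simp
qed

lemmas act3_closed = act_closed[OF order_refl, unfolded Suc_2_eq_3]
lemmas act3_emb = act_emb[OF order_refl]

lemma eq_minus_self_imp_0:
  fixes w :: "'a::real_vector"
  assumes "w = - w" shows "w = 0"
proof -
  have "2 *\<^sub>R w = w + w" by (rule scaleR_2)
  also have "\<dots> = 0" using assms by (metis eq_neg_iff_add_eq_0)
  finally show ?thesis by simp
qed

lemma left_mult_row_mult:
  assumes "p \<in> div_alg 2" "v \<in> vec_over 2" "B \<in> mat_over 2"
  shows "row_mult (left_mult p v) B = left_mult p (row_mult v B)"
  using assms(1) assms(2)[THEN vec_over_nth] assms(3)[THEN mat_over_nth]
  by (simp add: vec_eq_iff row_mult_nth left_mult_def omult_add_right omult_assoc)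

text \<open>Sp(1) acts on v by left multiplication and SL(3, H) by right multiplication; these
  commute by associativity of the quaternions.\<close>

lemma act_in_centralizer:
  assumes AB: "(A, B) \<in> sl_pairs 2"
  shows "restrict (act 2 A B) (Herm 3) \<in> Sp1_centralizer"
proof -
  let ?g = "restrict (act 2 A B) (Herm 3)"
  have "?g \<in> GL_on (Herm 3)" using act_in_GL_on[OF order_refl AB] by simp
  moreover have "herm_det 3 (?g X) = herm_det 3 X" if "X \<in> Herm 3" for X
    using that act_det3[OF order_refl AB, of X] act3_closed(3)[OF AB that]
    by (simp add: herm_det_eq_det3)
  ultimately have E6: "?g \<in> E6" by (simp add: E6_def)
  have "compose (Herm 3) ?g h = compose (Herm 3) h ?g" if h: "h \<in> Sp1" for h
    unfolding compose_def
  proof (rule restrict_ext)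
    fix X assume X3: "X \<in> Herm 3"
    have hX: "h X \<in> Herm 3" using h X3 jordan_aut_in by (auto simp: Sp1_def)
    obtain S v where X: "X = emb 2 S v" "S \<in> Herm 2" "v \<in> vec_over 2" using X3 by (rule emb3_cases)
    obtain p where p: "p \<in> div_alg 2" "\<And>S v. S \<in> Herm 2 \<Longrightarrow> v \<in> vec_over 2 \<Longrightarrow> h (emb 2 S v) = emb 2 S (left_mult p v)"
      using Sp1_left_mult[OF h] by blast
    have "?g (h X) = emb 2 (congruence A S) (row_mult (left_mult p v) B)"
      using hX X p by (simp add: act3_emb left_mult_in)
    also have "\<dots> = emb 2 (congruence A S) (left_mult p (row_mult v B))"
      using left_mult_row_mult[OF p(1) X(3)] sl_pairsD(3)[OF AB] by simp
    also have "\<dots> = h (?g X)"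
      using X3 X p act3_closed(1,2)[OF AB] by (simp add: act3_emb)
    finally show "?g (h X) = h (?g X)" .
  qed
  then show ?thesis using E6 by (simp add: Sp1_centralizer_def)
qed

text \<open>The element -1 of Sp(1) has H_2 and its complement as eigenspaces, so g preserves both.
  On the complement g commutes with left multiplication by unit quaternions, hence is right
  multiplication by a matrix B. Invariance of \<open>det S - v S v\<^sup>*\<close> then leaves no
  choice on H_2: the Hermitian form of \<open>g S\<close> is that of \<open>A S A\<^sup>*\<close>
  with A inverse to B.\<close>

lemma centralizer_is_act:
  assumes g: "g \<in> Sp1_centralizer"
  obtains A B where "(A, B) \<in> sl_pairs 2" "g = restrict (act 2 A B) (Herm 3)"
proof -
  have gE: "g \<in> GL_on (Herm 3)" "\<And>X. X \<in> Herm 3 \<Longrightarrow> herm_det 3 (g X) = herm_det 3 X"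
    and comm: "\<And>h. h \<in> Sp1 \<Longrightarrow> compose (Herm 3) g h = compose (Herm 3) h g"
    using g by (auto simp: Sp1_centralizer_def E6_def)
  have ext: "g \<in> extensional (Herm 3)" and bij: "bij_betw g (Herm 3) (Herm 3)"
    and g_add: "\<And>X Y. X \<in> Herm 3 \<Longrightarrow> Y \<in> Herm 3 \<Longrightarrow> g (X + Y) = g X + g Y"
    and g_scale: "\<And>c X. X \<in> Herm 3 \<Longrightarrow> g (c *\<^sub>R X) = c *\<^sub>R g X"
    using gE(1) by (auto simp: GL_on_def Bij_def)
  have g_in: "g X \<in> Herm 3" if "X \<in> Herm 3" for X using bij that bij_betwE by blast
  have g_det: "det3 (g X) = det3 X" if "X \<in> Herm 3" for X
    using gE(2)[OF that] that g_in[OF that] by (simp add: herm_det_eq_det3)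
  have g_twist: "g (twist_mat p X) = twist_mat p (g X)"
    if "p \<in> div_alg 2" "norm p = 1" "X \<in> Herm 3" for p X
    using fun_cong[OF comm[OF twist_mat_in_Sp1[OF that(1,2)]], of X] that(3) g_in[OF that(3)]
    by (simp add: compose_def)
  have 0: "(0::octonion^3) \<in> vec_over 2" and H0: "(0::omat) \<in> Herm 2" by (simp_all add: vec_over_def Herm_intros)
  have H3: "S \<in> Herm 3" if "S \<in> Herm 2" for S using that Herm_mono[of 2 3] by simp
  have neg: "oct_of_real (- 1) \<in> div_alg 2" "norm (oct_of_real (- 1)) = 1" by simp_all
  have lm_neg: "left_mult (oct_of_real (- 1)) v = - v" for v by (simp add: left_mult_def vec_eq_iff)
  have g2: "g S \<in> Herm 2" if S: "S \<in> Herm 2" for S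
  proof -
    obtain T w where T: "g S = emb 2 T w" "T \<in> Herm 2" "w \<in> vec_over 2"
      using g_in[OF H3[OF S]] by (rule emb3_cases)
    have "twist_mat (oct_of_real (- 1)) S = S" using twist_mat_emb[OF neg(1) S 0] lm_neg[of 0] by simp
    then have "emb 2 T w = emb 2 T (- w)"
      using g_twist[OF neg H3[OF S]] T twist_mat_emb[OF neg(1) T(2,3)] by (simp add: lm_neg)
    moreover have "- w \<in> vec_over 2" using T(3) by (simp add: vec_over_def div_alg_minus)
    ultimately have "w = - w" using emb3_eq_iff[OF T(2,3) T(2)] by blast
    then have "w = 0" by (rule eq_minus_self_imp_0)
    then show ?thesis using T by simp
  qed
  define \<gamma> where "\<gamma> v = off_part 2 (g (emb 2 0 v))" for v
  have \<gamma>: "g (emb 2 0 v) = emb 2 0 (\<gamma> v)" "\<gamma> v \<in> vec_over 2" if v: "v \<in> vec_over 2" for v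
  proof -
    have E: "emb 2 0 v \<in> Herm 3" using emb3[OF H0 v] .
    obtain T w where T: "g (emb 2 0 v) = emb 2 T w" "T \<in> Herm 2" "w \<in> vec_over 2"
      using g_in[OF E] by (rule emb3_cases)
    have "twist_mat (oct_of_real (- 1)) (emb 2 0 v) = (- 1) *\<^sub>R emb 2 0 v"
      unfolding twist_mat_emb[OF neg(1) H0 v] lm_neg emb_scaleR by simp
    then have "emb 2 T (- w) = (- 1) *\<^sub>R emb 2 T w"
      using g_twist[OF neg E] g_scale[OF E, of "- 1"] twist_mat_emb[OF neg(1) T(2,3)] by (simp only: T lm_neg)
    then have "emb 2 T (- w) = emb 2 (- T) (- w)" by (simp add: emb_scaleR)
    moreover have "- w \<in> vec_over 2" using T(3) by (simp add: vec_over_def div_alg_minus)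
    ultimately have "T = - T" using emb3_eq_iff[of T "- w" "- T" "- w"] T(2) by (simp add: Herm_intros)
    then have "T = 0" by (rule eq_minus_self_imp_0)
    then have e: "g (emb 2 0 v) = emb 2 0 w" using T by simp
    then have "\<gamma> v = w" unfolding \<gamma>_def using off_part_emb[OF order_refl H0 T(3)] by simp
    then show "g (emb 2 0 v) = emb 2 0 (\<gamma> v)" "\<gamma> v \<in> vec_over 2" using e T(3) by simp_all
  qed
  have g_emb: "g (emb 2 S v) = emb 2 (g S) (\<gamma> v)" if "S \<in> Herm 2" "v \<in> vec_over 2" for S v
  proof -
    have "emb 2 S v = S + emb 2 0 v" using emb_add[of 2 S 0 0 v] by simp
    then have "g (emb 2 S v) = g S + emb 2 0 (\<gamma> v)"
      using g_add[OF H3[OF that(1)] emb3[OF H0 that(2)]] \<gamma>(1)[OF that(2)] by simp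
    then show ?thesis using emb_add[of 2 "g S" 0 0 "\<gamma> v"] by simp
  qed
  have \<gamma>_eqI: "\<gamma> v = w" if "v \<in> vec_over 2" "w \<in> vec_over 2" "g (emb 2 0 v) = emb 2 0 w" for v w
    using \<gamma>[OF that(1)] that emb3_eq_iff[OF H0 \<gamma>(2)[OF that(1)] H0 that(2)] by simp
  have \<gamma>_add: "\<gamma> (v + w) = \<gamma> v + \<gamma> w" if vw: "v \<in> vec_over 2" "w \<in> vec_over 2" for v w
  proof (rule \<gamma>_eqI)
    have "emb 2 0 (v + w) = emb 2 0 v + emb 2 0 w" by (simp add: emb_add)
    then have "g (emb 2 0 (v + w)) = emb 2 0 (\<gamma> v) + emb 2 0 (\<gamma> w)"
      using g_add[OF emb3[OF H0 vw(1)] emb3[OF H0 vw(2)]] \<gamma>(1) vw by simp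
    then show "g (emb 2 0 (v + w)) = emb 2 0 (\<gamma> v + \<gamma> w)" by (simp add: emb_add)
  qed (use vw \<gamma>(2) in \<open>simp_all add: vec_over_add\<close>)
  have \<gamma>_left: "\<gamma> (left_mult p v) = left_mult p (\<gamma> v)" if p: "p \<in> div_alg 2" and v: "v \<in> vec_over 2" for p v
  proof (rule \<gamma>_eqI)
    \<comment> \<open>Commutation is available for unit quaternions; a general p is its norm times
      such a q, with q = 1 as a harmless default at p = 0.\<close>
    define q where "q = (if p = 0 then oct_one else (1 / norm p) *\<^sub>R p)"
    have q: "q \<in> div_alg 2" "norm q = 1" using p by (simp_all add: q_def div_alg_scaleR)
    have pq: "p = norm p *\<^sub>R q" by (simp add: q_def)
    have s: "emb 2 0 (left_mult p w) = norm p *\<^sub>R twist_mat q (emb 2 0 w)" if "w \<in> vec_over 2" for w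
    proof -
      have "left_mult p w = norm p *\<^sub>R left_mult q w" by (subst pq) (simp add: left_mult_def vec_eq_iff)
      then show ?thesis unfolding twist_mat_emb[OF q(1) H0 that] emb_scaleR by simp
    qed
    have E: "emb 2 0 v \<in> Herm 3" using emb3[OF H0 v] .
    have "twist_mat q (emb 2 0 v) \<in> Herm 3"
      unfolding twist_mat_emb[OF q(1) H0 v] using emb3[OF H0 left_mult_in[OF q(1) v]] .
    then have "g (emb 2 0 (left_mult p v)) = norm p *\<^sub>R twist_mat q (emb 2 0 (\<gamma> v))"
      unfolding s[OF v] by (simp add: g_scale g_twist[OF q E] \<gamma>(1)[OF v])
    then show "g (emb 2 0 (left_mult p v)) = emb 2 0 (left_mult p (\<gamma> v))" unfolding s[OF \<gamma>(2)[OF v]] .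
  qed (use p v \<gamma>(2) in \<open>simp_all add: left_mult_in\<close>)
  have ax: "axis i d \<in> vec_over 2" if "d \<in> div_alg 2" for i d using that by (simp add: vec_over_def axis_def)
  have ax1: "axis i oct_one \<in> vec_over 2" for i by (rule ax) simp
  define B where "B = (\<chi> i. \<gamma> (axis i oct_one))"
  have B: "B \<in> mat_over 2"
    using \<gamma>(2)[OF ax1, THEN vec_over_nth] by (simp add: B_def mat_over_def)
  have \<gamma>_B: "\<gamma> v = row_mult v B" if v: "v \<in> vec_over 2" for v
  proof -
    note D = vec_over_nth[OF v]
    have a: "axis i d = left_mult d (axis i oct_one)" for i d
      by (simp add: left_mult_def vec_eq_iff axis_def)
    have "axis 1 (v$1) + (axis 2 (v$2) + axis 3 (v$3)) = v" by (simp add: vec_eq_iff forall_3 axis_def)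
    then have "\<gamma> v = \<gamma> (axis 1 (v$1) + (axis 2 (v$2) + axis 3 (v$3)))" by (rule arg_cong[OF sym])
    also have "\<dots> = \<gamma> (axis 1 (v$1)) + (\<gamma> (axis 2 (v$2)) + \<gamma> (axis 3 (v$3)))"
      using D by (simp add: \<gamma>_add ax vec_over_add)
    also have "\<dots> = left_mult (v$1) (B$1) + (left_mult (v$2) (B$2) + left_mult (v$3) (B$3))"
      unfolding a[of 1 "v$1"] a[of 2 "v$2"] a[of 3 "v$3"] \<gamma>_left[OF D ax1] by (simp add: B_def)
    also have "\<dots> = row_mult v B" by (simp add: vec_eq_iff row_mult_nth left_mult_def)
    finally show ?thesis .
  qed
  have surj: "\<exists>v\<in>vec_over 2. \<gamma> v = w" if w: "w \<in> vec_over 2" for w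
  proof -
    obtain X where X: "X \<in> Herm 3" "g X = emb 2 0 w"
      using bij_betw_imp_surj_on[OF bij] emb3[OF H0 w] by (metis imageE)
    obtain S v where Sv: "X = emb 2 S v" "S \<in> Herm 2" "v \<in> vec_over 2" using X(1) by (rule emb3_cases)
    have "emb 2 (g S) (\<gamma> v) = emb 2 0 w" using X(2) g_emb[OF Sv(2,3)] Sv(1) by simp
    then have "\<gamma> v = w" using emb3_eq_iff[OF g2[OF Sv(2)] \<gamma>(2)[OF Sv(3)] H0 w] by blast
    then show ?thesis using Sv(3) by blast
  qed
  have inj: "v = w" if vw: "v \<in> vec_over 2" "w \<in> vec_over 2" "\<gamma> v = \<gamma> w" for v w
  proof -
    have "g (emb 2 0 v) = g (emb 2 0 w)" using \<gamma>(1) vw by simp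
    then have "emb 2 0 v = emb 2 0 w"
      using inj_onD[OF bij_betw_imp_inj_on[OF bij] _ emb3[OF H0 vw(1)] emb3[OF H0 vw(2)]] by blast
    then show ?thesis using emb3_eq_iff[OF H0 vw(1) H0 vw(2)] by blast
  qed
  have "\<exists>c. c \<in> vec_over 2 \<and> \<gamma> c = axis i oct_one" for i using surj[OF ax1[of i]] by blast
  then obtain c where c: "\<And>i. c i \<in> vec_over 2" "\<And>i. \<gamma> (c i) = axis i oct_one" by metis
  \<comment> \<open>Row i of A is the preimage of the i-th basis vector, which yields A B =
    1.\<close>
  define A where "A = (\<chi> i. c i)"
  have A: "A \<in> mat_over 2" using c(1)[THEN vec_over_nth] by (simp add: A_def mat_over_def)
  have row: "(X \<odot>\<odot> Y) $ i = row_mult (X$i) Y" for X Y :: omat and i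
    by (simp add: vec_eq_iff mmult_nth row_mult_nth)
  have one: "omat_one $ i = axis i oct_one" for i
    using exhaust_3[of i] by (auto simp: vec_eq_iff forall_3 axis_def Diag_nth)
  have rowD: "X $ i \<in> vec_over 2" if "X \<in> mat_over 2" for X i using that by (simp add: vec_over_def mat_over_def)
  have AB: "A \<odot>\<odot> B = omat_one"
  proof -
    have "(A \<odot>\<odot> B) $ i = omat_one $ i" for i
      unfolding row one using \<gamma>_B[OF c(1), of i] c(2)[of i] by (simp add: A_def)
    then show ?thesis by (simp add: vec_eq_iff)
  qed
  \<comment> \<open>Injectivity of \<open>\<gamma>\<close> makes the inverse two-sided:
    corresponding rows of B A and of the unit matrix have the same image.\<close>
  have BA: "B \<odot>\<odot> A = omat_one"
  proof -
    have "(B \<odot>\<odot> A) $ i = omat_one $ i" for i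
    proof (rule inj)
      have "\<gamma> ((B \<odot>\<odot> A) $ i) = ((B \<odot>\<odot> A) \<odot>\<odot> B) $ i"
        unfolding row[of "B \<odot>\<odot> A"] using A B by (intro \<gamma>_B rowD mat_over_mult)
      also have "\<dots> = B $ i" using mmult_assoc[OF B A B] AB by simp
      also have "\<dots> = \<gamma> (omat_one $ i)" unfolding one by (simp add: B_def)
      finally show "\<gamma> ((B \<odot>\<odot> A) $ i) = \<gamma> (omat_one $ i)" .
    qed (use A B in \<open>simp_all add: rowD mat_over_mult mat_over_Diag\<close>)
    then show ?thesis by (simp add: vec_eq_iff)
  qed
  have det_g: "det3 (g S) = det3 S" if "S \<in> Herm 2" for S using g_det[OF H3[OF that]] .
  have gS: "g S = congruence A S" if S: "S \<in> Herm 2" for S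
  proof (rule herm_form_eq_imp_eq)
    show "g S \<in> Herm 2" using g2[OF S] .
    show "congruence A S \<in> Herm 2" using congruence_in_Herm[OF order_refl A S] .
    fix w assume "w \<in> vec_over 2"
    then obtain v where v: "v \<in> vec_over 2" "\<gamma> v = w" using surj by blast
    have "det3 (g (emb 2 S v)) = det3 (emb 2 S v)" using g_det[OF emb3[OF S v(1)]] .
    then have "herm_form (g S) w = herm_form S v"
      unfolding g_emb[OF S v(1)] v(2) det3_emb[OF order_refl S v(1)]
        det3_emb[OF order_refl g2[OF S] \<open>w \<in> vec_over 2\<close>] det_g[OF S] by simp
    then show "herm_form (g S) w = herm_form (congruence A S) w"
      using herm_form_congruence[OF order_refl A B BA S v(1)] \<gamma>_B[OF v(1)] v(2) by simp
  qed
  have "det3 (congruence A S) = det3 S" if "S \<in> Herm 2" for S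
    using gS[OF that] det_g[OF that] by simp
  then have "(A, B) \<in> sl_pairs 2"
    by (intro sl_pairsI) (simp_all add: A B AB BA)
  moreover have "g = restrict (act 2 A B) (Herm 3)"
  proof (rule extensionalityI[OF ext restrict_extensional])
    fix X assume X3: "X \<in> Herm 3"
    obtain S v where X: "X = emb 2 S v" "S \<in> Herm 2" "v \<in> vec_over 2" using X3 by (rule emb3_cases)
    show "g X = restrict (act 2 A B) (Herm 3) X"
      using X3 by (simp add: X(1) g_emb[OF X(2,3)] act3_emb[OF X(2,3)] gS[OF X(2)] \<gamma>_B[OF X(3)])
  qed
  ultimately show thesis by (rule that)
qed

lemma Sp1_centralizer_eq:
  "Sp1_centralizer = {restrict (act 2 A B) (Herm 3) | A B. (A, B) \<in> sl_pairs 2}"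
proof (intro equalityI subsetI)
  fix g assume "g \<in> Sp1_centralizer"
  then show "g \<in> {restrict (act 2 A B) (Herm 3) | A B. (A, B) \<in> sl_pairs 2}"
    using centralizer_is_act[of g] by blast
qed (use act_in_centralizer in blast)

subsection \<open>Connectedness of \<open>SL(3, \<H>)\<close>\<close>

lemma continuous_on_mmult:
  assumes "continuous_on S f" "continuous_on S g" shows "continuous_on S (\<lambda>x. f x \<odot>\<odot> g x)"
  unfolding mmult_def
  by (intro continuous_on_vec_lambda continuous_on_sum continuous_on_omult continuous_on_component assms)

definition sl_component :: "(omat \<times> omat) set" where
  "sl_component = connected_component_set (sl_pairs 2) (omat_one, omat_one)"

lemma sl_component_subset: "sl_component \<subseteq> sl_pairs 2"
  unfolding sl_component_def by (rule connected_component_subset)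

lemma sl_componentI:
  assumes "connected T" "T \<subseteq> sl_pairs 2" "P \<in> T" "P \<in> sl_component" "Q \<in> T" shows "Q \<in> sl_component"
proof -
  have "connected_component (sl_pairs 2) P Q" unfolding connected_component_def using assms by blast
  with assms(4) show ?thesis unfolding sl_component_def mem_Collect_eq by (rule connected_component_trans)
qed

lemma one_in_component: "(omat_one, omat_one) \<in> sl_component"
  unfolding sl_component_def using sl_pairs_one[OF order_refl] by (simp add: connected_component_refl)

lemma connected_sl_component: "connected sl_component"
  unfolding sl_component_def by (rule connected_connected_component)

text \<open>Translation by (A, B) maps the component onto a connected set through (A, B), which
  therefore stays inside the component.\<close>

lemma sl_component_mult:
  assumes "(A, B) \<in> sl_component" "(A', B') \<in> sl_component"
  shows "(A \<odot>\<odot> A', B' \<odot>\<odot> B) \<in> sl_component"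
proof -
  let ?f = "\<lambda>P. (A \<odot>\<odot> fst P, snd P \<odot>\<odot> B)"
  have "continuous_on sl_component ?f"
    by (intro continuous_on_Pair continuous_on_mmult continuous_on_const continuous_on_fst
        continuous_on_snd continuous_on_id)
  then have conn: "connected (?f ` sl_component)"
    using connected_sl_component by (rule connected_continuous_image)
  have sub: "?f ` sl_component \<subseteq> sl_pairs 2"
  proof (intro image_subsetI)
    fix P assume P: "P \<in> sl_component"
    have "(fst P, snd P) \<in> sl_pairs 2" using subsetD[OF sl_component_subset P] by simp
    then show "(A \<odot>\<odot> fst P, snd P \<odot>\<odot> B) \<in> sl_pairs 2"
      by (rule sl_pairs_mult[OF order_refl subsetD[OF sl_component_subset assms(1)]])
  qed
  have "(A, B) \<in> ?f ` sl_component"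
    by (rule image_eqI[OF _ one_in_component]) simp
  moreover have "(A \<odot>\<odot> A', B' \<odot>\<odot> B) \<in> ?f ` sl_component"
    by (rule image_eqI[OF _ assms(2)]) simp
  ultimately show ?thesis using sl_componentI[OF conn sub _ assms(1)] by simp
qed

lemma continuous_on_transvection:
  assumes "continuous_on S f" shows "continuous_on S (\<lambda>x. transvection i j (f x))"
proof -
  have "continuous_on S (\<lambda>x. if p = q then oct_one else if p = i \<and> q = j then f x else 0)" for p q
  proof (cases "p \<noteq> q \<and> p = i \<and> q = j")
    case True
    then have pq: "p \<noteq> q" "p = i \<and> q = j" by auto
    have "(\<lambda>x. if p = q then oct_one else if p = i \<and> q = j then f x else 0) = f"
      by (intro ext) (simp only: if_not_P[OF pq(1)] if_P[OF pq(2)])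
    then show ?thesis using assms by (simp only:)
  next
    case False
    then have "(\<lambda>x. if p = q then oct_one else if p = i \<and> q = j then f x else 0) = (\<lambda>x. if p = q then oct_one else 0)"
      by (intro ext) auto
    then show ?thesis by (simp only: continuous_on_const)
  qed
  then show ?thesis unfolding transvection_def by (intro continuous_on_vec_lambda)
qed

text \<open>The path s t for s in [0, 1] joins the transvection to the identity.\<close>

lemma transvection_in_component:
  assumes "i \<noteq> j" "t \<in> div_alg 2" shows "(transvection i j t, transvection i j (- t)) \<in> sl_component"
proof (rule sl_componentI[OF _ _ _ one_in_component])
  let ?f = "\<lambda>s. (transvection i j (s *\<^sub>R t), transvection i j (- (s *\<^sub>R t)))"
  have "continuous_on {0..1} (\<lambda>s. s *\<^sub>R t)"
    by (intro continuous_on_scaleR continuous_on_id continuous_on_const)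
  then have "continuous_on {0..1} ?f"
    by (intro continuous_on_Pair continuous_on_transvection continuous_on_minus)
  then show "connected (?f ` {0..1})"
    using connected_Icc by (rule connected_continuous_image)
  show "?f ` {0..1} \<subseteq> sl_pairs 2"
    using transvection_in_sl_pairs[OF assms(1)] assms(2) by (simp add: image_subset_iff div_alg_scaleR)
  show "(omat_one, omat_one) \<in> ?f ` {0..1}" by (rule image_eqI[of _ _ 0]) (simp_all add: transvection_0)
  show "(transvection i j t, transvection i j (- t)) \<in> ?f ` {0..1}" by (rule image_eqI[of _ _ 1]) simp_all
qed

section \<open>Diagonal matrices in the identity component\<close>

definition oct_inv :: "octonion \<Rightarrow> octonion" where
  "oct_inv p = (1 / inner p p) *\<^sub>R ocnj p"

lemma oct_inv_mult: "p \<noteq> 0 \<Longrightarrow> p \<odot> oct_inv p = oct_one" "p \<noteq> 0 \<Longrightarrow> oct_inv p \<odot> p = oct_one"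
  by (simp_all add: oct_inv_def omult_ocnj_self ocnj_omult_self oct_of_real_scaleR)

lemma oct_one_neq_0: "oct_one \<noteq> 0"
  using oct_of_real_eq_iff[of 1 0] unfolding oct_of_real_0 by simp

lemma oct_inv_in: "p \<in> div_alg m \<Longrightarrow> oct_inv p \<in> div_alg m"
  by (simp add: oct_inv_def div_alg_intros)

lemma diag_mat_altdef:
  "diag_mat p q r = (\<chi> i j. if i = j then if i = 1 then p else if i = 2 then q else r else 0)"
  by (simp add: omat_eq_iff)

lemma continuous_on_diag_mat:
  assumes "continuous_on S f" "continuous_on S g" "continuous_on S h"
  shows "continuous_on S (\<lambda>x. diag_mat (f x) (g x) (h x))"
proof -
  have "continuous_on S (\<lambda>x. if i = j then if i = 1 then f x else if i = 2 then g x else h x else 0)" for i j :: 3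
    using assms by (cases "i = j"; cases "i = 1"; cases "i = 2") (simp_all add: continuous_on_const)
  then show ?thesis unfolding diag_mat_altdef by (intro continuous_on_vec_lambda)
qed

text \<open>Triples of nonzero quaternions form a connected set, being a product of punctured
  four-dimensional spaces; normalising the last entry maps them onto the diagonal matrices in
  question.\<close>

lemma diag_mat_in_component:
  assumes pqr: "p \<in> div_alg 2" "q \<in> div_alg 2" "r \<in> div_alg 2" and n: "norm p * norm q * norm r = 1"
  shows "(diag_mat p q r, diag_mat (oct_inv p) (oct_inv q) (oct_inv r)) \<in> sl_component"
proof -
  define N where "N = div_alg 2 - {0}"
  have "connected (- {0::quaternion})"
    by (rule connected_punctured_universe) simp
  moreover have "linear oct_of_quat" by (rule linearI) (simp_all add: oct_of_quat_def)
  then have "continuous_on (- {0}) oct_of_quat" by (rule linear_continuous_on[OF linear_conv_bounded_linear[THEN iffD1]])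
  ultimately have "connected (oct_of_quat ` (- {0}))" by (rule connected_continuous_image[rotated])
  moreover have "oct_of_quat ` (- {0}) = N"
  proof -
    have z: "oct_of_quat q = 0 \<longleftrightarrow> q = 0" for q by (simp add: oct_of_quat_def prod_eq_iff)
    have "div_alg 2 = range oct_of_quat" by (simp add: div_alg_def)
    then have N: "N = range oct_of_quat - {0}" by (simp only: N_def)
    show ?thesis
    proof (intro equalityI subsetI)
      fix y assume "y \<in> oct_of_quat ` (- {0})"
      then obtain q where q: "q \<noteq> 0" "y = oct_of_quat q" by (elim imageE) simp
      then show "y \<in> N" unfolding N using z[of q] by simp
    next
      fix y assume "y \<in> N"
      then obtain q where q: "y = oct_of_quat q" "y \<noteq> 0" unfolding N by (elim DiffE imageE) simp
      then have "q \<in> - {0}" using z[of q] by simp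
      with q(1) show "y \<in> oct_of_quat ` (- {0})" by (rule image_eqI)
    qed
  qed
  ultimately have "connected N" by simp
  then have conn: "connected (N \<times> N \<times> N)" by (intro connected_Times)
  \<comment> \<open>Rescaled so that the product of the three norms is 1; a triple with this
    property is left unchanged.\<close>
  define last where "last P = (1 / (norm (fst P) * norm (fst (snd P)) * norm (snd (snd P)))) *\<^sub>R snd (snd P)"
    for P :: "octonion \<times> octonion \<times> octonion"
  define F where "F P = (diag_mat (fst P) (fst (snd P)) (last P),
      diag_mat (oct_inv (fst P)) (oct_inv (fst (snd P))) (oct_inv (last P)))" for P
  have nz: "fst P \<noteq> 0" "fst (snd P) \<noteq> 0" "last P \<noteq> 0" "fst P \<in> div_alg 2" "fst (snd P) \<in> div_alg 2"
    "last P \<in> div_alg 2" "norm (fst P) * norm (fst (snd P)) * norm (last P) = 1" if "P \<in> N \<times> N \<times> N" for P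
    using that unfolding mem_Times_iff N_def Diff_iff singleton_iff last_def
    by (simp_all add: div_alg_scaleR)
  have last: "continuous_on (N \<times> N \<times> N) last"
    unfolding last_def
    by (intro continuous_on_scaleR continuous_on_divide continuous_on_mult continuous_on_norm continuous_on_const
        continuous_on_fst continuous_on_snd continuous_on_id) (use nz(1,2) in \<open>simp add: mem_Times_iff N_def\<close>)
  have inv: "continuous_on (N \<times> N \<times> N) (\<lambda>P. oct_inv (f P))"
    if "continuous_on (N \<times> N \<times> N) f" "\<And>P. P \<in> N \<times> N \<times> N \<Longrightarrow> f P \<noteq> 0" for f
    unfolding oct_inv_def using that
    by (intro continuous_on_scaleR continuous_on_divide continuous_on_const continuous_on_inner continuous_on_oct
        ballI) simp_all
  have "continuous_on (N \<times> N \<times> N) F"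
    unfolding F_def using nz
    by (intro continuous_on_Pair continuous_on_diag_mat inv last continuous_on_fst continuous_on_snd continuous_on_id)
  then have C: "connected (F ` (N \<times> N \<times> N))" using conn by (rule connected_continuous_image)
  have S: "F ` (N \<times> N \<times> N) \<subseteq> sl_pairs 2"
  proof (intro image_subsetI)
    fix P assume P: "P \<in> N \<times> N \<times> N"
    note nz = nz[OF P]
    have "inner (fst P) (fst P) * inner (fst (snd P)) (fst (snd P)) * inner (last P) (last P)
        = (norm (fst P) * norm (fst (snd P)) * norm (last P))\<^sup>2"
      by (simp add: power_mult_distrib dot_square_norm)
    then show "F P \<in> sl_pairs 2"
      unfolding F_def using nz by (intro diag_mat_in_sl_pairs) (simp_all add: oct_inv_mult oct_inv_in)
  qed
  have "F (oct_one, oct_one, oct_one) = (omat_one, omat_one)"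
    by (simp add: F_def last_def oct_inv_def diag_mat_of_real)
  moreover have "(oct_one, oct_one, oct_one) \<in> N \<times> N \<times> N"
    using oct_of_real_eq_iff[of 1 0] unfolding N_def oct_of_real_0 by simp
  ultimately have 1: "(omat_one, omat_one) \<in> F ` (N \<times> N \<times> N)" by (metis image_eqI)
  have "p \<noteq> 0" "q \<noteq> 0" "r \<noteq> 0" using n by auto
  then have "(p, q, r) \<in> N \<times> N \<times> N" using pqr by (simp add: N_def)
  moreover have "F (p, q, r) = (diag_mat p q r, diag_mat (oct_inv p) (oct_inv q) (oct_inv r))"
    using n by (simp add: F_def last_def)
  ultimately have "(diag_mat p q r, diag_mat (oct_inv p) (oct_inv q) (oct_inv r)) \<in> F ` (N \<times> N \<times> N)"
    by (metis image_eqI)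
  then show ?thesis using sl_componentI[OF C S 1 one_in_component] by blast
qed

section \<open>Gaussian elimination over the quaternions\<close>

lemma transvection_left_nth:
  "i \<noteq> j \<Longrightarrow> (transvection i j t \<odot>\<odot> A) $ p $ q = A$p$q + (if p = i then t \<odot> A$j$q else 0)"
  using exhaust_3[of i] exhaust_3[of j] exhaust_3[of p] by (auto simp: mmult_nth transvection_def)

lemma transvection_right_nth:
  "i \<noteq> j \<Longrightarrow> (A \<odot>\<odot> transvection i j t) $ p $ q = A$p$q + (if q = j then A$p$i \<odot> t else 0)"
  using exhaust_3[of i] exhaust_3[of j] exhaust_3[of q] by (auto simp: mmult_nth transvection_def)

text \<open>Quantified over B so that it speaks about A alone and can be carried along row and
  column operations.\<close>

definition sl_good :: "omat \<Rightarrow> bool" where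
  "sl_good A \<longleftrightarrow> (\<forall>B. (A, B) \<in> sl_pairs 2 \<longrightarrow> (A, B) \<in> sl_component)"

lemma sl_good_left:
  assumes "i \<noteq> j" "t \<in> div_alg 2" "sl_good (transvection i j t \<odot>\<odot> A)" shows "sl_good A"
  unfolding sl_good_def
proof (intro allI impI)
  fix B assume AB: "(A, B) \<in> sl_pairs 2"
  let ?E = "transvection i j t" and ?E' = "transvection i j (- t)"
  have E: "(?E, ?E') \<in> sl_pairs 2" using transvection_in_sl_pairs[OF assms(1,2)] .
  have E': "(?E', ?E) \<in> sl_component"
    using transvection_in_component[OF assms(1) div_alg_minus[OF assms(2)]] by simp
  have "(?E \<odot>\<odot> A, B \<odot>\<odot> ?E') \<in> sl_component"
    using sl_pairs_mult[OF order_refl E AB] assms(3) by (simp add: sl_good_def)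
  then have "(?E' \<odot>\<odot> (?E \<odot>\<odot> A), (B \<odot>\<odot> ?E') \<odot>\<odot> ?E) \<in> sl_component" by (rule sl_component_mult[OF E'])
  then show "(A, B) \<in> sl_component"
    using sl_pairsD[OF AB] sl_pairsD[OF E] by (simp add: mmult_assoc) (simp flip: mmult_assoc)
qed

lemma sl_good_right:
  assumes "i \<noteq> j" "t \<in> div_alg 2" "sl_good (A \<odot>\<odot> transvection i j t)" shows "sl_good A"
  unfolding sl_good_def
proof (intro allI impI)
  fix B assume AB: "(A, B) \<in> sl_pairs 2"
  let ?E = "transvection i j t" and ?E' = "transvection i j (- t)"
  have E: "(?E, ?E') \<in> sl_pairs 2" using transvection_in_sl_pairs[OF assms(1,2)] .
  have E': "(?E', ?E) \<in> sl_component"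
    using transvection_in_component[OF assms(1) div_alg_minus[OF assms(2)]] by simp
  have "(A \<odot>\<odot> ?E, ?E' \<odot>\<odot> B) \<in> sl_component"
    using sl_pairs_mult[OF order_refl AB E] assms(3) by (simp add: sl_good_def)
  then have "((A \<odot>\<odot> ?E) \<odot>\<odot> ?E', ?E \<odot>\<odot> (?E' \<odot>\<odot> B)) \<in> sl_component" using E' by (rule sl_component_mult)
  then show "(A, B) \<in> sl_component"
    using sl_pairsD[OF AB] sl_pairsD[OF E] by (simp add: mmult_assoc) (simp flip: mmult_assoc)
qed

text \<open>Gaussian elimination: \<open>sl_good\<close> is checked on diagonal matrices and pulled back along the row and
  column operations.\<close>

lemma sl_good_diagonal:
  assumes "A$1$2 = 0" "A$1$3 = 0" "A$2$1 = 0" "A$2$3 = 0" "A$3$1 = 0" "A$3$2 = 0"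
  shows "sl_good A"
  unfolding sl_good_def
proof (intro allI impI)
  fix B assume AB: "(A, B) \<in> sl_pairs 2"
  note d = sl_pairsD[OF AB]
  define p q r where "p = A$1$1" and "q = A$2$2" and "r = A$3$3"
  have A: "A = diag_mat p q r" using assms by (simp add: omat_eq_iff p_def q_def r_def)
  have D: "p \<in> div_alg 2" "q \<in> div_alg 2" "r \<in> div_alg 2"
    using d(2) by (simp_all add: mat_over_def p_def q_def r_def)
  \<comment> \<open>Invariance of det, evaluated at the unit matrix.\<close>
  have "inner p p * inner q q * inner r r = 1"
    using sl_pairs_det3[OF order_refl AB Diag_in_Herm[of 1 1 1]]
      det3_congruence_diag_mat[OF D Diag_in_Herm[of 1 1 1]] by (simp add: A det3_Diag)
  then have "(norm p * norm q * norm r)\<^sup>2 = 1" by (simp add: power_mult_distrib dot_square_norm)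
  moreover have "0 \<le> norm p * norm q * norm r" by simp
  ultimately have n: "norm p * norm q * norm r = 1" by (metis abs_of_nonneg power2_eq_1_iff abs_1 abs_minus_cancel)
  then have nz: "p \<noteq> 0" "q \<noteq> 0" "r \<noteq> 0" by auto
  let ?B = "diag_mat (oct_inv p) (oct_inv q) (oct_inv r)"
  have c: "(A, ?B) \<in> sl_component" unfolding A by (rule diag_mat_in_component[OF D n])
  have "?B \<in> mat_over 2" using D by (intro diag_mat_over oct_inv_in)
  then have "(B \<odot>\<odot> A) \<odot>\<odot> ?B = B \<odot>\<odot> (A \<odot>\<odot> ?B)" using d by (intro mmult_assoc)
  then have "?B = B"
    using d(5) nz by (simp add: A diag_mat_mult oct_inv_mult diag_mat_of_real)
  then show "(A, B) \<in> sl_component" using c by simp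
qed

text \<open>The pivot at (2,2) removes the entries (3,2) and (2,3), the only ones left off the
  diagonal.\<close>

lemma sl_good_block:
  assumes "A \<in> mat_over 2" "A$1$2 = 0" "A$1$3 = 0" "A$2$1 = 0" "A$3$1 = 0" "A$2$2 \<noteq> 0"
  shows "sl_good A"
proof (rule sl_good_left[of 3 2 "- (A$3$2 \<odot> oct_inv (A$2$2))"])
  note D = mat_over_nth[OF assms(1)]
  show t: "- (A$3$2 \<odot> oct_inv (A$2$2)) \<in> div_alg 2" by (intro div_alg_intros oct_inv_in D)
  have c: "(A$3$2 \<odot> oct_inv (A$2$2)) \<odot> A$2$2 = A$3$2"
    using assms(6) by (simp add: omult_assoc D oct_inv_in oct_inv_mult)
  let ?A = "transvection 3 2 (- (A$3$2 \<odot> oct_inv (A$2$2))) \<odot>\<odot> A"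
  show "sl_good ?A"
  proof (rule sl_good_right[of 2 3 "- (oct_inv (A$2$2) \<odot> A$2$3)"])
    show "- (oct_inv (A$2$2) \<odot> A$2$3) \<in> div_alg 2" by (intro div_alg_intros oct_inv_in D)
    have "A$2$2 \<odot> (oct_inv (A$2$2) \<odot> A$2$3) = A$2$3"
      using assms(6) by (simp add: omult_assoc[symmetric] D oct_inv_in oct_inv_mult)
    then show "sl_good (?A \<odot>\<odot> transvection 2 3 (- (oct_inv (A$2$2) \<odot> A$2$3)))"
      using assms c by (intro sl_good_diagonal)
        (simp_all add: transvection_left_nth transvection_right_nth omult_minus_left omult_minus_right)
  qed simp
qed simp

text \<open>The pivot at (1,1) clears the first row and column. If the entry (2,2) then vanishes,
  invertibility makes (3,2) nonzero, and adding the third row to the second restores a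
  pivot.\<close>

lemma sl_good_corner:
  assumes "(A, B) \<in> sl_pairs 2" "A$1$1 \<noteq> 0" shows "sl_good A"
proof -
  have step: "sl_good A" if AB: "(A, B) \<in> sl_pairs 2" and z: "A$1$2 = 0" "A$1$3 = 0" "A$2$1 = 0" "A$3$1 = 0" for A B
  proof (cases "A$2$2 = 0")
    case True
    have "(B \<odot>\<odot> A) $ 2 $ 2 = oct_one" using sl_pairsD(5)[OF AB] by (simp add: Diag_nth)
    then have "B$2$3 \<odot> A$3$2 = oct_one" using True z by (simp add: mmult_nth)
    then have "A$3$2 \<noteq> 0" using oct_one_neq_0 by (metis omult_zero_right)
    moreover have "transvection 2 3 oct_one \<odot>\<odot> A \<in> mat_over 2"
      by (intro mat_over_mult transvection_over sl_pairsD(2)[OF AB]) simp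
    ultimately have "sl_good (transvection 2 3 oct_one \<odot>\<odot> A)"
      using z True by (intro sl_good_block) (simp_all add: transvection_left_nth)
    then show ?thesis by (rule sl_good_left[rotated 2]) simp_all
  next
    case False
    then show ?thesis using z sl_pairsD(2)[OF AB] by (intro sl_good_block)
  qed
  note D = mat_over_nth[OF sl_pairsD(2)[OF assms(1)]]
  let ?i = "oct_inv (A$1$1)"
  define t2 t3 s2 s3 where "t2 = - (A$2$1 \<odot> ?i)" and "t3 = - (A$3$1 \<odot> ?i)"
    and "s2 = - (?i \<odot> A$1$2)" and "s3 = - (?i \<odot> A$1$3)"
  have ts: "t2 \<in> div_alg 2" "t3 \<in> div_alg 2" "s2 \<in> div_alg 2" "s3 \<in> div_alg 2"
    unfolding t2_def t3_def s2_def s3_def by (intro div_alg_intros oct_inv_in D)+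
  have c: "t2 \<odot> A$1$1 = - A$2$1" "t3 \<odot> A$1$1 = - A$3$1" "A$1$1 \<odot> s2 = - A$1$2" "A$1$1 \<odot> s3 = - A$1$3"
    using assms(2) unfolding t2_def t3_def s2_def s3_def
    by (simp_all add: omult_minus_left omult_minus_right omult_assoc D oct_inv_in oct_inv_mult)
      (simp_all add: omult_assoc[symmetric] D oct_inv_in oct_inv_mult)
  define A1 where "A1 = transvection 2 1 t2 \<odot>\<odot> A"
  define A2 where "A2 = transvection 3 1 t3 \<odot>\<odot> A1"
  define A3 where "A3 = A2 \<odot>\<odot> transvection 1 2 s2"
  define A4 where "A4 = A3 \<odot>\<odot> transvection 1 3 s3"
  have "(A1, B \<odot>\<odot> transvection 2 1 (- t2)) \<in> sl_pairs 2"
    unfolding A1_def by (rule sl_pairs_mult[OF order_refl transvection_in_sl_pairs[OF _ ts(1)] assms(1)]) simp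
  then obtain B1 where "(A1, B1) \<in> sl_pairs 2" ..
  then have "(A2, B1 \<odot>\<odot> transvection 3 1 (- t3)) \<in> sl_pairs 2"
    unfolding A2_def by (rule sl_pairs_mult[OF order_refl transvection_in_sl_pairs[OF _ ts(2)], rotated]) simp
  then obtain B2 where "(A2, B2) \<in> sl_pairs 2" ..
  then have "(A3, transvection 1 2 (- s2) \<odot>\<odot> B2) \<in> sl_pairs 2"
    unfolding A3_def by (rule sl_pairs_mult[OF order_refl _ transvection_in_sl_pairs[OF _ ts(3)]]) simp
  then obtain B3 where "(A3, B3) \<in> sl_pairs 2" ..
  then have "(A4, transvection 1 3 (- s3) \<odot>\<odot> B3) \<in> sl_pairs 2"
    unfolding A4_def by (rule sl_pairs_mult[OF order_refl _ transvection_in_sl_pairs[OF _ ts(4)]]) simp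
  moreover have "A4$1$2 = 0" "A4$1$3 = 0" "A4$2$1 = 0" "A4$3$1 = 0"
    by (simp_all add: A4_def A3_def A2_def A1_def transvection_left_nth transvection_right_nth c)
  ultimately have "sl_good A4" by (intro step)
  then have "sl_good A3" unfolding A4_def by (rule sl_good_right[rotated 2]) (use ts in simp_all)
  then have "sl_good A2" unfolding A3_def by (rule sl_good_right[rotated 2]) (use ts in simp_all)
  then have "sl_good A1" unfolding A2_def by (rule sl_good_left[rotated 2]) (use ts in simp_all)
  then show ?thesis unfolding A1_def by (rule sl_good_left[rotated 2]) (use ts in simp_all)
qed

lemma one_neq_2: "(1::3) \<noteq> 2" and one_neq_3: "(1::3) \<noteq> 3"
  by simp_all

text \<open>If the corner vanishes, the first column of an invertible matrix still has a nonzero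
  entry, and adding its row to the first creates a pivot. Hence the component of the identity is
  everything.\<close>

lemma sl_pairs_connected: "connected (sl_pairs 2)"
proof -
  have "sl_good A" if AB: "(A, B) \<in> sl_pairs 2" for A B
  proof (cases "A$1$1 = 0")
    case True
    have "(B \<odot>\<odot> A) $ 1 $ 1 = oct_one" using sl_pairsD(5)[OF AB] by (simp add: Diag_nth)
    then have "B$1$2 \<odot> A$2$1 + B$1$3 \<odot> A$3$1 = oct_one" using True by (simp add: mmult_nth)
    then have "A$2$1 \<noteq> 0 \<or> A$3$1 \<noteq> 0" using oct_one_neq_0 by (metis omult_zero_right add_0)
    then obtain k where k: "1 \<noteq> k" "A$k$1 \<noteq> 0"
      by (elim disjE) (metis one_neq_2, metis one_neq_3)
    have E: "(transvection 1 k oct_one \<odot>\<odot> A, B \<odot>\<odot> transvection 1 k (- oct_one)) \<in> sl_pairs 2"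
      by (rule sl_pairs_mult[OF order_refl transvection_in_sl_pairs AB]) (use k in simp_all)
    show ?thesis
      by (rule sl_good_left[OF k(1) _ sl_good_corner[OF E]]) (use k True in \<open>simp_all add: transvection_left_nth\<close>)
  next
    case False
    then show ?thesis using sl_good_corner[OF AB] by blast
  qed
  then have "sl_pairs 2 = sl_component"
    using sl_component_subset by (auto simp: sl_good_def)
  then show ?thesis using connected_sl_component by simp
qed

text \<open>A continuous image of \<open>sl_pairs 2\<close>; in the topology of pointwise
  convergence continuity is checked at each fixed X.\<close>

lemma connected_Sp1_centralizer: "connected Sp1_centralizer"
proof -
  let ?f = "\<lambda>P. restrict (act 2 (fst P) (snd P)) (Herm 3)"
  have "continuous_on (sl_pairs 2) (\<lambda>P. ?f P X)" for X
  proof (cases "X \<in> Herm 3")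
    case True
    have "continuous_on UNIV (\<lambda>P::omat \<times> omat. congruence (fst P) S)" for S
      unfolding congruence_def adjoint_mat_def
      by (intro continuous_on_mmult continuous_on_vec_lambda continuous_on_oct continuous_on_component
          continuous_on_const continuous_on_fst continuous_on_id)
    moreover have "continuous_on UNIV (\<lambda>P::omat \<times> omat. row_mult v (snd P))" for v
      unfolding row_mult_def
      by (intro continuous_on_vec_lambda continuous_on_sum continuous_on_omult continuous_on_component
          continuous_on_const continuous_on_snd continuous_on_id)
    moreover have "continuous_on UNIV (\<lambda>v. herm 0 0 0 (v$1 \<odot> cd_unit 2) (v$2 \<odot> cd_unit 2) (v$3 \<odot> cd_unit 2))"
      by (rule linear_continuous_on[OF linear_conv_bounded_linear[THEN iffD1]], rule linearI)
        (simp_all add: herm_ops omult_add_left)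
    ultimately have "continuous_on UNIV (\<lambda>P::omat \<times> omat. act 2 (fst P) (snd P) X)"
      unfolding act_def emb_def by (intro continuous_on_add) (auto intro: continuous_on_compose2)
    then show ?thesis using True by (auto intro: continuous_on_subset)
  next
    case False
    then show ?thesis by (simp add: continuous_on_const)
  qed
  then have "continuous_on (sl_pairs 2) ?f" by (rule continuous_on_coordinatewise_then_product)
  then have "connected (?f ` sl_pairs 2)" using sl_pairs_connected by (rule connected_continuous_image)
  moreover have "?f ` sl_pairs 2 = Sp1_centralizer" unfolding Sp1_centralizer_eq by force
  ultimately show ?thesis by simp
qed

text \<open>For m = 2 this is where connectedness enters: the identity component is the whole
  centralizer.\<close>

lemma G_sub_eq_act:
  assumes "m \<le> 2"
  shows "G_sub (Suc m) = {restrict (act m A B) (Herm (Suc m)) | A B. (A, B) \<in> sl_pairs m}"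
proof (cases "m \<le> 1")
  case True
  then show ?thesis by (rule G_sub_eq_act_commutative)
next
  case False
  then have m: "m = 2" using assms by simp
  have "restrict (act 2 omat_one omat_one) (Herm 3) \<in> Sp1_centralizer"
    using act_in_centralizer sl_pairs_one by blast
  moreover have "restrict (act 2 omat_one omat_one) (Herm 3) = (\<lambda>X\<in>Herm 3. X)"
    using act_one[OF order_refl] by (intro restrict_ext) simp
  ultimately have "connected_component_set Sp1_centralizer (\<lambda>X\<in>Herm 3. X) = Sp1_centralizer"
    using connected_Sp1_centralizer by (simp add: connected_component_eq_self)
  then show ?thesis by (simp add: m G_sub_def Sp1_centralizer_eq)
qed

section \<open>The fibration in affine coordinates\<close>

lemma Herm1_mono: "m \<le> k \<Longrightarrow> X \<in> Herm1 m \<Longrightarrow> X \<in> Herm1 k"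
  using Herm_mono by (simp add: Herm1_def)

lemma Plane_D:
  assumes "n \<le> 3" "X \<in> Plane n"
  shows "X \<in> Herm n" "herm_trace X = 1" "adj3 X = 0" "det3 X = 0"
proof -
  show X: "X \<in> Herm n" "herm_trace X = 1" "adj3 X = 0" using assms by (simp_all add: Plane_eq Herm1_def)
  have X3: "X \<in> Herm 3" using Herm_mono[OF assms(1) X(1)] .
  have s: "sec3 X = 0" using X(3) by (simp add: sec3_def herm_trace_def)
  \<comment> \<open>X is idempotent, so its cube has trace 1, and Newton's identity with trace 1 and
    \<open>sec3 X = 0\<close> leaves det = 0.\<close>
  have "jordan_prod X X = X" using square_eq_adj3[OF X3] X s by simp
  then show "det3 X = 0" using trace_cube_eq[OF X3] X(2) s by simp
qed

lemma Plane_Suc_cases: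
  assumes "m \<le> 2" "X \<in> Plane (Suc m)"
  obtains S v where "X = emb m S v" "S \<in> Herm m" "v \<in> vec_over m" "herm_trace S = 1"
    "adj3 S = outer v" "row_mult v S = 0"
proof -
  have "X \<in> Herm (Suc m)" using Plane_D(1)[OF _ assms(2)] assms(1) by simp
  then obtain S v where X: "X = emb m S v" "S \<in> Herm m" "v \<in> vec_over m" using assms(1) by (elim emb_cases)
  then show ?thesis using that Plane_emb_iff[OF assms(1) X(2,3)] assms(2) by blast
qed

lemma sec3_outer: "sec3 S = inner (v$1) (v$1) + inner (v$2) (v$2) + inner (v$3) (v$3)" if "adj3 S = outer v"
  using that by (simp add: sec3_def outer_def)

lemma outer_eq_0_iff: "outer v = 0 \<longleftrightarrow> v = 0"
  unfolding outer_def herm_0 herm_eq_iff by (auto simp: vec_eq_iff forall_3)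

text \<open>From v S = 0 the form vanishes at v, so det S = det X = 0; and \<open>sec3 S\<close> is
  the squared norm of v.\<close>

lemma proj_Plane_in_Sigma:
  assumes "m \<le> 2" "X \<in> Plane (Suc m)" shows "proj_mat m X \<in> Sigma_bd m"
proof -
  obtain S v where X: "X = emb m S v" "S \<in> Herm m" "v \<in> vec_over m" "herm_trace S = 1"
    "adj3 S = outer v" "row_mult v S = 0" using assms by (rule Plane_Suc_cases)
  have "det3 X = 0" using Plane_D(4)[OF _ assms(2)] assms(1) by simp
  then have "det3 S = 0"
    unfolding X(1) det3_emb[OF assms(1) X(2,3)] herm_form_def X(6) by (simp add: herm_dot_def)
  moreover have "0 \<le> sec3 S" unfolding sec3_outer[OF X(5)] by simp
  ultimately show ?thesis
    using assms(1) X(2,4) by (simp add: X(1) proj_mat_emb[OF assms(1) X(2,3)] Sigma_bd_eq Herm1_def)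
qed

text \<open>The action is not compared with the adjoint directly: by \<open>adj3_eq_0_iff\<close>
  the condition is expressed through det, which is preserved.\<close>

lemma act_adj3:
  assumes "m \<le> 2" "(A, B) \<in> sl_pairs m" "X \<in> Herm (Suc m)" "adj3 X = 0"
  shows "adj3 (act m A B X) = 0"
proof -
  have n: "Suc m \<le> 3" using assms(1) by simp
  note aX = act_closed(3)[OF assms(1-3)] and lin = linear_act[of m A B]
  show ?thesis
    unfolding adj3_eq_0_iff[OF n aX]
  proof
    fix Y assume Y: "Y \<in> Herm (Suc m)"
    define Z where "Z = act m B A Y"
    have Z: "Z \<in> Herm (Suc m)" "act m A B Z = Y"
      using act_closed(3)[OF assms(1) sl_pairs_swap[OF assms(1,2)] Y] act_inverse(2)[OF assms(1,2) Y]
      by (simp_all add: Z_def)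
    have "act m A B X + Y = act m A B (X + Z)" "act m A B X - Y = act m A B (X - Z)"
      using linear_add[OF lin] linear_diff[OF lin] Z(2) by simp_all
    then show "det3 (act m A B X + Y) - det3 (act m A B X - Y) = 2 * det3 Y"
      using assms(3,4) Z adj3_eq_0_iff[OF n assms(3)]
      by (metis act_det3[OF assms(1,2)] Herm_intros(1,2))
  qed
qed

text \<open>On the boundary the eigenvalues are nonnegative with product 0, so the smallest is 0,
  and sorting puts it first.\<close>

lemma Sigma_diagonal:
  assumes "m \<le> 2" "S \<in> Sigma_bd m"
  obtains A B l2 l3 where "(A, B) \<in> sl_pairs m" "congruence A S = Diag 0 l2 l3" "0 \<le> l2" "0 \<le> l3"
proof -
  have m3: "m \<le> 3" using assms(1) by simp
  have S: "S \<in> Herm m" "herm_trace S = 1" "det3 S = 0" "0 \<le> sec3 S"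
    using assms m3 by (simp_all add: Sigma_bd_eq Herm1_def)
  obtain l1 l2 l3 where l: "has_eigenvalues m S l1 l2 l3" "reachable m S (Diag l1 l2 l3)"
    using S(1) m3 by (rule ex_eigenvalues)
  note e = has_eigenvalues_det3[OF l(1) m3 S(1)]
  have o: "l1 \<le> l2" "l2 \<le> l3" using l(1) by (simp_all add: has_eigenvalues_def)
  have s: "l1 + l2 + l3 = 1" "0 \<le> l1 * l2 + l2 * l3 + l3 * l1" "l1 * l2 * l3 = 0" using S e by simp_all
  have "0 \<le> l1" using smallest_eigenvalue_nonneg[OF o s(1,2)] s(3) by simp
  then have l1: "l1 = 0" using s(3) o by auto
  obtain f where f: "f \<in> unitary_moves m" "f S = Diag l1 l2 l3" using l(2) unfolding reachable_def by blast
  obtain A B where "(A, B) \<in> sl_pairs m" "\<forall>S\<in>Herm m. f S = congruence A S"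
    using unitary_moves_congruence[OF f(1) assms(1)] by blast
  then show ?thesis using that[of A B l2 l3] f(2) S(1) o l1 by simp
qed

lemma adj3_Diag_0: "adj3 (Diag 0 b c) = Diag (b * c) 0 0"
  by (simp add: adj3_Diag)

lemma outer_axis: "outer (axis 1 w) = Diag (inner w w) 0 0"
  by (simp add: outer_def axis_def Diag_eq_herm)

lemma row_mult_axis_Diag: "row_mult (axis 1 w) (Diag a b c) = axis 1 (a *\<^sub>R w)"
  by (simp add: vec_eq_iff forall_3 row_mult_nth axis_def Diag_nth)

text \<open>Over Diag 0 l2 l3 a lift can be written down, and the group carries it back to
  S.\<close>

lemma Sigma_lift:
  assumes "m \<le> 2" "S \<in> Sigma_bd m"
  obtains v where "v \<in> vec_over m" "emb m S v \<in> Plane (Suc m)"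
proof -
  have n: "Suc m \<le> 3" and m3: "m \<le> 3" using assms(1) by simp_all
  obtain A B l2 l3 where A: "(A, B) \<in> sl_pairs m" "congruence A S = Diag 0 l2 l3" "0 \<le> l2" "0 \<le> l3"
    using assms by (rule Sigma_diagonal)
  note BA = sl_pairs_swap[OF assms(1) A(1)]
  have S: "S \<in> Herm m" "herm_trace S = 1" using assms(2) m3 by (simp_all add: Sigma_bd_eq Herm1_def)
  \<comment> \<open>The adjoint of Diag 0 l2 l3 is Diag (l2 l3) 0 0, so a lift has first entry of
    norm sqrt (l2 l3) and no other entries.\<close>
  define w where "w = (axis 1 (oct_of_real (sqrt (l2 * l3))) :: octonion^3)"
  have w: "w \<in> vec_over m" by (simp add: w_def vec_over_def axis_def)
  define v where "v = row_mult w A"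
  have v: "v \<in> vec_over m" unfolding v_def using act_closed(2)[OF assms(1) BA w] .
  have S2: "S \<in> mat_over 2" "A \<in> mat_over 2" "B \<in> mat_over 2"
    using Herm_mono[OF assms(1) S(1)] sl_pairs_mono2[OF assms(1) A(1)] by (simp_all add: Herm_def)
  have BS: "congruence B (Diag 0 l2 l3) = S"
    unfolding A(2)[symmetric] congruence_mmult[OF S2(3,2,1), symmetric] using sl_pairsD(5)[OF A(1)] by simp
  have "adj3 (Diag 0 l2 l3) - outer w = 0"
    unfolding adj3_Diag_0 w_def outer_axis using A(3,4) by simp
  moreover have "row_mult w (Diag 0 l2 l3) = 0"
    unfolding w_def row_mult_axis_Diag by (simp add: vec_eq_iff axis_def)
  ultimately have "adj3 (emb m (Diag 0 l2 l3) w) = 0"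
    unfolding adj3_emb[OF assms(1) Diag_in_Herm w] by simp
  then have "adj3 (act m B A (emb m (Diag 0 l2 l3) w)) = 0"
    using emb_in_Herm[OF assms(1) Diag_in_Herm w] by (intro act_adj3[OF assms(1) BA])
  then have "adj3 (emb m S v) = 0"
    unfolding act_emb[OF assms(1) Diag_in_Herm w] BS v_def[symmetric] .
  then have "emb m S v \<in> Plane (Suc m)"
    unfolding Plane_eq[OF n] using emb_in_Herm[OF assms(1) S(1) v] trace_emb[OF assms(1) S(1)] S(2)
    by (simp add: Herm1_def)
  then show ?thesis using v that by blast
qed

section \<open>Total space and base inside the slices of trace 1, with n = m + 1\<close>

definition total_pts :: "nat \<Rightarrow> omat set" where "total_pts m = Plane (Suc m) - Plane m"
definition base_pts :: "nat \<Rightarrow> omat set" where "base_pts m = Sigma_bd m - Plane m"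

text \<open>Removing P_m from the larger plane means removing the points with v = 0.\<close>

lemma emb_in_total_iff:
  assumes "m \<le> 2" "S \<in> Herm m" "v \<in> vec_over m"
  shows "emb m S v \<in> total_pts m \<longleftrightarrow> v \<noteq> 0 \<and> herm_trace S = 1 \<and> adj3 S = outer v \<and> row_mult v S = 0"
proof (cases "v = 0")
  case True
  have n: "Suc m \<le> 3" and m3: "m \<le> 3" using assms(1) by simp_all
  have "S \<in> Plane m" if P: "S \<in> Plane (Suc m)"
    unfolding Plane_eq[OF m3] Herm1_def using Plane_D(2,3)[OF n P] assms(2) by simp
  then have "S \<notin> total_pts m" unfolding total_pts_def by blast
  then show ?thesis using True by simp
next
  case False
  have "emb m S v \<notin> Plane m"
  proof
    assume "emb m S v \<in> Plane m"
    then have H: "emb m S v \<in> Herm m" using Plane_D(1)[of m] assms(1) by simp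
    have "emb m (emb m S v) 0 = emb m S v" by (rule emb_zero)
    moreover have "(0::octonion^3) \<in> vec_over m" by (simp add: vec_over_def)
    ultimately have "0 = v" using emb_eq_iff[OF assms(1) H _ assms(2,3)] by blast
    then show False using False by simp
  qed
  then show ?thesis using False Plane_emb_iff[OF assms] by (simp add: total_pts_def)
qed

lemma total_cases:
  assumes "m \<le> 2" "X \<in> total_pts m"
  obtains S v where "X = emb m S v" "S \<in> Herm m" "v \<in> vec_over m" "herm_trace S = 1"
    "adj3 S = outer v" "row_mult v S = 0" "v \<noteq> 0" "S \<in> base_pts m"
proof -
  have XP: "X \<in> Plane (Suc m)" using assms(2) by (simp add: total_pts_def)
  obtain S v where X: "X = emb m S v" "S \<in> Herm m" "v \<in> vec_over m" "herm_trace S = 1"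
    "adj3 S = outer v" "row_mult v S = 0" using assms(1) XP by (rule Plane_Suc_cases)
  have v: "v \<noteq> 0" using emb_in_total_iff[OF assms(1) X(2,3)] assms(2) X(1) by simp
  have "S \<in> Sigma_bd m" using proj_Plane_in_Sigma[OF assms(1) XP] by (simp add: X(1) proj_mat_emb[OF assms(1) X(2,3)])
  \<comment> \<open>The adjoint of S is \<open>outer v\<close>, which is nonzero, whereas it
    vanishes on the plane.\<close>
  moreover have "S \<notin> Plane m" using v assms(1) X(5) outer_eq_0_iff[of v] by (simp add: Plane_eq)
  ultimately show ?thesis using that[of S v] X v by (simp add: base_pts_def)
qed

lemma base_lift:
  assumes "m \<le> 2" "S \<in> base_pts m"
  obtains v where "v \<in> vec_over m" "emb m S v \<in> total_pts m"
proof -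
  have S: "S \<in> Sigma_bd m" "S \<notin> Plane m" using assms(2) by (simp_all add: base_pts_def)
  obtain v where v: "v \<in> vec_over m" "emb m S v \<in> Plane (Suc m)" using assms(1) S(1) by (rule Sigma_lift)
  have SH: "S \<in> Herm1 m" "S \<in> Herm m" using S(1) assms(1) by (simp_all add: Sigma_bd_eq Herm1_def)
  have p: "herm_trace S = 1 \<and> adj3 S = outer v \<and> row_mult v S = 0"
    using Plane_emb_iff[OF assms(1) SH(2) v(1)] v(2) by simp
  have "adj3 S \<noteq> 0" using S(2) SH(1) assms(1) by (simp add: Plane_eq)
  then have "v \<noteq> 0" using p outer_eq_0_iff[of v] by metis
  then have "emb m S v \<in> total_pts m" using emb_in_total_iff[OF assms(1) SH(2) v(1)] p by simp
  then show ?thesis using v(1) that by blast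
qed

lemma base_in_Herm1: "m \<le> 2 \<Longrightarrow> S \<in> base_pts m \<Longrightarrow> S \<in> Herm1 m"
  by (simp add: base_pts_def Sigma_bd_eq)

lemma total_in_Herm1: "m \<le> 2 \<Longrightarrow> X \<in> total_pts m \<Longrightarrow> X \<in> Herm1 (Suc m)"
  by (simp add: total_pts_def Plane_eq)

lemma proj_total: "m \<le> 2 \<Longrightarrow> proj_mat m ` total_pts m = base_pts m"
proof (intro equalityI subsetI)
  fix S assume m: "m \<le> 2" and "S \<in> proj_mat m ` total_pts m"
  then obtain X where X: "X \<in> total_pts m" "S = proj_mat m X" by blast
  obtain T v where T: "X = emb m T v" "T \<in> Herm m" "v \<in> vec_over m" "T \<in> base_pts m"
    using m X(1) by (rule total_cases)
  then show "S \<in> base_pts m" by (simp add: X(2) proj_mat_emb[OF m])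
next
  fix S assume m: "m \<le> 2" and S: "S \<in> base_pts m"
  obtain v where v: "v \<in> vec_over m" "emb m S v \<in> total_pts m" using m S by (rule base_lift)
  have "S = proj_mat m (emb m S v)"
    using base_in_Herm1[OF m S] v(1) by (simp add: proj_mat_emb[OF m] Herm1_def)
  then show "S \<in> proj_mat m ` total_pts m" using v(2) by (rule image_eqI)
qed

lemma proj_Plane: "m \<le> 2 \<Longrightarrow> proj_mat m ` Plane (Suc m) = Sigma_bd m"
proof (intro equalityI subsetI)
  fix S assume m: "m \<le> 2" and S: "S \<in> Sigma_bd m"
  obtain v where v: "v \<in> vec_over m" "emb m S v \<in> Plane (Suc m)" using m S by (rule Sigma_lift)
  have "S = proj_mat m (emb m S v)"
    using S m v(1) by (simp add: proj_mat_emb Herm1_def Sigma_bd_eq)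
  then show "S \<in> proj_mat m ` Plane (Suc m)" using v(2) by (rule image_eqI)
qed (use proj_Plane_in_Sigma in blast)

text \<open>A nonzero \<open>X\<close> with \<open>X\<^sup># = 0\<close> has nonzero trace, so the group permutes the lines spanned by points of the plane.\<close>

lemma act_total:
  assumes "m \<le> 2" "(A, B) \<in> sl_pairs m" "X \<in> total_pts m"
  obtains c where "c \<noteq> 0" "c *\<^sub>R act m A B X \<in> total_pts m"
proof -
  have n: "Suc m \<le> 3" using assms(1) by simp
  obtain S v where X: "X = emb m S v" "S \<in> Herm m" "v \<in> vec_over m" "v \<noteq> 0"
    using assms(1,3) by (rule total_cases)
  have XP: "X \<in> Plane (Suc m)" using assms(3) by (simp add: total_pts_def)
  note XD = Plane_D[OF n XP]
  let ?Y = "act m A B X"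
  have Y: "?Y \<in> Herm (Suc m)" "adj3 ?Y = 0"
    using act_closed(3)[OF assms(1,2) XD(1)] act_adj3[OF assms(1,2) XD(1,3)] by simp_all
  have w: "row_mult v B \<noteq> 0"
  proof
    assume "row_mult v B = 0"
    then have "row_mult (row_mult v B) A = 0" by (simp add: vec_eq_iff row_mult_nth)
    moreover have "row_mult (row_mult v B) A = v"
      using row_mult_mmult[of v B A] sl_pairs_mono2[OF assms(1,2)] vec_over_mono[OF assms(1) X(3)]
        sl_pairsD(5)[OF assms(2)] by simp
    ultimately show False using X(4) by simp
  qed
  note cl = act_closed(1)[OF assms(1,2) X(2)] act_closed(2)[OF assms(1,2) X(3)]
  have Ye: "?Y = emb m (congruence A S) (row_mult v B)" unfolding X(1) by (rule act_emb[OF assms(1) X(2,3)])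
  have "?Y \<noteq> 0"
    using w emb_eq_iff[OF assms(1) cl, of 0 0] unfolding Ye by (simp add: Herm_intros vec_over_def)
  then have t: "herm_trace ?Y \<noteq> 0" using adj3_eq_0_trace[of ?Y] Y Herm_mono[OF n] by blast
  \<comment> \<open>Restores trace 1 after the action, which preserves det only.\<close>
  define c where "c = 1 / herm_trace ?Y"
  have c: "c \<noteq> 0" using t by (simp add: c_def)
  have cY: "c *\<^sub>R ?Y \<in> Herm (Suc m)" using Y(1) by (rule Herm_intros)
  have "adj3 (c *\<^sub>R ?Y) = 0"
  proof -
    obtain a b d x y z where h: "?Y = herm a b d x y z" using Y(1) by (rule HermE)
    have "adj3 (c *\<^sub>R ?Y) = c\<^sup>2 *\<^sub>R adj3 ?Y"
      unfolding h herm_ops adj3_herm by (simp add: power2_eq_square algebra_simps)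
    then show ?thesis using Y(2) by simp
  qed
  moreover have "herm_trace (c *\<^sub>R ?Y) = 1" using t by (simp add: herm_trace_scaleR c_def)
  ultimately have P: "c *\<^sub>R ?Y \<in> Plane (Suc m)" using cY by (simp add: Plane_eq[OF n] Herm1_def)
  have e: "c *\<^sub>R ?Y = emb m (c *\<^sub>R congruence A S) (c *\<^sub>R row_mult v B)" unfolding Ye emb_scaleR ..
  have H: "c *\<^sub>R congruence A S \<in> Herm m" "c *\<^sub>R row_mult v B \<in> vec_over m"
    using cl by (simp_all add: Herm_intros vec_over_def div_alg_scaleR)
  have "c *\<^sub>R ?Y \<in> total_pts m"
    unfolding e emb_in_total_iff[OF assms(1) H] using P[unfolded e Plane_emb_iff[OF assms(1) H]] w c by simp
  then show ?thesis using c that by blast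
qed

text \<open>A representative of trace 2, so it is not itself in \<open>total_pts m\<close>; only its
  line belongs to the total space, and orbits are compared up to a scalar.\<close>

definition base_point :: "nat \<Rightarrow> omat" where
  "base_point m = emb m (Diag 0 1 1) (axis 1 oct_one)"

text \<open>Diagonalising S leaves v with a single nonzero entry. A phase makes this entry real and
  positive, a diagonal scaling makes the two nonzero eigenvalues equal, and a multiple of the base
  point remains.\<close>

lemma act_to_base_point:
  assumes "m \<le> 2" "X \<in> total_pts m"
  obtains A B c where "(A, B) \<in> sl_pairs m" "c \<noteq> 0" "act m A B X = c *\<^sub>R base_point m"
proof -
  have n: "Suc m \<le> 3" using assms(1) by simp
  obtain S v where X: "X = emb m S v" "S \<in> Herm m" "v \<in> vec_over m" "v \<noteq> 0" "S \<in> base_pts m"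
    using assms by (rule total_cases)
  have XP: "X \<in> Plane (Suc m)" using assms(2) by (simp add: total_pts_def)
  note XD = Plane_D[OF n XP]
  have "S \<in> Sigma_bd m" using X(5) by (simp add: base_pts_def)
  then obtain A B l2 l3 where A: "(A, B) \<in> sl_pairs m" "congruence A S = Diag 0 l2 l3" "0 \<le> l2" "0 \<le> l3"
    using Sigma_diagonal[OF assms(1)] by blast
  define w where "w = row_mult v B"
  have w: "w \<in> vec_over m" unfolding w_def using act_closed(2)[OF assms(1) A(1) X(3)] .
  have AX: "act m A B X = emb m (Diag 0 l2 l3) w"
    unfolding X(1) act_emb[OF assms(1) X(2,3)] A(2) w_def ..
  have w0: "w \<noteq> 0"
  proof
    assume "w = 0"
    then have "row_mult w A = 0" by (simp add: vec_eq_iff row_mult_nth)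
    moreover have "row_mult w A = v"
      unfolding w_def using row_mult_mmult[of v B A] sl_pairs_mono2[OF assms(1) A(1)]
        vec_over_mono[OF assms(1) X(3)] sl_pairsD(5)[OF A(1)] by simp
    ultimately show False using X(4) by simp
  qed
  have "adj3 (emb m (Diag 0 l2 l3) w) = 0" using act_adj3[OF assms(1) A(1) XD(1,3)] unfolding AX .
  then have "emb m (adj3 (Diag 0 l2 l3) - outer w) (- row_mult w (Diag 0 l2 l3)) = emb m 0 0"
    using adj3_emb[OF assms(1) Diag_in_Herm w] by simp
  moreover have "- row_mult w (Diag 0 l2 l3) \<in> vec_over m"
    using row_mult_in[OF w mat_over_Diag] by (simp add: vec_over_def div_alg_minus)
  moreover have "adj3 (Diag 0 l2 l3) - outer w \<in> Herm m"
    using w by (intro Herm_intros adj3_in_Herm Diag_in_Herm outer_in)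
  moreover have "(0::omat) \<in> Herm m" "(0::octonion^3) \<in> vec_over m" by (simp_all add: Herm_intros vec_over_def)
  ultimately have "adj3 (Diag 0 l2 l3) - outer w = 0"
    using emb_eq_iff[OF assms(1), of "adj3 (Diag 0 l2 l3) - outer w" "- row_mult w (Diag 0 l2 l3)" 0 0] by blast
  then have o: "outer w = Diag (l2 * l3) 0 0" by (simp add: adj3_Diag_0)
  then have w23: "w$2 = 0" "w$3 = 0" and w1: "inner (w$1) (w$1) = l2 * l3"
    by (simp_all add: outer_def Diag_eq_herm)
  have w_axis: "w = axis 1 (w$1)" using w23 by (simp add: vec_eq_iff forall_3 axis_def)
  then have "w$1 \<noteq> 0" using w0 by (auto simp: vec_eq_iff forall_3 w23)
  then have "l2 * l3 \<noteq> 0" using w1 by (metis inner_eq_zero_iff)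
  then have l: "0 < l2" "0 < l3" using A(3,4) by auto
  have nw: "norm (w$1) = sqrt (l2 * l3)" using w1 by (simp add: norm_eq_sqrt_inner)
  obtain u where u: "u \<in> div_alg m" "norm u = 1" "w$1 \<odot> u = oct_of_real (norm (w$1))"
    using vec_over_nth[OF w] by (rule ex_phase_real)
  have u2: "u \<in> div_alg 2" using u(1) assms(1) div_alg_mono by blast
  have P: "(diag_mat (ocnj u) oct_one u, diag_mat u oct_one (ocnj u)) \<in> sl_pairs m"
    using phase_in_sl_pairs[OF assms(1), of "ocnj u"] u by simp
  have P1: "congruence (diag_mat (ocnj u) oct_one u) (Diag 0 l2 l3) = Diag 0 l2 l3"
    using congruence_diag_mat[of "ocnj u" oct_one u 0 0 0 0 l2 l3] u2 norm_1_inner[OF u(2)]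
    by (simp add: Diag_eq_herm)
  have P2: "row_mult w (diag_mat u oct_one (ocnj u)) = axis 1 (oct_of_real (sqrt (l2 * l3)))"
    by (subst w_axis) (simp add: vec_eq_iff forall_3 row_mult_nth axis_def u(3) nw)
  have PX: "act m (diag_mat (ocnj u) oct_one u) (diag_mat u oct_one (ocnj u)) (act m A B X)
      = emb m (Diag 0 l2 l3) (axis 1 (oct_of_real (sqrt (l2 * l3))))"
    unfolding AX act_emb[OF assms(1) Diag_in_Herm w] P1 P2 ..
  define q where "q = sqrt (sqrt (l3 / l2))"
  have q: "q > 0" using l by (simp add: q_def)
  have q2: "q * q = sqrt l3 / sqrt l2" using l by (simp add: q_def real_sqrt_divide)
  have Q: "(Diag 1 q (1/q), Diag 1 (1/q) q) \<in> sl_pairs m" using scaling_in_sl_pairs[OF assms(1)] q by simp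
  have ql: "q * q * l2 = sqrt (l2 * l3)" "1 / q * (1 / q) * l3 = sqrt (l2 * l3)"
  proof -
    have "sqrt l2 * sqrt l2 = l2" "sqrt l3 * sqrt l3 = l3" using l by simp_all
    moreover have "sqrt l2 > 0" "sqrt l3 > 0" using l by simp_all
    ultimately show "q * q * l2 = sqrt (l2 * l3)" "1 / q * (1 / q) * l3 = sqrt (l2 * l3)"
      unfolding q2 times_divide_times_eq real_sqrt_mult by (simp_all add: field_simps)
  qed
  have Q1: "congruence (Diag 1 q (1/q)) (Diag 0 l2 l3) = sqrt (l2 * l3) *\<^sub>R Diag 0 1 1"
    using congruence_diag_mat[of oct_one "oct_of_real q" "oct_of_real (1/q)" 0 0 0 0 l2 l3] ql
    by (simp add: Diag_eq_herm diag_mat_of_real herm_ops del: times_divide_eq_left times_divide_eq_right)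
  have ax: "axis 1 (oct_of_real (sqrt (l2 * l3))) \<in> vec_over m" by (simp add: vec_over_def axis_def)
  have Q2: "row_mult (axis 1 (oct_of_real (sqrt (l2 * l3)))) (Diag 1 (1/q) q) = sqrt (l2 * l3) *\<^sub>R axis 1 oct_one"
    unfolding row_mult_axis_Diag by (simp add: vec_eq_iff axis_def oct_of_real_scaleR)
  let ?P = "diag_mat (ocnj u) oct_one u" and ?P' = "diag_mat u oct_one (ocnj u)"
  let ?Q = "Diag 1 q (1/q)" and ?Q' = "Diag 1 (1/q) q"
  have "act m ?Q ?Q' (act m ?P ?P' (act m A B X)) = sqrt (l2 * l3) *\<^sub>R base_point m"
    unfolding PX act_emb[OF assms(1) Diag_in_Herm ax] Q1 Q2 base_point_def emb_scaleR ..
  moreover have "act m ?Q ?Q' (act m ?P ?P' (act m A B X)) = act m (?Q \<odot>\<odot> (?P \<odot>\<odot> A)) ((B \<odot>\<odot> ?P') \<odot>\<odot> ?Q') X"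
    unfolding act_act[OF assms(1) P A(1) XD(1)]
    by (rule act_act[OF assms(1) Q sl_pairs_mult[OF assms(1) P A(1)] XD(1)])
  moreover have "sqrt (l2 * l3) \<noteq> 0" using l by simp
  ultimately show ?thesis
    using that sl_pairs_mult[OF assms(1) Q sl_pairs_mult[OF assms(1) P A(1)]] by metis
qed

lemma act_transitive:
  assumes "m \<le> 2" "X \<in> total_pts m" "Y \<in> total_pts m"
  obtains A B c where "(A, B) \<in> sl_pairs m" "c \<noteq> 0" "act m A B X = c *\<^sub>R Y"
proof -
  obtain A B a where A: "(A, B) \<in> sl_pairs m" "a \<noteq> 0" "act m A B X = a *\<^sub>R base_point m"
    using assms(1,2) by (rule act_to_base_point)
  obtain C D b where C: "(C, D) \<in> sl_pairs m" "b \<noteq> 0" "act m C D Y = b *\<^sub>R base_point m"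
    using assms(1,3) by (rule act_to_base_point)
  have H: "X \<in> Herm (Suc m)" "Y \<in> Herm (Suc m)"
    using total_in_Herm1[OF assms(1)] assms(2,3) by (simp_all add: Herm1_def)
  note DC = sl_pairs_swap[OF assms(1) C(1)]
  have "base_point m = (1/b) *\<^sub>R act m C D Y" using C(2,3) by simp
  then have "act m D C (act m A B X) = (a / b) *\<^sub>R act m D C (act m C D Y)"
    unfolding A(3) by (simp add: linear_cmul[OF linear_act])
  then have "act m (D \<odot>\<odot> A) (B \<odot>\<odot> C) X = (a / b) *\<^sub>R Y"
    unfolding act_act[OF assms(1) DC A(1) H(1)] act_inverse(1)[OF assms(1) C(1) H(2)] .
  then show ?thesis using that[OF sl_pairs_mult[OF assms(1) DC A(1)], of "a / b"] A(2) C(2) by simp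
qed

subsection \<open>Local trivialisations\<close>

lemma bounded_linear_of_linear: "linear f \<Longrightarrow> bounded_linear (f :: 'a::euclidean_space \<Rightarrow> 'b::real_normed_vector)"
  by (simp add: linear_conv_bounded_linear)

lemmas continuous_on_linear_compose =
  bounded_linear.continuous_on[OF bounded_linear_of_linear]

lemma continuous_on_herm:
  assumes "continuous_on S a" "continuous_on S b" "continuous_on S c"
    "continuous_on S x" "continuous_on S y" "continuous_on S z"
  shows "continuous_on S (\<lambda>s. herm (a s) (b s) (c s) (x s) (y s) (z s))"
proof -
  define L where "L P = herm (fst P) (fst (snd P)) (fst (snd (snd P))) (fst (snd (snd (snd P))))
      (fst (snd (snd (snd (snd P))))) (snd (snd (snd (snd (snd P)))))"
    for P :: "real \<times> real \<times> real \<times> octonion \<times> octonion \<times> octonion"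
  have "linear L" unfolding L_def by (rule linearI) (simp_all add: herm_ops)
  moreover have "continuous_on S (\<lambda>s. (a s, b s, c s, x s, y s, z s))"
    using assms by (intro continuous_on_Pair)
  ultimately have "continuous_on S (\<lambda>s. L (a s, b s, c s, x s, y s, z s))" by (rule continuous_on_linear_compose)
  then show ?thesis by (simp add: L_def)
qed

lemma continuous_on_adj3: "continuous_on S adj3"
  unfolding adj3_def[abs_def] by (intro continuous_on_herm) (rule entry_continuous)+

lemma continuous_on_left_mult:
  assumes "continuous_on S p" "continuous_on S v" shows "continuous_on S (\<lambda>s. left_mult (p s) (v s))"
  unfolding left_mult_def by (intro continuous_on_vec_lambda continuous_on_omult continuous_on_component assms)

lemma continuous_on_emb:
  assumes "continuous_on S f" "continuous_on S v" shows "continuous_on S (\<lambda>s. emb m (f s) (v s))"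
  unfolding emb_def
  by (intro continuous_on_add continuous_on_herm continuous_on_omult continuous_on_component continuous_on_const assms)

lemma outer_nth: "outer v $ i $ j = ocnj (v$i) \<odot> v$j"
  using exhaust_3[of i] exhaust_3[of j] by (auto simp: outer_def ocnj_omult_self ocnj_omult)

lemma left_mult_left_mult:
  assumes "p \<in> div_alg 2" "q \<in> div_alg 2" "v \<in> vec_over 2"
  shows "left_mult p (left_mult q v) = left_mult (p \<odot> q) v"
  using assms(1,2) assms(3)[THEN vec_over_nth] by (simp add: left_mult_def vec_eq_iff omult_assoc)

lemma outer_left_mult:
  assumes "p \<in> div_alg 2" "norm p = 1" "v \<in> vec_over 2" shows "outer (left_mult p v) = outer v"
  using assms(1) assms(3)[THEN vec_over_nth] norm_1_inner[OF assms(2)]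
  by (simp add: vec_eq_iff outer_nth left_mult_def ocnj_omult omult_assoc div_alg_intros ocnj_cancel_left)

text \<open>The fibre coordinate: the fibre over S is a unit sphere in A_m, read off from the phase
  of a nonzero entry v_i.\<close>

definition unit_of :: "nat \<Rightarrow> 3 \<Rightarrow> omat \<Rightarrow> octonion" where
  "unit_of m i X = (1 / norm (off_part m X $ i)) *\<^sub>R off_part m X $ i"

text \<open>If \<open>S\<^sup># = v\<^sup>* v\<close> and \<open>v\<^sub>i \<noteq> 0\<close>, then \<open>v\<close> is the product of the unit \<open>v\<^sub>i / |v\<^sub>i|\<close> with the vector
  \<open>section_row i S\<close>, which depends on \<open>S\<close> only.\<close>

definition section_row :: "3 \<Rightarrow> omat \<Rightarrow> octonion^3" where
  "section_row i S = (1 / sqrt (oct_Re (adj3 S $ i $ i))) *\<^sub>R adj3 S $ i"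

lemma section_row_in: "S \<in> Herm m \<Longrightarrow> section_row i S \<in> vec_over m"
  using adj3_in_Herm[of S m] by (simp add: section_row_def vec_over_def Herm_def mat_over_def div_alg_scaleR)

lemma section_row_outer:
  assumes "m \<le> 2" "v \<in> vec_over m" "adj3 S = outer v" "oct_Re (adj3 S $ i $ i) > 0"
  shows "norm (v$i) = sqrt (oct_Re (adj3 S $ i $ i))" "v$i \<noteq> 0"
    "left_mult ((1 / norm (v$i)) *\<^sub>R v$i) (section_row i S) = v"
proof -
  have e: "oct_Re (adj3 S $ i $ i) = inner (v$i) (v$i)"
    unfolding assms(3) outer_nth by (simp add: ocnj_omult_self)
  then show n: "norm (v$i) = sqrt (oct_Re (adj3 S $ i $ i))" by (simp add: norm_eq_sqrt_inner)
  then show nz: "v$i \<noteq> 0" using assms(4) by auto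
  have "(norm (v$i) * norm (v$i)) = inner (v$i) (v$i)" by (simp add: dot_square_norm power2_eq_square)
  then have "left_mult ((1 / norm (v$i)) *\<^sub>R v$i) (section_row i S) $ j = v$j" for j
    using nz unfolding section_row_def n[symmetric]
    by (simp add: left_mult_def assms(3) outer_nth ocnj_cancel_left')
  then show "left_mult ((1 / norm (v$i)) *\<^sub>R v$i) (section_row i S) = v" by (simp add: vec_eq_iff)
qed

text \<open>Starting from one lift v with phase u0, left multiplication by u times the conjugate of
  u0 gives the lift with phase u; it changes neither \<open>outer v\<close> nor the condition v S =
  0.\<close>

lemma unit_in_total:
  assumes "m \<le> 2" "S \<in> base_pts m" "oct_Re (adj3 S $ i $ i) > 0" "u \<in> div_alg m" "norm u = 1"
  shows "emb m S (left_mult u (section_row i S)) \<in> total_pts m"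
    and "unit_of m i (emb m S (left_mult u (section_row i S))) = u"
proof -
  have S: "S \<in> Herm m" "herm_trace S = 1" using base_in_Herm1[OF assms(1,2)] by (simp_all add: Herm1_def)
  obtain v where v: "v \<in> vec_over m" "emb m S v \<in> total_pts m" using assms(1,2) by (rule base_lift)
  have vS: "v \<noteq> 0" "adj3 S = outer v" "row_mult v S = 0"
    using v emb_in_total_iff[OF assms(1) S(1) v(1)] by simp_all
  define u0 where "u0 = (1 / norm (v$i)) *\<^sub>R v$i"
  note sr = section_row_outer[OF assms(1) v(1) vS(2) assms(3)]
  have u0: "u0 \<in> div_alg m" "norm u0 = 1"
    using sr(2) vec_over_nth[OF v(1)] by (simp_all add: u0_def div_alg_scaleR)
  define p where "p = u \<odot> ocnj u0"
  have p: "p \<in> div_alg m" "norm p = 1" using u0 assms(4,5) by (simp_all add: p_def div_alg_intros norm_omult)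
  note r = section_row_in[OF S(1), of i]
  have D: "p \<in> div_alg 2" "u0 \<in> div_alg 2" "u \<in> div_alg 2" "section_row i S \<in> vec_over 2" "v \<in> vec_over 2" "S \<in> mat_over 2"
    using p u0 assms(4) r v(1) Herm_mono[OF assms(1) S(1)] div_alg_mono[OF assms(1)] vec_over_mono[OF assms(1)]
    by (simp_all add: Herm_def)
  have "p \<odot> u0 = u" unfolding p_def using ocnj_cancel_right'[of u u0] norm_1_inner[OF u0(2)] by simp
  then have pv: "left_mult u (section_row i S) = left_mult p v"
    using left_mult_left_mult[OF D(1,2,4)] sr(3) by (simp add: u0_def)
  have w: "left_mult p v \<in> vec_over m" using p(1) v(1) by (rule left_mult_in)
  have "row_mult (left_mult p v) S = 0"
    using left_mult_row_mult[OF D(1,5,6)] vS(3) by (simp add: left_mult_def vec_eq_iff)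
  moreover have "left_mult p v \<noteq> 0"
  proof -
    have "p \<noteq> 0" using p(2) by auto
    then show ?thesis using sr(2) by (auto simp: left_mult_def vec_eq_iff)
  qed
  ultimately show "emb m S (left_mult u (section_row i S)) \<in> total_pts m"
    unfolding pv emb_in_total_iff[OF assms(1) S(1) w] using S(2) vS(2) outer_left_mult[OF D(1) p(2) D(5)] by simp
  have "section_row i S $ i = oct_of_real (sqrt (oct_Re (adj3 S $ i $ i)))"
  proof -
    have "adj3 S $ i $ i = oct_of_real (oct_Re (adj3 S $ i $ i))"
      unfolding vS(2) outer_nth by (simp add: ocnj_omult_self)
    then have "section_row i S $ i = (1 / sqrt (oct_Re (adj3 S $ i $ i))) *\<^sub>R oct_of_real (oct_Re (adj3 S $ i $ i))"
      by (simp add: section_row_def)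
    also have "\<dots> = oct_of_real (sqrt (oct_Re (adj3 S $ i $ i)))"
      using assms(3) by (simp add: oct_of_real_scaleR real_div_sqrt)
    finally show ?thesis .
  qed
  then have "off_part m (emb m S (left_mult u (section_row i S))) $ i = sqrt (oct_Re (adj3 S $ i $ i)) *\<^sub>R u"
    using off_part_emb[OF assms(1) S(1) left_mult_in[OF assms(4) r]] by (simp add: left_mult_def)
  then show "unit_of m i (emb m S (left_mult u (section_row i S))) = u"
    using assms(3,5) by (simp add: unit_of_def)
qed

lemma continuous_on_proj_mat: "continuous_on S (proj_mat m)"
  by (rule linear_continuous_on[OF bounded_linear_of_linear[OF linear_proj_mat]])

text \<open>Where the i-th diagonal entry of the adjoint is positive, \<open>section_row i\<close>
  gives a continuous section and the phase of v_i a fibre coordinate. Such sets cover the base,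
  because the adjoint is \<open>v\<^sup>* v\<close> with v nonzero.\<close>

lemma fibration_affine:
  assumes m: "m \<le> 2"
  shows "locally_trivial_fibration (top_of_set (total_pts m)) (top_of_set (base_pts m)) (proj_mat m)"
  unfolding locally_trivial_fibration_def
proof (intro conjI ballI)
  show "continuous_map (top_of_set (total_pts m)) (top_of_set (base_pts m)) (proj_mat m)"
    using proj_total[OF m] continuous_on_proj_mat by (simp add: continuous_map_in_subtopology image_subset_iff_funcset[symmetric])
  show "proj_mat m ` topspace (top_of_set (total_pts m)) = topspace (top_of_set (base_pts m))"
    using proj_total[OF m] by simp
next
  fix S0 assume "S0 \<in> topspace (top_of_set (base_pts m))"
  then have S0: "S0 \<in> base_pts m" by simp
  define d where "d i S = oct_Re (adj3 S $ i $ i)" for i S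
  have d_cont: "continuous_on T (d i)" for T i
    unfolding d_def[abs_def]
    by (rule continuous_on_oct continuous_on_component continuous_on_adj3)+
  have "\<exists>i. d i S0 > 0"
  proof -
    have S0H: "S0 \<in> Herm m" using base_in_Herm1[OF m S0] by (simp add: Herm1_def)
    obtain v where v: "v \<in> vec_over m" "emb m S0 v \<in> total_pts m" using m S0 by (rule base_lift)
    then have "v \<noteq> 0" "adj3 S0 = outer v" using emb_in_total_iff[OF m S0H v(1)] by simp_all
    then obtain i where "v$i \<noteq> 0" by (auto simp: vec_eq_iff)
    then have "d i S0 > 0" unfolding d_def \<open>adj3 S0 = outer v\<close> outer_nth by (simp add: ocnj_omult_self)
    then show ?thesis ..
  qed
  then obtain i where i: "d i S0 > 0" ..
  define U where "U = base_pts m \<inter> {S. 0 < d i S}"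
  have "open {S. 0 < d i S}" by (rule open_Collect_less[OF continuous_on_const d_cont])
  then have openU: "openin (top_of_set (base_pts m)) U" unfolding U_def by (rule openin_open_Int)
  define T where "T = {X \<in> total_pts m. proj_mat m X \<in> U}"
  define F where "F = {X \<in> total_pts m. proj_mat m X = S0}"
  \<comment> \<open>The second factor has to be the fibre over S0 itself, so a phase is stored as
    the point over S0 that has this phase.\<close>
  define h where "h X = (proj_mat m X, emb m S0 (left_mult (unit_of m i X) (section_row i S0)))" for X
  define k where "k P = emb m (fst P) (left_mult (unit_of m i (snd P)) (section_row i (fst P)))" for P
  have S0U: "S0 \<in> U" using S0 i by (simp add: U_def)
  have UD: "S \<in> base_pts m" "S \<in> Herm m" "0 < oct_Re (adj3 S $ i $ i)" if "S \<in> U" for S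
    using that base_in_Herm1[OF m] by (simp_all add: U_def Herm1_def d_def)
  have TD: "unit_of m i X \<in> div_alg m" "norm (unit_of m i X) = 1" "off_part m X $ i \<noteq> 0"
      "emb m (proj_mat m X) (left_mult (unit_of m i X) (section_row i (proj_mat m X))) = X"
    if X: "X \<in> T" for X
  proof -
    have XT: "X \<in> total_pts m" "proj_mat m X \<in> U" using X by (simp_all add: T_def)
    obtain S v where Sv: "X = emb m S v" "S \<in> Herm m" "v \<in> vec_over m" "adj3 S = outer v"
      using m XT(1) by (rule total_cases)
    have pr: "proj_mat m X = S" "off_part m X = v" unfolding Sv(1) by (simp_all add: emb_parts[OF m Sv(2,3)])
    note sr = section_row_outer[OF m Sv(3,4) UD(3)[OF XT(2)[unfolded pr]]]
    show "unit_of m i X \<in> div_alg m" "norm (unit_of m i X) = 1" "off_part m X $ i \<noteq> 0"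
      using sr(2) vec_over_nth[OF Sv(3)] by (simp_all add: unit_of_def pr div_alg_scaleR)
    show "emb m (proj_mat m X) (left_mult (unit_of m i X) (section_row i (proj_mat m X))) = X"
      unfolding unit_of_def pr sr(3) by (simp add: Sv(1))
  qed
  have FT: "X \<in> T" "proj_mat m X = S0" if "X \<in> F" for X using that S0U by (simp_all add: F_def T_def)
  have h_in: "h X \<in> U \<times> F" and kh: "k (h X) = X" if X: "X \<in> T" for X
  proof -
    note u = unit_in_total[OF m S0 UD(3)[OF S0U] TD(1,2)[OF X]]
    have "proj_mat m (emb m S0 (left_mult (unit_of m i X) (section_row i S0))) = S0"
      using proj_mat_emb[OF m UD(2)[OF S0U] left_mult_in[OF TD(1)[OF X] section_row_in[OF UD(2)[OF S0U]]]] .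
    then show "h X \<in> U \<times> F" using X u(1) by (simp add: h_def F_def T_def)
    show "k (h X) = X" unfolding h_def k_def using u(2) TD(4)[OF X] by simp
  qed
  have k_in: "k P \<in> T" and hk: "h (k P) = P" if P: "P \<in> U \<times> F" for P
  proof -
    have S: "fst P \<in> U" and Y: "snd P \<in> F" using P by (simp_all add: mem_Times_iff)
    note YT = FT[OF Y] and uD = TD(1,2)[OF FT(1)[OF Y]]
    note u = unit_in_total[OF m UD(1)[OF S] UD(3)[OF S] uD]
    have p: "proj_mat m (k P) = fst P"
      unfolding k_def using proj_mat_emb[OF m UD(2)[OF S] left_mult_in[OF uD(1) section_row_in[OF UD(2)[OF S]]]] .
    show "k P \<in> T" using u(1) p S by (simp add: T_def) (simp add: k_def)
    have "unit_of m i (k P) = unit_of m i (snd P)" unfolding k_def by (rule u(2))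
    then have "h (k P) = (fst P, snd P)" unfolding h_def p using TD(4)[OF YT(1)] unfolding YT(2) by simp
    then show "h (k P) = P" by simp
  qed
  have unit_cont: "continuous_on R (\<lambda>x. unit_of m i (f x))"
    if "continuous_on R f" "\<And>x. x \<in> R \<Longrightarrow> f x \<in> T" for R and f :: "'z::topological_space \<Rightarrow> omat"
  proof -
    have "continuous_on R (\<lambda>x. off_part m (f x) $ i)"
      by (intro continuous_on_component continuous_on_linear_compose[OF linear_proj_off] that(1))
    then show ?thesis unfolding unit_of_def using TD(3) that(2)
      by (intro continuous_on_scaleR continuous_on_divide continuous_on_const continuous_on_norm) simp_all
  qed
  have h_cont: "continuous_on T h"
    unfolding h_def
    by (intro continuous_on_Pair continuous_on_proj_mat continuous_on_emb continuous_on_left_mult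
        continuous_on_const unit_cont continuous_on_id)
  have row_cont: "continuous_on U (section_row i)"
    unfolding section_row_def[abs_def]
    by (intro continuous_on_scaleR continuous_on_divide continuous_on_const continuous_on_real_sqrt
        d_cont[unfolded d_def] continuous_on_component continuous_on_adj3) (use UD(3) in fastforce)
  have k_cont: "continuous_on (U \<times> F) k"
    unfolding k_def
  proof (intro continuous_on_emb continuous_on_left_mult unit_cont continuous_on_fst continuous_on_snd continuous_on_id)
    show "continuous_on (U \<times> F) (\<lambda>P. section_row i (fst P))"
      by (rule continuous_on_compose2[OF row_cont]) (auto intro: continuous_on_fst continuous_on_id)
    show "snd P \<in> T" if "P \<in> U \<times> F" for P using that FT(1) by (simp add: mem_Times_iff)
  qed
  have "homeomorphic_maps (top_of_set T) (top_of_set (U \<times> F)) h k"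
    unfolding homeomorphic_maps_def
  proof (intro conjI ballI)
    show "continuous_map (top_of_set T) (top_of_set (U \<times> F)) h"
      unfolding continuous_map_in_subtopology using h_cont h_in by (simp add: image_subset_iff)
    show "continuous_map (top_of_set (U \<times> F)) (top_of_set T) k"
      unfolding continuous_map_in_subtopology continuous_map_iff_continuous topspace_euclidean_subtopology
      by (intro conjI k_cont funcsetI k_in)
    show "k (h X) = X" if "X \<in> topspace (top_of_set T)" for X using that kh by simp
    show "h (k P) = P" if "P \<in> topspace (top_of_set (U \<times> F))" for P using that hk by (simp only: topspace_euclidean_subtopology)
  qed
  then have "homeomorphic_map (top_of_set T) (top_of_set (U \<times> F)) h" using homeomorphic_map_maps by blast
  moreover have "subtopology (top_of_set (total_pts m)) {X \<in> topspace (top_of_set (total_pts m)). proj_mat m X \<in> U} = top_of_set T"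
    "subtopology (top_of_set (base_pts m)) U = top_of_set U"
    "subtopology (top_of_set (total_pts m)) {X \<in> topspace (top_of_set (total_pts m)). proj_mat m X = S0} = top_of_set F"
    unfolding subtopology_subtopology topspace_euclidean_subtopology
    by (rule arg_cong[where f = top_of_set]; unfold T_def F_def U_def; blast)+
  ultimately have "homeomorphic_map (subtopology (top_of_set (total_pts m)) {X \<in> topspace (top_of_set (total_pts m)). proj_mat m X \<in> U})
      (prod_topology (subtopology (top_of_set (base_pts m)) U)
        (subtopology (top_of_set (total_pts m)) {X \<in> topspace (top_of_set (total_pts m)). proj_mat m X = S0})) h"
    by (simp only: prod_topology_subtopology_eu)
  moreover have "\<forall>X\<in>topspace (top_of_set (total_pts m)). proj_mat m X \<in> U \<longrightarrow> fst (h X) = proj_mat m X"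
    by (simp add: h_def)
  ultimately show "\<exists>U h. openin (top_of_set (base_pts m)) U \<and> S0 \<in> U \<and>
        homeomorphic_map (subtopology (top_of_set (total_pts m)) {X \<in> topspace (top_of_set (total_pts m)). proj_mat m X \<in> U})
          (prod_topology (subtopology (top_of_set (base_pts m)) U)
            (subtopology (top_of_set (total_pts m)) {X \<in> topspace (top_of_set (total_pts m)). proj_mat m X = S0})) h \<and>
        (\<forall>X\<in>topspace (top_of_set (total_pts m)). proj_mat m X \<in> U \<longrightarrow> fst (h X) = proj_mat m X)"
    using openU S0U by blast
qed

section \<open>Passage to projective space\<close>

lemma span_singleton_eqD:
  fixes X Y :: "'a::real_vector"
  assumes "span {X} = span {Y}" "X \<noteq> 0" obtains c where "c \<noteq> 0" "X = c *\<^sub>R Y"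
proof -
  have "X \<in> span {Y}" using assms(1) span_base[of X "{X}"] by simp
  then obtain c where "X = c *\<^sub>R Y" by (auto simp: span_singleton)
  then show ?thesis using assms(2) that[of c] by auto
qed

lemma span_scaled:
  fixes X :: "'a::real_vector"
  assumes "c \<noteq> 0" shows "span {c *\<^sub>R X} = span {X}"
proof (intro equalityI span_minimal subspace_span)
  show "{c *\<^sub>R X} \<subseteq> span {X}" by (simp add: span_base span_scale)
  have "(1/c) *\<^sub>R (c *\<^sub>R X) \<in> span {c *\<^sub>R X}" by (intro span_scale span_base) simp
  then show "{X} \<subseteq> span {c *\<^sub>R X}" using assms by simp
qed

lemma topspace_proj_topology: "topspace (proj_topology V) = proj_space V"
proof
  show "topspace (proj_topology V) \<subseteq> proj_space V"
    using openin_topspace[of "proj_topology V"] unfolding openin_proj_topology by blast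
  have "{x \<in> V - {0}. span {x} \<in> proj_space V} = V - {0}" by (auto simp: proj_space_def)
  then have "openin (proj_topology V) (proj_space V)" unfolding openin_proj_topology by simp
  then show "proj_space V \<subseteq> topspace (proj_topology V)" by (rule openin_subset)
qed

lemma continuous_map_span: "continuous_map (top_of_set (V - {0})) (proj_topology V) (\<lambda>X. span {X})"
  unfolding continuous_map_def topspace_proj_topology openin_proj_topology
  by (auto simp: proj_space_def)

text \<open>The inverse of the chart that sends a matrix of trace 1 to its line.\<close>

definition tr_rep :: "omat set \<Rightarrow> omat" where
  "tr_rep L = (THE X. X \<in> L \<and> herm_trace X = 1)"

lemma tr_rep_span:
  assumes "herm_trace X \<noteq> 0" shows "tr_rep (span {X}) = (1 / herm_trace X) *\<^sub>R X"
  unfolding tr_rep_def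
proof (rule the_equality)
  show "(1 / herm_trace X) *\<^sub>R X \<in> span {X} \<and> herm_trace ((1 / herm_trace X) *\<^sub>R X) = 1"
    using assms by (simp add: herm_trace_scaleR span_scale span_base)
  fix Y assume Y: "Y \<in> span {X} \<and> herm_trace Y = 1"
  then obtain c where "Y = c *\<^sub>R X" by (auto simp: span_singleton)
  then show "Y = (1 / herm_trace X) *\<^sub>R X" using Y assms by (simp add: herm_trace_scaleR field_simps)
qed

lemma Herm1_nonzero: "Q \<subseteq> Herm1 n \<Longrightarrow> Q \<subseteq> Herm n - {0}"
  by (auto simp: Herm1_def herm_trace_def)

text \<open>A line meets the slice of trace 1 in at most one point, so distinct points of the slice
  span distinct lines.\<close>

lemma to_proj_diff:
  assumes "A \<subseteq> Herm1 n" "B \<subseteq> Herm1 n" shows "to_proj A - to_proj B = to_proj (A - B)"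
proof -
  have rep: "tr_rep (span {X}) = X" if "X \<in> Herm1 n" for X
    using tr_rep_span[of X] that by (simp add: Herm1_def)
  have eq: "X = Y" if XY: "X \<in> A" "Y \<in> B" and s: "span {X} = span {Y}" for X Y
  proof -
    have "X = tr_rep (span {X})" using rep subsetD[OF assms(1) XY(1)] by simp
    also have "\<dots> = tr_rep (span {Y})" by (simp only: s)
    also have "\<dots> = Y" using rep subsetD[OF assms(2) XY(2)] by simp
    finally show ?thesis .
  qed
  show ?thesis
  proof (intro equalityI subsetI)
    fix L assume "L \<in> to_proj A - to_proj B"
    then obtain X where X: "X \<in> A" "L = span {X}" "span {X} \<notin> to_proj B" unfolding to_proj_def by blast
    then have "X \<notin> B" unfolding to_proj_def by blast
    then show "L \<in> to_proj (A - B)" using X(1,2) unfolding to_proj_def by blast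
  next
    fix L assume "L \<in> to_proj (A - B)"
    then obtain X where X: "X \<in> A" "X \<notin> B" "L = span {X}" unfolding to_proj_def by blast
    have "L \<notin> to_proj B"
    proof
      assume "L \<in> to_proj B"
      then obtain Y where "Y \<in> B" "L = span {Y}" unfolding to_proj_def by blast
      then show False using eq[OF X(1)] X(2,3) by metis
    qed
    then show "L \<in> to_proj A - to_proj B" using X(1,3) unfolding to_proj_def by blast
  qed
qed

lemma topspace_lines:
  assumes "Q \<subseteq> Herm1 n" shows "topspace (subtopology (proj_topology (Herm n)) (to_proj Q)) = to_proj Q"
proof -
  have "to_proj Q \<subseteq> proj_space (Herm n)"
    unfolding to_proj_def proj_space_def using Herm1_nonzero[OF assms] by (intro image_subsetI) blast
  then show ?thesis unfolding topspace_subtopology topspace_proj_topology by (rule Int_absorb1)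
qed

text \<open>The topology on lines is a quotient topology, so continuity of the inverse chart amounts
  to openness of saturated sets of nonzero matrices.\<close>

lemma homeomorphic_maps_lines:
  assumes Q: "Q \<subseteq> Herm1 n"
  shows "homeomorphic_maps (top_of_set Q) (subtopology (proj_topology (Herm n)) (to_proj Q)) (\<lambda>X. span {X}) tr_rep"
  unfolding homeomorphic_maps_def topspace_lines[OF Q] topspace_euclidean_subtopology
proof (intro conjI ballI)
  let ?V = "Herm n"
  have tr: "tr_rep (span {X}) = X" if "X \<in> Q" for X
    using tr_rep_span[of X] that Q by (auto simp: Herm1_def)
  have "continuous_map (top_of_set Q) (proj_topology ?V) (\<lambda>X. span {X})"
    using continuous_map_span Herm1_nonzero[OF Q] by (rule continuous_map_from_subtopology_mono)
  then show "continuous_map (top_of_set Q) (subtopology (proj_topology ?V) (to_proj Q)) (\<lambda>X. span {X})"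
    unfolding continuous_map_in_subtopology by (auto simp: to_proj_def)
  show "tr_rep (span {X}) = X" if "X \<in> Q" for X using tr[OF that] .
  show "span {tr_rep L} = L" if L: "L \<in> to_proj Q" for L
  proof -
    obtain X where "X \<in> Q" "L = span {X}" using L unfolding to_proj_def by blast
    then show ?thesis using tr by simp
  qed
  have "openin (subtopology (proj_topology ?V) (to_proj Q)) {L \<in> to_proj Q. tr_rep L \<in> W}" if W: "open W" for W
  proof -
    \<comment> \<open>The cone over W: open, and invariant under nonzero scalars, hence
      saturated.\<close>
    define G where "G = {X. herm_trace X \<noteq> 0 \<and> (1 / herm_trace X) *\<^sub>R X \<in> W}"
    have o: "open {X. herm_trace X \<noteq> 0}"
      by (rule open_Collect_neq[OF continuous_on_trace continuous_on_const])
    have "continuous_on {X. herm_trace X \<noteq> 0} (\<lambda>X. (1 / herm_trace X) *\<^sub>R X)"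
      by (intro continuous_on_scaleR continuous_on_divide continuous_on_const continuous_on_trace continuous_on_id) simp
    from continuous_open_preimage[OF this o W] have oG: "open G"
      by (simp add: G_def vimage_def Int_def conj_commute)
    define T where "T = (\<lambda>X. span {X}) ` (G \<inter> ?V)"
    have G0: "X \<noteq> 0" if "X \<in> G" for X using that by (auto simp: G_def herm_trace_def)
    have GT: "span {X} \<in> T \<longleftrightarrow> X \<in> G" if X: "X \<in> ?V - {0}" for X
    proof
      assume "span {X} \<in> T"
      then obtain Y where Y: "Y \<in> G" "span {X} = span {Y}" unfolding T_def by blast
      then obtain c where c: "c \<noteq> 0" "X = c *\<^sub>R Y" using X by (elim span_singleton_eqD) auto
      then show "X \<in> G" using Y(1) by (simp add: G_def herm_trace_scaleR)
    qed (use X in \<open>auto simp: T_def\<close>)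
    have "{X \<in> ?V - {0}. span {X} \<in> T} = (?V - {0}) \<inter> G" using GT by blast
    moreover have "T \<subseteq> proj_space ?V" unfolding T_def proj_space_def using G0 by blast
    ultimately have "openin (proj_topology ?V) T"
      unfolding openin_proj_topology using oG by (simp add: openin_open_Int)
    moreover have "{L \<in> to_proj Q. tr_rep L \<in> W} = T \<inter> to_proj Q"
    proof -
      have "tr_rep (span {X}) \<in> W \<longleftrightarrow> span {X} \<in> T" if "X \<in> Q" for X
      proof -
        have "X \<in> ?V - {0}" "herm_trace X = 1" using that Q Herm1_nonzero[OF Q] by (auto simp: Herm1_def)
        then show ?thesis using GT[of X] tr[OF that] by (simp add: G_def)
      qed
      then show ?thesis unfolding to_proj_def by blast
    qed
    ultimately show ?thesis unfolding openin_subtopology by blast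
  qed
  then have "continuous_map (subtopology (proj_topology ?V) (to_proj Q)) euclidean tr_rep"
    unfolding continuous_map_def topspace_lines[OF Q] by simp
  moreover have "tr_rep L \<in> Q" if L: "L \<in> to_proj Q" for L
  proof -
    obtain X where "X \<in> Q" "L = span {X}" using L unfolding to_proj_def by blast
    then show ?thesis using tr by simp
  qed
  ultimately show "continuous_map (subtopology (proj_topology ?V) (to_proj Q)) (top_of_set Q) tr_rep"
    unfolding continuous_map_in_subtopology topspace_lines[OF Q] by blast
qed

section \<open>Transfer of fibrations along homeomorphisms\<close>

lemma locally_trivial_fibration_transfer:
  assumes E: "homeomorphic_maps E E' f f'" and B: "homeomorphic_maps B B' g g'"
    and comm: "\<And>x. x \<in> topspace E \<Longrightarrow> p' (f x) = g (p x)"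
    and p: "locally_trivial_fibration E B p"
  shows "locally_trivial_fibration E' B' p'"
proof -
  have f: "continuous_map E E' f" "continuous_map E' E f'" "\<And>x. x \<in> topspace E \<Longrightarrow> f' (f x) = x"
    "\<And>y. y \<in> topspace E' \<Longrightarrow> f (f' y) = y"
    using E by (auto simp: homeomorphic_maps_def)
  have g: "continuous_map B B' g" "continuous_map B' B g'" "\<And>x. x \<in> topspace B \<Longrightarrow> g' (g x) = x"
    "\<And>y. y \<in> topspace B' \<Longrightarrow> g (g' y) = y"
    using B by (auto simp: homeomorphic_maps_def)
  have f_in: "\<And>x. x \<in> topspace E \<Longrightarrow> f x \<in> topspace E'" "\<And>y. y \<in> topspace E' \<Longrightarrow> f' y \<in> topspace E"
    and g_in: "\<And>x. x \<in> topspace B \<Longrightarrow> g x \<in> topspace B'" "\<And>y. y \<in> topspace B' \<Longrightarrow> g' y \<in> topspace B"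
    using continuous_map_funspace[OF f(1)] continuous_map_funspace[OF f(2)]
      continuous_map_funspace[OF g(1)] continuous_map_funspace[OF g(2)] by (simp_all add: Pi_iff)
  have pc: "continuous_map E B p" and ps: "p ` topspace E = topspace B"
    using p by (auto simp: locally_trivial_fibration_def)
  have p': "p' y = g (p (f' y))" if "y \<in> topspace E'" for y using comm[OF f_in(2)[OF that]] f(4)[OF that] by simp
  have p_in: "p x \<in> topspace B" if "x \<in> topspace E" for x using ps that by blast
  show ?thesis
    unfolding locally_trivial_fibration_def
  proof (intro conjI ballI)
    have "continuous_map E' B' (g \<circ> (p \<circ> f'))"
      by (intro continuous_map_compose[OF _ g(1)] continuous_map_compose[OF f(2) pc])
    then show "continuous_map E' B' p'" by (rule continuous_map_eq) (simp add: p')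
    show "p' ` topspace E' = topspace B'"
    proof (intro equalityI subsetI)
      fix b assume b: "b \<in> topspace B'"
      then obtain x where x: "x \<in> topspace E" "g' b = p x" using g_in(2)[OF b] ps by blast
      then have "b = p' (f x)" using comm[OF x(1)] g(4)[OF b] by simp
      then show "b \<in> p' ` topspace E'" using f_in(1)[OF x(1)] by (rule image_eqI)
    next
      fix b assume "b \<in> p' ` topspace E'"
      then obtain y where "y \<in> topspace E'" "b = p' y" by blast
      then show "b \<in> topspace B'" using p' f_in(2) p_in g_in(1) by simp
    qed
  next
    fix b' assume b': "b' \<in> topspace B'"
    define b where "b = g' b'"
    have b: "b \<in> topspace B" "g b = b'" using g_in(2)[OF b'] g(4)[OF b'] by (simp_all add: b_def)
    have "\<exists>U h. openin B U \<and> b \<in> U \<and> homeomorphic_map (subtopology E {x \<in> topspace E. p x \<in> U})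
          (prod_topology (subtopology B U) (subtopology E {x \<in> topspace E. p x = b})) h
        \<and> (\<forall>x\<in>topspace E. p x \<in> U \<longrightarrow> fst (h x) = p x)"
      using p b(1) unfolding locally_trivial_fibration_def by simp
    then obtain U h where U: "openin B U" "b \<in> U"
      and h: "homeomorphic_map (subtopology E {x \<in> topspace E. p x \<in> U})
          (prod_topology (subtopology B U) (subtopology E {x \<in> topspace E. p x = b})) h"
      and hp: "\<forall>x\<in>topspace E. p x \<in> U \<longrightarrow> fst (h x) = p x"
      by (elim exE conjE)
    have UB: "U \<subseteq> topspace B" using U(1) by (rule openin_subset)
    let ?EU = "{x \<in> topspace E. p x \<in> U}" and ?Eb = "{x \<in> topspace E. p x = b}"
    let ?EU' = "{y \<in> topspace E'. p' y \<in> g ` U}" and ?Eb' = "{y \<in> topspace E'. p' y = b'}"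
    have hf: "homeomorphic_map E E' f" and hf': "homeomorphic_map E' E f'" and hg: "homeomorphic_map B B' g"
      using E B unfolding homeomorphic_maps_map by simp_all
    have inj: "inj_on g (topspace B)" using g(3) by (rule inj_on_inverseI)
    have mem: "p' (f x) \<in> g ` U \<longleftrightarrow> p x \<in> U" "p' (f x) = b' \<longleftrightarrow> p x = b" if x: "x \<in> topspace E" for x
      unfolding comm[OF x] b(2)[symmetric]
      using inj_on_image_mem_iff[OF inj p_in[OF x] UB] inj_on_eq_iff[OF inj p_in[OF x] b(1)] by simp_all
    have mem': "p' y \<in> g ` U \<longleftrightarrow> p (f' y) \<in> U" if "y \<in> topspace E'" for y
      using mem(1)[OF f_in(2)[OF that]] f(4)[OF that] by simp
    have 1: "homeomorphic_map (subtopology E' ?EU') (subtopology E ?EU) f'"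
      by (rule homeomorphic_map_subtopologies_alt[OF hf']) (simp add: mem' f_in(2))
    have 2: "homeomorphic_map (subtopology E ?Eb) (subtopology E' ?Eb') f"
      by (rule homeomorphic_map_subtopologies_alt[OF hf]) (simp add: mem(2))
    have 3: "homeomorphic_map (subtopology B U) (subtopology B' (g ` U)) g"
      by (rule homeomorphic_map_subtopologies_alt[OF hg]) (simp add: inj_on_image_mem_iff[OF inj _ UB])
    obtain f2 where f2: "homeomorphic_maps (subtopology E ?Eb) (subtopology E' ?Eb') f f2"
      using 2 unfolding homeomorphic_map_maps ..
    obtain g2 where g2: "homeomorphic_maps (subtopology B U) (subtopology B' (g ` U)) g g2"
      using 3 unfolding homeomorphic_map_maps ..
    have "homeomorphic_maps (prod_topology (subtopology B U) (subtopology E ?Eb))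
        (prod_topology (subtopology B' (g ` U)) (subtopology E' ?Eb')) (\<lambda>(x, y). (g x, f y)) (\<lambda>(x, y). (g2 x, f2 y))"
      unfolding homeomorphic_maps_prod using f2 g2 by simp
    then have 4: "homeomorphic_map (prod_topology (subtopology B U) (subtopology E ?Eb))
        (prod_topology (subtopology B' (g ` U)) (subtopology E' ?Eb')) (\<lambda>(x, y). (g x, f y))"
      by (rule homeomorphic_maps_map[THEN iffD1, THEN conjunct1])
    \<comment> \<open>The given trivialisation, conjugated by the homeomorphisms of the total space,
      the base and the fibre.\<close>
    define h' where "h' = (\<lambda>(x, y). (g x, f y)) \<circ> (h \<circ> f')"
    have "homeomorphic_map (subtopology E' ?EU') (prod_topology (subtopology B' (g ` U)) (subtopology E' ?Eb')) h'"
      unfolding h'_def by (rule homeomorphic_map_compose[OF homeomorphic_map_compose[OF 1 h] 4])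
    moreover have "\<forall>y\<in>topspace E'. p' y \<in> g ` U \<longrightarrow> fst (h' y) = p' y"
    proof (intro ballI impI)
      fix y assume y: "y \<in> topspace E'" "p' y \<in> g ` U"
      then have "fst (h (f' y)) = p (f' y)" using hp f_in(2) mem' by blast
      then show "fst (h' y) = p' y" using p'[OF y(1)] by (simp add: h'_def case_prod_unfold)
    qed
    moreover have "openin B' (g ` U)" using homeomorphic_map_openness[OF hg UB] U(1) by simp
    moreover have "b' \<in> g ` U" using U(2) b(2) by blast
    ultimately show "\<exists>U h. openin B' U \<and> b' \<in> U \<and>
        homeomorphic_map (subtopology E' {x \<in> topspace E'. p' x \<in> U})
          (prod_topology (subtopology B' U) (subtopology E' {x \<in> topspace E'. p' x = b'})) h \<and>
        (\<forall>x\<in>topspace E'. p' x \<in> U \<longrightarrow> fst (h x) = p' x)"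
      by (intro exI[of _ "g ` U"] exI[of _ h'] conjI)
  qed
qed

subsection \<open>Groups of linear maps acting on lines\<close>

lemma group_action_lines:
  assumes G: "subgroup \<G> (BijGroup V)" and S: "\<And>L. L \<in> S \<Longrightarrow> L \<subseteq> V"
    and inv: "\<And>g. g \<in> \<G> \<Longrightarrow> \<exists>g'\<in>\<G>. \<forall>x\<in>V. g' (g x) = x \<and> g (g' x) = x"
    and closed: "\<And>g L. g \<in> \<G> \<Longrightarrow> L \<in> S \<Longrightarrow> g ` L \<in> S"
    and \<phi>: "\<And>g. g \<in> \<G> \<Longrightarrow> \<phi> g = (\<lambda>L\<in>S. g ` L)"
  shows "group_action (BijGroup V \<lparr>carrier := \<G>\<rparr>) S \<phi>"
proof (intro group_action.intro group_hom.intro group_hom_axioms.intro)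
  show "group (BijGroup V \<lparr>carrier := \<G>\<rparr>)" using G group_BijGroup by (rule subgroup.subgroup_is_group)
  show "group (BijGroup S)" by (rule group_BijGroup)
  have GB: "\<G> \<subseteq> Bij V" using subgroup.subset[OF G] by (simp add: BijGroup_def)
  have \<phi>_Bij: "\<phi> g \<in> Bij S" if g: "g \<in> \<G>" for g
  proof -
    obtain g' where g': "g' \<in> \<G>" "\<forall>x\<in>V. g' (g x) = x \<and> g (g' x) = x" using inv[OF g] by blast
    have "bij_betw (\<phi> g) S S"
    proof (rule bij_betwI[where g = "\<phi> g'"])
      have i: "g' ` (g ` L) = L" "g ` (g' ` L) = L" if "L \<in> S" for L
        using g'(2) S[OF that] by (force simp: image_image subset_iff)+
      show "\<phi> g' (\<phi> g L) = L" "\<phi> g (\<phi> g' L) = L" if "L \<in> S" for L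
        using that i closed g g'(1) by (simp_all add: \<phi>)
    qed (use closed g g'(1) in \<open>auto simp: \<phi>\<close>)
    then show ?thesis using \<phi>[OF g] by (simp add: Bij_def)
  qed
  show "\<phi> \<in> hom (BijGroup V \<lparr>carrier := \<G>\<rparr>) (BijGroup S)"
  proof (rule homI)
    fix g assume "g \<in> carrier (BijGroup V \<lparr>carrier := \<G>\<rparr>)"
    then show "\<phi> g \<in> carrier (BijGroup S)" using \<phi>_Bij by (simp add: BijGroup_def)
  next
    fix g h assume "g \<in> carrier (BijGroup V \<lparr>carrier := \<G>\<rparr>)" "h \<in> carrier (BijGroup V \<lparr>carrier := \<G>\<rparr>)"
    then have gh: "g \<in> \<G>" "h \<in> \<G>" by simp_all
    then have ghB: "g \<in> Bij V" "h \<in> Bij V" using GB by blast+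
    have m: "g \<otimes>\<^bsub>BijGroup V \<lparr>carrier := \<G>\<rparr>\<^esub> h = compose V g h"
      using ghB by (simp add: BijGroup_def)
    have c: "compose V g h \<in> \<G>"
      using subgroup.m_closed[OF G gh] ghB by (simp add: BijGroup_def)
    have "\<phi> (compose V g h) = compose S (\<phi> g) (\<phi> h)"
      unfolding \<phi>[OF c] unfolding compose_def
    proof (rule restrict_ext)
      fix L assume L: "L \<in> S"
      have "(\<lambda>x\<in>V. g (h x)) ` L = g ` (h ` L)" using S[OF L] by (force simp: image_image)
      then show "(\<lambda>x\<in>V. g (h x)) ` L = \<phi> g (\<phi> h L)" using gh L closed by (simp add: \<phi>)
    qed
    then show "\<phi> (g \<otimes>\<^bsub>BijGroup V \<lparr>carrier := \<G>\<rparr>\<^esub> h) = \<phi> g \<otimes>\<^bsub>BijGroup S\<^esub> \<phi> h"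
      unfolding m using \<phi>_Bij gh by (simp add: BijGroup_def)
  qed
qed

text \<open>Pointwise convergence controls g at each fixed vector; joint continuity comes from
  expanding x in a finite orthonormal basis, where g x is the sum of the vectors g b with
  coefficients depending on x alone.\<close>

lemma continuous_on_GL_apply:
  fixes V :: "'v::euclidean_space set"
  assumes V: "subspace V" and G: "\<G> \<subseteq> GL_on V"
  shows "continuous_on (\<G> \<times> V) (\<lambda>P. fst P (snd P))"
proof -
  have "\<exists>B. B \<subseteq> V \<and> pairwise orthogonal B \<and> (\<forall>x\<in>B. norm x = 1) \<and> independent B \<and> span B = V"
    by (rule orthonormal_basis_subspace[OF V], rule exI) (intro conjI ballI; (assumption | simp))
  then obtain B where B: "B \<subseteq> V" "pairwise orthogonal B" "\<forall>x\<in>B. norm x = 1" "independent B" "span B = V"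
    by (elim exE conjE)
  have fin: "finite B" using B(4) by (rule independent_imp_finite)
  have lin: "g (\<Sum>b\<in>F. c b *\<^sub>R b) = (\<Sum>b\<in>F. c b *\<^sub>R g b)" if g: "g \<in> \<G>" and "finite F" "F \<subseteq> B" for g F c
    using that(2,3)
  proof (induction F rule: finite_induct)
    case empty
    have "g \<in> GL_on V" using g G by blast
    then have "g (0 *\<^sub>R 0) = 0 *\<^sub>R g 0" using subspace_0[OF V] unfolding GL_on_def by blast
    then show ?case by simp
  next
    case (insert b F)
    have FV: "F \<subseteq> V" "b \<in> V" using insert.prems B(1) by blast+
    have m: "(\<Sum>b\<in>F. c b *\<^sub>R b) \<in> V" "c b *\<^sub>R b \<in> V"
      using FV by (blast intro: subspace_sum[OF V] subspace_scale[OF V])+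
    have "g \<in> GL_on V" using g G by blast
    then have "g (c b *\<^sub>R b + (\<Sum>b\<in>F. c b *\<^sub>R b)) = c b *\<^sub>R g b + g (\<Sum>b\<in>F. c b *\<^sub>R b)"
      using m FV(2) by (simp add: GL_on_def)
    then show ?case using insert by simp
  qed
  have "continuous_on (\<G> \<times> V) (\<lambda>P. \<Sum>b\<in>B. inner (snd P) b *\<^sub>R fst P b)"
  proof (rule continuous_on_sum)
    fix b
    have "continuous_on (\<G> \<times> V) (\<lambda>P. fst P b)"
      by (rule continuous_on_product_then_coordinatewise[OF continuous_on_fst[OF continuous_on_id]])
    moreover have "continuous_on (\<G> \<times> V) (\<lambda>P. inner (snd P) b)"
      by (rule continuous_on_inner[OF continuous_on_snd[OF continuous_on_id] continuous_on_const])
    ultimately show "continuous_on (\<G> \<times> V) (\<lambda>P. inner (snd P) b *\<^sub>R fst P b)"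
      by (intro continuous_on_scaleR)
  qed
  moreover have "(\<Sum>b\<in>B. inner (snd P) b *\<^sub>R fst P b) = fst P (snd P)" if "P \<in> \<G> \<times> V" for P
  proof -
    have P: "fst P \<in> \<G>" "snd P \<in> V" using that by (simp_all add: mem_Times_iff)
    have "(\<Sum>b\<in>B. inner (snd P) b *\<^sub>R b) = snd P"
      using orthonormal_basis_expand[OF B(2) _ _ fin, of "snd P"] P(2) B(3,5) by simp
    then show ?thesis using lin[OF P(1) fin order_refl, of "\<lambda>b. inner (snd P) b"] by simp
  qed
  ultimately show ?thesis by (rule continuous_on_eq)
qed

lemma GL_image_span:
  assumes "g \<in> GL_on V" "X \<in> V" shows "g ` span {X} = span {g X}"
  using assms unfolding span_singleton by (auto simp: GL_on_def image_iff)

text \<open>A line is replaced by its point of trace 1, moved by g and spanned again. The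
  intermediate vector is only known to be nonzero, since g does not respect the trace. With k = n
  this serves the total space, with k = n - 1 the base.\<close>

lemma continuous_line_action:
  assumes G: "\<G> \<subseteq> GL_on (Herm n)" and k: "k \<le> n" and Gk: "\<And>g X. g \<in> \<G> \<Longrightarrow> X \<in> Herm k \<Longrightarrow> g X \<in> Herm k"
    and Q: "Q \<subseteq> Herm1 k" and closed: "\<And>g L. g \<in> \<G> \<Longrightarrow> L \<in> to_proj Q \<Longrightarrow> g ` L \<in> to_proj Q"
    and \<phi>: "\<And>g L. g \<in> \<G> \<Longrightarrow> L \<in> to_proj Q \<Longrightarrow> \<phi> g L = g ` L"
  shows "continuous_map (prod_topology (top_of_set \<G>) (subtopology (proj_topology (Herm k)) (to_proj Q)))
    (subtopology (proj_topology (Herm k)) (to_proj Q)) (\<lambda>(g, L). \<phi> g L)"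
proof -
  let ?E = "subtopology (proj_topology (Herm k)) (to_proj Q)"
  let ?P = "prod_topology (top_of_set \<G>) ?E"
  note hom = homeomorphic_maps_lines[OF Q]
  have tr: "continuous_map ?E (top_of_set Q) tr_rep" "\<And>L. L \<in> to_proj Q \<Longrightarrow> span {tr_rep L} = L"
    "\<And>L. L \<in> to_proj Q \<Longrightarrow> tr_rep L \<in> Q"
  proof -
    show 1: "continuous_map ?E (top_of_set Q) tr_rep" "\<And>L. L \<in> to_proj Q \<Longrightarrow> span {tr_rep L} = L"
      using hom unfolding homeomorphic_maps_def topspace_lines[OF Q] by blast+
    show "\<And>L. L \<in> to_proj Q \<Longrightarrow> tr_rep L \<in> Q"
      using continuous_map_funspace[OF 1(1)] unfolding topspace_lines[OF Q] topspace_euclidean_subtopology by blast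
  qed
  have QH: "X \<in> Herm k" "X \<in> Herm n" "X \<noteq> 0" if "X \<in> Q" for X
    using Herm1_nonzero[OF Q] that Herm_mono[OF k] by blast+
  have nz: "g X \<noteq> 0" if g: "g \<in> \<G>" and X: "X \<in> Herm n" "X \<noteq> 0" for g X
  proof
    assume "g X = 0"
    have gl: "g \<in> GL_on (Herm n)" using g G by blast
    have "g 0 = g (0 *\<^sub>R X)" by simp
    also have "\<dots> = 0 *\<^sub>R g X" using gl X(1) unfolding GL_on_def by blast
    finally have "g 0 = g X" using \<open>g X = 0\<close> by simp
    moreover have "inj_on g (Herm n)" using gl by (auto simp: GL_on_def Bij_def bij_betw_def)
    ultimately show False using X Herm_intros(5) by (metis inj_onD)
  qed
  have "continuous_on (\<G> \<times> Q) (\<lambda>P. fst P (snd P))"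
    by (rule continuous_on_subset[OF continuous_on_GL_apply[OF subspace_Herm G]]) (use QH(2) in blast)
  then have 1: "continuous_map (prod_topology (top_of_set \<G>) (top_of_set Q)) (top_of_set (Herm k - {0})) (\<lambda>P. fst P (snd P))"
    unfolding prod_topology_subtopology_eu continuous_map_in_subtopology topspace_euclidean_subtopology
      continuous_map_iff_continuous
    using Gk QH nz by (intro conjI funcsetI) (simp_all add: mem_Times_iff)
  have "continuous_map ?P (top_of_set Q) (tr_rep \<circ> snd)"
    by (rule continuous_map_compose[OF continuous_map_snd tr(1)])
  then have 2: "continuous_map ?P (prod_topology (top_of_set \<G>) (top_of_set Q)) (\<lambda>x. (fst x, (tr_rep \<circ> snd) x))"
    by (intro continuous_map_pairedI continuous_map_fst)
  have "continuous_map ?P (proj_topology (Herm k)) ((\<lambda>X. span {X}) \<circ> ((\<lambda>P. fst P (snd P)) \<circ> (\<lambda>x. (fst x, (tr_rep \<circ> snd) x))))"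
    by (intro continuous_map_compose[OF _ continuous_map_span] continuous_map_compose[OF 2 1])
  then have 3: "continuous_map ?P (proj_topology (Herm k)) (\<lambda>(g, L). \<phi> g L)"
  proof (rule continuous_map_eq)
    fix x assume "x \<in> topspace ?P"
    then have x: "fst x \<in> \<G>" "snd x \<in> to_proj Q" unfolding topspace_prod_topology topspace_lines[OF Q] by auto
    have "fst x ` span {tr_rep (snd x)} = span {fst x (tr_rep (snd x))}"
      using GL_image_span x(1) G QH(2)[OF tr(3)[OF x(2)]] by blast
    then show "((\<lambda>X. span {X}) \<circ> ((\<lambda>P. fst P (snd P)) \<circ> (\<lambda>x. (fst x, (tr_rep \<circ> snd) x)))) x = (\<lambda>(g, L). \<phi> g L) x"
      using \<phi>[OF x] tr(2)[OF x(2)] by (simp add: case_prod_unfold)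
  qed
  show ?thesis
    unfolding continuous_map_in_subtopology
  proof (intro conjI 3 funcsetI)
    fix x assume "x \<in> topspace ?P"
    then have x: "fst x \<in> \<G>" "snd x \<in> to_proj Q" unfolding topspace_prod_topology topspace_lines[OF Q] by auto
    then show "(\<lambda>(g, L). \<phi> g L) x \<in> to_proj Q" using \<phi> closed by (simp add: case_prod_unfold)
  qed
qed

subsection \<open>Homogeneity and the fibration\<close>

lemma G_subE:
  assumes "m \<le> 2" "g \<in> G_sub (Suc m)"
  obtains A B where "(A, B) \<in> sl_pairs m" "g = restrict (act m A B) (Herm (Suc m))"
  using assms(2) unfolding G_sub_eq_act[OF assms(1)] by blast

lemma G_subI: "m \<le> 2 \<Longrightarrow> (A, B) \<in> sl_pairs m \<Longrightarrow> restrict (act m A B) (Herm (Suc m)) \<in> G_sub (Suc m)"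
  unfolding G_sub_eq_act by blast

lemma G_sub_GL: "m \<le> 2 \<Longrightarrow> G_sub (Suc m) \<subseteq> GL_on (Herm (Suc m))"
  using act_in_GL_on by (metis G_subE subsetI)

lemma G_sub_inverse:
  assumes "m \<le> 2" "g \<in> G_sub (Suc m)"
  shows "\<exists>g'\<in>G_sub (Suc m). \<forall>X\<in>Herm (Suc m). g' (g X) = X \<and> g (g' X) = X"
proof -
  obtain A B where AB: "(A, B) \<in> sl_pairs m" "g = restrict (act m A B) (Herm (Suc m))"
    using assms by (rule G_subE)
  note BA = sl_pairs_swap[OF assms(1) AB(1)]
  have "\<forall>X\<in>Herm (Suc m). restrict (act m B A) (Herm (Suc m)) (g X) = X \<and> g (restrict (act m B A) (Herm (Suc m)) X) = X"
    unfolding AB(2)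
    using act_inverse[OF assms(1) AB(1)] act_closed(3)[OF assms(1) AB(1)] act_closed(3)[OF assms(1) BA] by simp
  then show ?thesis using G_subI[OF assms(1) BA] by (rule bexI)
qed

lemma subgroup_G_sub:
  assumes "m \<le> 2" shows "subgroup (G_sub (Suc m)) (BijGroup (Herm (Suc m)))"
proof (rule group.subgroupI[OF group_BijGroup])
  let ?V = "Herm (Suc m)"
  have B: "G_sub (Suc m) \<subseteq> Bij ?V" using G_sub_GL[OF assms] by (auto simp: GL_on_def)
  then show "G_sub (Suc m) \<subseteq> carrier (BijGroup ?V)" by (simp add: BijGroup_def)
  show "G_sub (Suc m) \<noteq> {}" using G_subI[OF assms sl_pairs_one[OF assms]] by blast
  fix g assume g: "g \<in> G_sub (Suc m)"
  obtain g' where g': "g' \<in> G_sub (Suc m)" "\<forall>X\<in>?V. g' (g X) = X \<and> g (g' X) = X"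
    using G_sub_inverse[OF assms g] by blast
  have gB: "g \<in> Bij ?V" "g' \<in> Bij ?V" using g g'(1) B by blast+
  have "compose ?V g' g = (\<lambda>X\<in>?V. X)" unfolding compose_def using g'(2) by (intro restrict_ext) simp
  then have "g' \<otimes>\<^bsub>BijGroup ?V\<^esub> g = \<one>\<^bsub>BijGroup ?V\<^esub>" using gB by (simp add: BijGroup_def)
  then have "inv\<^bsub>BijGroup ?V\<^esub> g = g'"
    using gB by (intro group.inv_equality[OF group_BijGroup]) (simp_all add: BijGroup_def)
  then show "inv\<^bsub>BijGroup ?V\<^esub> g \<in> G_sub (Suc m)" using g'(1) by simp
  fix h assume h: "h \<in> G_sub (Suc m)"
  have hB: "h \<in> Bij ?V" using h B by blast
  obtain A B where AB: "(A, B) \<in> sl_pairs m" "g = restrict (act m A B) ?V" using assms g by (rule G_subE)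
  obtain A' B' where AB': "(A', B') \<in> sl_pairs m" "h = restrict (act m A' B') ?V" using assms h by (rule G_subE)
  have "compose ?V g h = restrict (act m (A \<odot>\<odot> A') (B' \<odot>\<odot> B)) ?V"
    unfolding compose_def AB(2) AB'(2)
    using act_act[OF assms AB(1) AB'(1)] act_closed(3)[OF assms AB'(1)] by (intro restrict_ext) simp
  then show "g \<otimes>\<^bsub>BijGroup ?V\<^esub> h \<in> G_sub (Suc m)"
    using gB hB G_subI[OF assms sl_pairs_mult[OF assms AB(1) AB'(1)]] by (simp add: BijGroup_def)
qed

lemma act_on_Herm:
  assumes "m \<le> 2" "S \<in> Herm m" shows "act m A B S = congruence A S"
  using act_emb[OF assms, of 0 A B] by (simp add: vec_over_def row_mult_def zero_vec_def[symmetric])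

lemma G_sub_Herm:
  assumes "m \<le> 2" "g \<in> G_sub (Suc m)" "S \<in> Herm m" shows "g S \<in> Herm m"
proof -
  obtain A B where AB: "(A, B) \<in> sl_pairs m" "g = restrict (act m A B) (Herm (Suc m))"
    using assms(1,2) by (rule G_subE)
  have "S \<in> Herm (Suc m)" by (rule Herm_mono[OF _ assms(3)]) simp
  then show ?thesis
    using act_closed(1)[OF assms(1) AB(1) assms(3)] by (simp add: AB(2) act_on_Herm[OF assms(1,3)])
qed

text \<open>On H_m the row v is zero and the action is plain congruence; every A in SL(3, A_m) has
  an inverse to be paired with, so all of the prescribed group is reached.\<close>

lemma G_sub_restrict:
  assumes "m \<le> 2" shows "(\<lambda>g. restrict g (Herm m)) ` G_sub (Suc m) = G_lin m"
proof -
  have r: "restrict (restrict (act m A B) (Herm (Suc m))) (Herm m) = restrict (congruence A) (Herm m)" for A B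
  proof (rule restrict_ext)
    fix S assume S: "S \<in> Herm m"
    have "S \<in> Herm (Suc m)" by (rule Herm_mono[OF _ S]) simp
    then show "restrict (act m A B) (Herm (Suc m)) S = congruence A S" by (simp add: act_on_Herm[OF assms S])
  qed
  have G: "G_lin m = {restrict (congruence A) (Herm m) | A. A \<in> SL3 m}" using assms by (simp add: G_lin_def)
  show ?thesis
  proof (intro equalityI subsetI)
    fix f assume "f \<in> (\<lambda>g. restrict g (Herm m)) ` G_sub (Suc m)"
    then obtain g where g: "g \<in> G_sub (Suc m)" "f = restrict g (Herm m)" by blast
    obtain A B where AB: "(A, B) \<in> sl_pairs m" "g = restrict (act m A B) (Herm (Suc m))"
      using assms g(1) by (rule G_subE)
    then show "f \<in> G_lin m" unfolding G g(2) AB(2) r using sl_pairsD(1)[OF AB(1)] by blast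
  next
    fix f assume "f \<in> G_lin m"
    then obtain A where A: "A \<in> SL3 m" "f = restrict (congruence A) (Herm m)" unfolding G by blast
    obtain B where B: "(A, B) \<in> sl_pairs m" using assms A(1) by (rule SL3_pair)
    have "f = restrict (restrict (act m A B) (Herm (Suc m))) (Herm m)" unfolding r A(2) ..
    then show "f \<in> (\<lambda>g. restrict g (Herm m)) ` G_sub (Suc m)" using G_subI[OF assms B] by (rule image_eqI)
  qed
qed

lemma proj_mat_span: "proj_mat m ` span {X} = span {proj_mat m X}"
  using linear_span_image[OF linear_proj_mat, of m "{X}"] by simp

lemma proj_mat_equivariant:
  assumes "m \<le> 2" "g \<in> G_sub (Suc m)" "X \<in> Herm (Suc m)"
  shows "proj_mat m (g X) = g (proj_mat m X)"
proof -
  obtain A B where AB: "(A, B) \<in> sl_pairs m" "g = restrict (act m A B) (Herm (Suc m))"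
    using assms(1,2) by (rule G_subE)
  obtain S v where X: "X = emb m S v" "S \<in> Herm m" "v \<in> vec_over m" using assms(1,3) by (rule emb_cases)
  have S: "S \<in> Herm (Suc m)" by (rule Herm_mono[OF _ X(2)]) simp
  have "proj_mat m (g X) = congruence A S"
    using assms(3) act_closed(1,2)[OF assms(1) AB(1)] X
    by (simp add: AB(2) act_emb[OF assms(1)] proj_mat_emb[OF assms(1)])
  also have "\<dots> = g (proj_mat m X)"
    using S X by (simp add: AB(2) proj_mat_emb[OF assms(1)] act_on_Herm[OF assms(1)])
  finally show ?thesis .
qed

text \<open>Invariance and transitivity are shown upstairs and pushed down: every line of the base
  lifts, and the projection is equivariant. Local triviality is transferred from the slices of trace
  1.\<close>

lemma homogeneous_fibration_lines:
  assumes m: "m \<le> 2"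
  shows "homogeneous_fibration (BijGroup (Herm (Suc m)) \<lparr>carrier := G_sub (Suc m)\<rparr>)
        (total_space (Suc m)) (line_action (topspace (total_space (Suc m))))
        (base_space m)
        (\<lambda>g. line_action (topspace (base_space m)) (restrict g (Herm m)))
        (\<lambda>L. proj_mat m ` L)"
proof -
  let ?n = "Suc m" and ?V = "Herm (Suc m)" and ?G = "G_sub (Suc m)"
  let ?T = "to_proj (total_pts m)" and ?B = "to_proj (base_pts m)"
  have n: "?n \<le> 3" and m3: "m \<le> 3" using m by simp_all
  have TQ: "total_pts m \<subseteq> Herm1 ?n" using total_in_Herm1[OF m] by blast
  have BQ: "base_pts m \<subseteq> Herm1 m" using base_in_Herm1[OF m] by blast
  have "to_proj (Plane ?n) - to_proj (Plane m) = ?T"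
    unfolding total_pts_def
  proof (rule to_proj_diff)
    show "Plane ?n \<subseteq> Herm1 ?n" "Plane m \<subseteq> Herm1 ?n"
      using Herm1_mono[of m ?n] unfolding Plane_eq[OF n] Plane_eq[OF m3] by auto
  qed
  then have E: "total_space ?n = subtopology (proj_topology ?V) ?T" by (simp add: total_space_def)
  have "to_proj (Sigma_bd m) - to_proj (Plane m) = ?B"
    unfolding base_pts_def by (rule to_proj_diff) (auto simp: Sigma_bd_eq[OF m3] Plane_eq[OF m3])
  then have B: "base_space m = subtopology (proj_topology (Herm m)) ?B" by (simp add: base_space_def)
  note topE = topspace_lines[OF TQ] and topB = topspace_lines[OF BQ]
  note GL = G_sub_GL[OF m]
  have XV: "X \<in> ?V" if "X \<in> total_pts m" for X using TQ that by (auto simp: Herm1_def)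
  have SV: "S \<in> Herm m" "S \<in> ?V" if "S \<in> base_pts m" for S
    using BQ that Herm_mono[of m ?n S] by (auto simp: Herm1_def)
  have gl: "g ` span {X} = span {g X}" if "g \<in> ?G" "X \<in> ?V" for g X
    using GL_image_span subsetD[OF GL that(1)] that(2) by blast
  have T_line: "L \<subseteq> ?V" if "L \<in> ?T" for L
    using that span_minimal[of "{_}" ?V] XV subspace_Herm unfolding to_proj_def by auto
  have B_line: "L \<subseteq> Herm m" if "L \<in> ?B" for L
    using that span_minimal[of "{_}" "Herm m"] SV subspace_Herm unfolding to_proj_def by auto
  have projL: "proj_mat m ` span {X} = span {proj_mat m X}" for X by (rule proj_mat_span)
  have pT: "proj_mat m ` L \<in> ?B" if L: "L \<in> ?T" for L
  proof -
    obtain X where X: "X \<in> total_pts m" "L = span {X}" using L unfolding to_proj_def by blast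
    then have "proj_mat m X \<in> base_pts m" using proj_total[OF m] by blast
    then show ?thesis unfolding X(2) projL to_proj_def by blast
  qed
  have B_lift: "\<exists>L\<in>?T. proj_mat m ` L = K" if K: "K \<in> ?B" for K
  proof -
    obtain S where S: "S \<in> base_pts m" "K = span {S}" using K unfolding to_proj_def by blast
    obtain X where X: "X \<in> total_pts m" "S = proj_mat m X" using S(1) proj_total[OF m] by blast
    show ?thesis unfolding S(2) X(2) projL[symmetric] using X(1) unfolding to_proj_def by blast
  qed
  have equiv: "proj_mat m ` (g ` L) = g ` (proj_mat m ` L)" if g: "g \<in> ?G" and L: "L \<subseteq> ?V" for g L
    unfolding image_image using proj_mat_equivariant[OF m g] L by (intro image_cong) auto
  have closedT: "g ` L \<in> ?T" if g: "g \<in> ?G" and L: "L \<in> ?T" for g L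
  proof -
    obtain X where X: "X \<in> total_pts m" "L = span {X}" using L unfolding to_proj_def by blast
    obtain A C where AC: "(A, C) \<in> sl_pairs m" "g = restrict (act m A C) ?V" using m g by (rule G_subE)
    obtain c where c: "c \<noteq> 0" "c *\<^sub>R act m A C X \<in> total_pts m" using m AC(1) X(1) by (rule act_total)
    have "g ` L = span {g X}" unfolding X(2) by (rule gl[OF g XV[OF X(1)]])
    also have "\<dots> = span {c *\<^sub>R act m A C X}" using XV[OF X(1)] by (simp add: AC(2) span_scaled[OF c(1)])
    finally show ?thesis using c(2) unfolding to_proj_def by blast
  qed
  have closedB: "g ` K \<in> ?B" if g: "g \<in> ?G" and K: "K \<in> ?B" for g K
  proof -
    obtain L where L: "L \<in> ?T" "proj_mat m ` L = K" using B_lift[OF K] by blast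
    show ?thesis unfolding L(2)[symmetric] equiv[OF g T_line[OF L(1)], symmetric] by (rule pT[OF closedT[OF g L(1)]])
  qed
  have transT: "\<exists>g\<in>?G. g ` L = L'" if L: "L \<in> ?T" and L': "L' \<in> ?T" for L L'
  proof -
    obtain X where X: "X \<in> total_pts m" "L = span {X}" using L unfolding to_proj_def by blast
    obtain Y where Y: "Y \<in> total_pts m" "L' = span {Y}" using L' unfolding to_proj_def by blast
    obtain A C c where A: "(A, C) \<in> sl_pairs m" "c \<noteq> 0" "act m A C X = c *\<^sub>R Y"
      using m X(1) Y(1) by (rule act_transitive)
    let ?g = "restrict (act m A C) ?V"
    have g: "?g \<in> ?G" using m A(1) by (rule G_subI)
    have "?g ` L = span {?g X}" unfolding X(2) by (rule gl[OF g XV[OF X(1)]])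
    also have "\<dots> = L'" using XV[OF X(1)] by (simp add: A(3) span_scaled[OF A(2)] Y(2))
    finally show ?thesis using g by (rule bexI)
  qed
  have transB: "\<exists>g\<in>?G. g ` K = K'" if K: "K \<in> ?B" and K': "K' \<in> ?B" for K K'
  proof -
    obtain L where L: "L \<in> ?T" "proj_mat m ` L = K" using B_lift[OF K] by blast
    obtain L' where L': "L' \<in> ?T" "proj_mat m ` L' = K'" using B_lift[OF K'] by blast
    obtain g where g: "g \<in> ?G" "g ` L = L'" using transT[OF L(1) L'(1)] by blast
    have "g ` K = K'" unfolding L(2)[symmetric] L'(2)[symmetric] equiv[OF g(1) T_line[OF L(1)], symmetric] g(2) ..
    then show ?thesis using g(1) by (rule bexI)
  qed
  let ?phi = "line_action ?T" and ?psi = "\<lambda>g. line_action ?B (restrict g (Herm m))"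
  have phi: "?phi g = (\<lambda>L\<in>?T. g ` L)" for g by (simp add: line_action_def)
  have psi: "?psi g = (\<lambda>L\<in>?B. g ` L)" for g
    unfolding line_action_def
  proof (rule restrict_ext)
    fix L assume "L \<in> ?B"
    then show "restrict g (Herm m) ` L = g ` L" using B_line by (intro image_cong) auto
  qed
  have BV: "L \<subseteq> ?V" if "L \<in> ?B" for L using B_line[OF that] Herm_mono[of m ?n] by auto
  have actT: "transitive_action (BijGroup ?V \<lparr>carrier := ?G\<rparr>) ?T ?phi"
  proof (rule transitive_action.intro)
    show "group_action (BijGroup ?V \<lparr>carrier := ?G\<rparr>) ?T ?phi"
      by (rule group_action_lines[OF subgroup_G_sub[OF m] T_line G_sub_inverse[OF m] closedT phi])
  qed (use transT in \<open>simp add: transitive_action_axioms_def phi\<close>)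
  have actB: "transitive_action (BijGroup ?V \<lparr>carrier := ?G\<rparr>) ?B ?psi"
  proof (rule transitive_action.intro)
    show "group_action (BijGroup ?V \<lparr>carrier := ?G\<rparr>) ?B ?psi"
      by (rule group_action_lines[OF subgroup_G_sub[OF m] BV G_sub_inverse[OF m] closedB psi])
  qed (use transB in \<open>simp add: transitive_action_axioms_def psi\<close>)
  have contT: "continuous_map (prod_topology (top_of_set ?G) (subtopology (proj_topology ?V) ?T))
      (subtopology (proj_topology ?V) ?T) (\<lambda>(g, L). ?phi g L)"
  proof (rule continuous_line_action[where \<G> = ?G and n = ?n and k = ?n and Q = "total_pts m" and \<phi> = ?phi])
    show "?G \<subseteq> GL_on ?V" by (rule GL)
    show "?n \<le> ?n" by simp
    show "g X \<in> ?V" if "g \<in> ?G" "X \<in> ?V" for g X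
      using subsetD[OF GL that(1)] that(2) by (auto simp: GL_on_def Bij_def bij_betw_def)
    show "total_pts m \<subseteq> Herm1 ?n" by (rule TQ)
    show "g ` L \<in> ?T" if "g \<in> ?G" "L \<in> ?T" for g L using closedT[OF that] .
    show "?phi g L = g ` L" if "g \<in> ?G" "L \<in> ?T" for g L unfolding phi using that(2) by simp
  qed
  have contB: "continuous_map (prod_topology (top_of_set ?G) (subtopology (proj_topology (Herm m)) ?B))
      (subtopology (proj_topology (Herm m)) ?B) (\<lambda>(g, L). ?psi g L)"
  proof (rule continuous_line_action[where \<G> = ?G and n = ?n and k = m and Q = "base_pts m" and \<phi> = ?psi])
    show "?G \<subseteq> GL_on ?V" by (rule GL)
    show "m \<le> ?n" by simp
    show "g X \<in> Herm m" if "g \<in> ?G" "X \<in> Herm m" for g X using G_sub_Herm[OF m that] .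
    show "base_pts m \<subseteq> Herm1 m" by (rule BQ)
    show "g ` L \<in> ?B" if "g \<in> ?G" "L \<in> ?B" for g L using closedB[OF that] .
    show "?psi g L = g ` L" if "g \<in> ?G" "L \<in> ?B" for g L unfolding psi using that(2) by simp
  qed
  have fib: "locally_trivial_fibration (subtopology (proj_topology ?V) ?T) (subtopology (proj_topology (Herm m)) ?B)
      (\<lambda>L. proj_mat m ` L)"
    by (rule locally_trivial_fibration_transfer[OF homeomorphic_maps_lines[OF TQ] homeomorphic_maps_lines[OF BQ] _
          fibration_affine[OF m]]) (rule projL)
  have eqv: "proj_mat m ` (?phi g L) = ?psi g (proj_mat m ` L)" if "g \<in> ?G" "L \<in> ?T" for g L
    unfolding phi psi using that pT[OF that(2)] equiv[OF that(1) T_line[OF that(2)]] by simp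
  show ?thesis
    unfolding homogeneous_fibration_def continuous_transitive_action_def E B topE topB
    using actT actB contT contB fib eqv by simp
qed

text \<open>The clause on restrictions records that the transformations of H_n in
  \<open>G_sub n\<close> induce on H_(n-1) exactly the group prescribed there, so that one group
  acts on both spaces.\<close>

theorem mainTheorem3:
  fixes n :: nat
  assumes "n \<in> {1, 2, 3}"
  shows "(\<lambda>L. proj_mat (n - 1) ` L) ` to_proj (Plane n) = to_proj (Sigma_bd (n - 1))
    \<and> (\<lambda>g. restrict g (Herm (n - 1))) ` G_sub n = G_lin (n - 1)
    \<and> homogeneous_fibration (BijGroup (Herm n) \<lparr>carrier := G_sub n\<rparr>)
        (total_space n) (line_action (topspace (total_space n)))
        (base_space (n - 1))
        (\<lambda>g. line_action (topspace (base_space (n - 1))) (restrict g (Herm (n - 1))))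
        (\<lambda>L. proj_mat (n - 1) ` L)"
proof -
  \<comment> \<open>The preceding lemmas are indexed by the level m of the base, with n = m +
    1.\<close>
  define m where "m = n - 1"
  have m: "m \<le> 2" and n: "n = Suc m" using assms by (auto simp: m_def)
  have "(\<lambda>L. proj_mat m ` L) ` to_proj (Plane n) = to_proj (proj_mat m ` Plane n)"
    unfolding to_proj_def image_image proj_mat_span ..
  then have "(\<lambda>L. proj_mat m ` L) ` to_proj (Plane n) = to_proj (Sigma_bd m)"
    unfolding n proj_Plane[OF m] .
  then show ?thesis
    using G_sub_restrict[OF m] homogeneous_fibration_lines[OF m] unfolding m_def[symmetric] n[symmetric] by blast
qed

end
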